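(* $$\mathcal{T}(4,2,2) = \{\{1\}, \{1,2\}, \{1,3\}, \{1,4\}, \{1,2,4\}, \{1,2,5\}\}.$$
   Context: $\mathcal{F}(4,2,2)$ denotes the set of families $F = \{f_1,f_2,f_3,f_4\}$ where each $f_j$ is a homogeneous polynomial over $\mathbb{C}$ in $2$ variables of degree $2$, and no two of the $f_j$ are proportional (two polynomials are proportional if one is a complex scalar multiple of the other; in particular all $f_j$ are nonzero). The ticket of $F$ is $T(F) = \{m \in \mathbb{N} : f_1^m,\dots,f_4^m \text{ are linearly dependent over } \mathbb{C}\}$, where $\mathbb{N}$ denotes the positive integers. Finally, $\mathcal{T}(4,2,2) = \{T(F) : F \in \mathcal{F}(4,2,2)\}$. *)

theory Defs
  imports Complex_Main "HOL-Computational_Algebra.Polynomial"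
begin

text \<open>Polynomials in two variables \<open>x, y\<close> over the complex numbers are elements of
  \<open>C[x][y]\<close>: the coefficient of \<open>x ^ i * y ^ j\<close> in \<open>p\<close> is \<open>coeff (coeff p j) i\<close>.\<close>

type_synonym bipoly = "complex poly poly"

text \<open>The zero polynomial is homogeneous of every degree.\<close>

definition homogeneous :: "nat \<Rightarrow> bipoly \<Rightarrow> bool" where
  "homogeneous d p \<longleftrightarrow> (\<forall>i j. coeff (coeff p j) i \<noteq> 0 \<longrightarrow> i + j = d)"

definition cscale :: "complex \<Rightarrow> bipoly \<Rightarrow> bipoly" where
  "cscale c p = smult [:c:] p"

text \<open>The scalar may be zero, so the zero polynomial is proportional to every polynomial.\<close>

definition proportional :: "bipoly \<Rightarrow> bipoly \<Rightarrow> bool" where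
  "proportional f g \<longleftrightarrow> (\<exists>c. f = cscale c g \<or> g = cscale c f)"

text \<open>\<open>families r d\<close> is \<open>F(r, 2, d)\<close>; the number of variables is fixed by the type.\<close>

definition families :: "nat \<Rightarrow> nat \<Rightarrow> bipoly set set" where
  "families r d = {F. finite F \<and> card F = r \<and> (\<forall>f\<in>F. homogeneous d f) \<and>
     pairwise (\<lambda>f g. \<not> proportional f g) F}"

lemma zero_notin_families:
  assumes "F \<in> families r d" "r \<ge> 2"
  shows "0 \<notin> F"
proof
  assume z: "0 \<in> F"
  have "card (F - {0}) \<noteq> 0"
    using assms z by (simp add: families_def)
  then obtain g where "g \<in> F" "g \<noteq> 0"
    by (metis card.empty Diff_iff ex_in_conv insertI1)
  moreover have "proportional 0 g"
    unfolding proportional_def cscale_def by (intro exI[of _ 0]) simp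
  ultimately show False
    using assms z by (auto simp: families_def pairwise_def)
qed

text \<open>Linear dependence is that of the family of powers indexed by the members of \<open>F\<close>
  (not of the set of powers, in which equal powers would be identified).\<close>

definition ticket :: "bipoly set \<Rightarrow> nat set" where
  "ticket F = {m. m > 0 \<and>
     (\<exists>c :: bipoly \<Rightarrow> complex. (\<exists>f\<in>F. c f \<noteq> 0) \<and> (\<Sum>f\<in>F. cscale (c f) (f ^ m)) = 0)}"

definition tickets :: "nat \<Rightarrow> nat \<Rightarrow> nat set set" where
  "tickets r d = {ticket F | F. F \<in> families r d}"

end

theory Submission
  imports Defs "HOL-Computational_Algebra.Fundamental_Theorem_Algebra"
begin

text \<open>
  A ticket depends only on the coefficient triples of the four forms, so the statement is about
  relations \<open>\<Sum>c\<^sub>i f\<^sub>i\<^sup>m = 0\<close> between powers of four pairwise non-parallel vectors in \<open>C\<^sup>3\<close>.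
  The exponent 1 always occurs, since \<open>C\<^sup>3\<close> has dimension 3. All bounds come from
  two cases.

  \<^bold>\<open>General position\<close> (any three of the four forms are linearly independent). There is one linear
  relation \<open>\<Sum>a\<^sub>i f\<^sub>i = 0\<close>, and no \<open>a\<^sub>i\<close> vanishes. If \<open>\<Sum>c\<^sub>i f\<^sub>i\<^sup>m = 0\<close> with \<open>m \<ge> 3\<close>, then
  differentiating shows that the vectors \<open>(a\<^sub>i)\<close> and \<open>(c\<^sub>i f\<^sub>i ^ (m - 1))\<close> are both orthogonal to \<open>(f\<^sub>i)\<close> and
  \<open>(f\<^sub>i')\<close>. Comparing complementary minors, \<open>a\<^sub>j c\<^sub>i f\<^sub>i ^ (m - 1) - a\<^sub>i c\<^sub>j f\<^sub>j ^ (m - 1)\<close> is a common factor \<open>M\<close> times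
  a Wronskian, and a degree count shows that \<open>M\<close> has a zero on the projective line
  (\<open>singular_point\<close>). With this zero as origin the forms can be normalised to
  \<open>f\<^sub>i = 1 + \<beta>\<^sub>i t + \<eta>\<^sub>i t\<^sup>2\<close> so that \<^emph>\<open>the same\<close> weights satisfy
  \<open>\<Sum>\<alpha>\<^sub>i f\<^sub>i = \<Sum>\<alpha>\<^sub>i f\<^sub>i\<^sup>m = 0\<close> (\<open>balanced_normal_form\<close>).

  Write \<open>\<langle>g\<rangle> = \<Sum>\<alpha>\<^sub>i g\<^sub>i\<close>. The coefficients of \<open>t\<^sup>2\<close>, \<open>t\<^sup>3\<close>, \<open>t\<^sup>4\<close> put the four points \<open>(\<beta>\<^sub>i, \<eta>\<^sub>i)\<close> on a
  parabola, which a change of the coordinate \<open>t\<close> centres: \<open>6\<eta> = (m - 2)(A - \<beta>\<^sup>2)\<close>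
  (\<open>centred_form\<close>). For a second exponent \<open>k \<ge> 2\<close> the coefficients up to \<open>t\<^sup>3\<close> leave only \<open>k = m\<close>
  and \<open>m + 1 = 3k\<close> (\<open>other_exponent\<close>); used in both directions this separates 3, 4, 5 from each
  other and 2 from 3 and 4. The moments \<open>\<langle>\<beta>\<^sup>k\<rangle>\<close> satisfy the recurrence of the quartic with roots
  \<open>\<beta>\<^sub>i\<close>, and the coefficients of \<open>t\<^sup>4, \<dots>, t\<^sup>9\<close> become equations for the coefficients of that quartic.
  They are contradictory for \<open>m \<ge> 6\<close> (\<open>exponent_le_5\<close>), and for \<open>m = 5\<close> they force
  \<open>\<eta> = - \<beta>\<^sup>2/2\<close> and constant \<open>\<beta>\<^sup>4\<close>, when \<open>\<Sum>\<beta>\<^sub>i\<^sup>2 f\<^sub>i\<^sup>2 = 0\<close>, so that 2 accompanies 5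
  (\<open>quintic_square\<close>).

  \<^bold>\<open>Special position\<close> (three of the forms span a pencil). For \<open>m \<ge> 3\<close> the pencil is
  ramified at every zero of the fourth form, which forces coordinates in which the fourth form is
  \<open>X Y\<close> and the pencil is spanned by \<open>X\<^sup>2\<close> and \<open>Y\<^sup>2\<close>. In these coordinates the only possible
  exponent is 4, and the squares of the forms are dependent as well
  (\<open>special_position_exponent\<close>).

  The six possibilities that remain are realised by explicit families.
\<close>

section \<open>Quadratic forms as coefficient triples\<close>

text \<open>The triple \<open>(p, q, r)\<close> stands for the form \<open>p x\<^sup>2 + q x y +
  r y\<^sup>2\<close>.\<close>

type_synonym qform = "complex \<times> complex \<times> complex"

fun quad :: "qform \<Rightarrow> complex \<Rightarrow> complex \<Rightarrow> complex" where
  "quad (p, q, r) x y = p * x\<^sup>2 + q * x * y + r * y\<^sup>2"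

fun det3 :: "qform \<Rightarrow> qform \<Rightarrow> qform \<Rightarrow> complex" where
  "det3 (p1, q1, r1) (p2, q2, r2) (p3, q3, r3) =
     p1 * (q2 * r3 - q3 * r2) - q1 * (p2 * r3 - p3 * r2) + r1 * (p2 * q3 - p3 * q2)"

fun parallel :: "qform \<Rightarrow> qform \<Rightarrow> bool" where
  "parallel (p1, q1, r1) (p2, q2, r2) \<longleftrightarrow>
     p1 * q2 = p2 * q1 \<and> p1 * r2 = p2 * r1 \<and> q1 * r2 = q2 * r1"

definition dependent_powers :: "'i set \<Rightarrow> ('i \<Rightarrow> qform) \<Rightarrow> nat \<Rightarrow> bool" where
  "dependent_powers I v m \<longleftrightarrow>
     (\<exists>c. (\<exists>i\<in>I. c i \<noteq> 0) \<and> (\<forall>x y. (\<Sum>i\<in>I. c i * quad (v i) x y ^ m) = 0))"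

text \<open>The form obtained by putting \<open>a x + b y\<close> for \<open>x\<close> and
  \<open>c x + d y\<close> for \<open>y\<close>.\<close>

fun substitute :: "complex \<Rightarrow> complex \<Rightarrow> complex \<Rightarrow> complex \<Rightarrow> qform \<Rightarrow> qform" where
  "substitute a b c d (p, q, r) =
     (p * a\<^sup>2 + q * a * c + r * c\<^sup>2,
      2 * p * a * b + q * (a * d + b * c) + 2 * r * c * d,
      p * b\<^sup>2 + q * b * d + r * d\<^sup>2)"

lemma quad_substitute:
  "quad (substitute a b c d u) x y = quad u (a * x + b * y) (c * x + d * y)"
  by (cases u) (simp add: algebra_simps power2_eq_square)

lemma substitute_onto:
  assumes "a * d - b * c \<noteq> (0::complex)"
  shows "a * ((d * x - b * y) / (a * d - b * c)) + b * ((a * y - c * x) / (a * d - b * c)) = x"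
    and "c * ((d * x - b * y) / (a * d - b * c)) + d * ((a * y - c * x) / (a * d - b * c)) = y"
proof -
  have "a * (d * x - b * y) + b * (a * y - c * x) = (a * d - b * c) * x"
    "c * (d * x - b * y) + d * (a * y - c * x) = (a * d - b * c) * y"
    by algebra+
  then show "a * ((d * x - b * y) / (a * d - b * c)) + b * ((a * y - c * x) / (a * d - b * c)) = x"
    "c * ((d * x - b * y) / (a * d - b * c)) + d * ((a * y - c * x) / (a * d - b * c)) = y"
    using assms by (simp_all add: times_divide_eq_right flip: add_divide_distrib)
qed

lemma dependent_powers_substitute:
  assumes "a * d - b * c \<noteq> 0"
  shows "dependent_powers I (\<lambda>i. substitute a b c d (v i)) m \<longleftrightarrow> dependent_powers I v m"
proof -
  have "(\<forall>x y. (\<Sum>i\<in>I. k i * quad (substitute a b c d (v i)) x y ^ m) = 0) \<longleftrightarrow>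
    (\<forall>x y. (\<Sum>i\<in>I. k i * quad (v i) x y ^ m) = 0)" for k
    unfolding quad_substitute using substitute_onto[OF assms] by metis
  then show ?thesis
    by (simp add: dependent_powers_def)
qed

text \<open>The determinant of the induced map on the symmetric square is the cube of the
  original one.\<close>

lemma det3_substitute:
  "det3 (substitute a b c d u) (substitute a b c d v) (substitute a b c d w) =
     (a * d - b * c) ^ 3 * det3 u v w"
proof -
  obtain p q r p' q' r' p'' q'' r'' where "u = (p, q, r)" "v = (p', q', r')" "w = (p'', q'', r'')"
    by (metis prod_cases3)
  then show ?thesis
    by (simp add: algebra_simps power2_eq_square power3_eq_cube)
qed

lemma parallel_substitute:
  assumes "a * d - b * c \<noteq> 0" "parallel (substitute a b c d u) (substitute a b c d v)"
  shows "parallel u v"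
proof -
  obtain p q r p' q' r' where [simp]: "u = (p, q, r)" "v = (p', q', r')"
    by (metis prod_cases3)
  let ?D = "a * d - b * c"
  have "?D ^ 3 * (p * q' - p' * q) = 0" "?D ^ 3 * (p * r' - p' * r) = 0"
      "?D ^ 3 * (q * r' - q' * r) = 0"
    using assms(2) unfolding \<open>u = _\<close> \<open>v = _\<close> substitute.simps parallel.simps by algebra+
  then show ?thesis
    using assms(1) by simp
qed

lemma dependent_powers_scale:
  assumes "\<And>i. i \<in> I \<Longrightarrow> s i \<noteq> 0" "\<And>i x y. i \<in> I \<Longrightarrow> quad (v i) x y = s i * quad (w i) x y"
  shows "dependent_powers I v m \<longleftrightarrow> dependent_powers I w m"
proof
  assume "dependent_powers I v m"
  then obtain c where c: "\<exists>i\<in>I. c i \<noteq> 0" "\<And>x y. (\<Sum>i\<in>I. c i * quad (v i) x y ^ m) = 0"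
    by (auto simp: dependent_powers_def)
  have "(\<Sum>i\<in>I. (c i * s i ^ m) * quad (w i) x y ^ m) = 0" for x y
    using c(2)[of x y] by (simp add: assms(2) power_mult_distrib mult.assoc)
  moreover have "\<exists>i\<in>I. c i * s i ^ m \<noteq> 0"
    using c(1) assms(1) by auto
  ultimately show "dependent_powers I w m"
    unfolding dependent_powers_def by (intro exI[of _ "\<lambda>i. c i * s i ^ m"]) blast
next
  assume "dependent_powers I w m"
  then obtain c where c: "\<exists>i\<in>I. c i \<noteq> 0" "\<And>x y. (\<Sum>i\<in>I. c i * quad (w i) x y ^ m) = 0"
    by (auto simp: dependent_powers_def)
  have "(\<Sum>i\<in>I. (c i / s i ^ m) * quad (v i) x y ^ m) = 0" for x y
  proof -
    have "(c i / s i ^ m) * quad (v i) x y ^ m = c i * quad (w i) x y ^ m" if "i \<in> I" for i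
      using assms(1)[OF that] by (simp add: assms(2)[OF that] power_mult_distrib)
    then show ?thesis
      using c(2)[of x y] by simp
  qed
  moreover have "\<exists>i\<in>I. c i / s i ^ m \<noteq> 0"
    using c(1) assms(1) by auto
  ultimately show "dependent_powers I v m"
    unfolding dependent_powers_def by (intro exI[of _ "\<lambda>i. c i / s i ^ m"]) blast
qed

text \<open>The polynomial in \<open>x\<close> obtained by setting \<open>y = 1\<close>.\<close>

fun dehom :: "qform \<Rightarrow> complex poly" where
  "dehom (p, q, r) = [:r, q, p:]"

lemma poly_dehom: "poly (dehom u) t = quad u t 1"
  by (cases u) (simp add: algebra_simps power2_eq_square)

lemma relation_dehom:
  assumes "\<And>x y. (\<Sum>i\<in>I. c i * quad (v i) x y ^ m) = 0"
  shows "(\<Sum>i\<in>I. smult (c i) (dehom (v i) ^ m)) = 0"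
proof -
  have "poly (\<Sum>i\<in>I. smult (c i) (dehom (v i) ^ m)) t = 0" for t
    using assms[of t 1] by (simp add: poly_sum poly_dehom)
  then show ?thesis
    using poly_all_0_iff_0 by blast
qed

lemma relation_coeff:
  assumes "\<And>x y. (\<Sum>i\<in>I. c i * quad (v i) x y ^ m) = 0"
  shows "(\<Sum>i\<in>I. c i * coeff (dehom (v i) ^ m) k) = 0"
proof -
  have "coeff (\<Sum>i\<in>I. smult (c i) (dehom (v i) ^ m)) k = 0"
    using relation_dehom[OF assms] by simp
  then show ?thesis
    by (simp add: coeff_sum)
qed
    
text \<open>The power \<open>g = f\<^sup>m\<close> satisfies \<open>f g' = m f' g\<close>;
  comparing coefficients gives a three-term recurrence, which computes the coefficients of
  \<open>g\<close> with \<open>m\<close> as a parameter.\<close>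

lemma coeff_dehom_power_Suc:
  fixes p q r :: complex and m :: nat
  defines "P \<equiv> \<lambda>k. coeff ([:r, q, p:] ^ m) k"
  shows "r * (of_nat k + 2) * P (Suc (Suc k)) =
     (of_nat m - of_nat k - 1) * q * P (Suc k) + (2 * of_nat m - of_nat k) * p * P k"
proof (cases m)
  case 0
  show ?thesis by (cases k) (simp_all add: P_def 0)
next
  case (Suc n)
  let ?f = "[:r, q, p:]"
  have "?f * pderiv (?f ^ m) = smult (of_nat m) (pderiv ?f * ?f ^ m)"
    unfolding Suc pderiv_power_Suc by (simp add: algebra_simps)
  then have "coeff (?f * pderiv (?f ^ m)) (Suc k) = of_nat m * coeff (pderiv ?f * ?f ^ m) (Suc k)"
    by simp
  moreover have "coeff (?f * pderiv (?f ^ m)) (Suc k) = r * coeff (pderiv (?f ^ m)) (Suc k) +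
      q * coeff (pderiv (?f ^ m)) k + of_nat k * p * P k"
    by (cases k) (simp_all add: mult_pCons_left coeff_pCons coeff_pderiv P_def)
  moreover have "coeff (pderiv ?f * g) (Suc k) = q * coeff g (Suc k) + 2 * p * coeff g k" for g
    by (simp add: pderiv_pCons mult_pCons_left coeff_pCons)
  ultimately have "r * coeff (pderiv (?f ^ m)) (Suc k) + q * coeff (pderiv (?f ^ m)) k +
      of_nat k * p * P k = of_nat m * (q * P (Suc k) + 2 * p * P k)"
    unfolding P_def by metis
  then show ?thesis
    by (simp add: coeff_pderiv P_def algebra_simps)
qed

lemma coeff_dehom_power_0: "coeff ([:r, q, p:] ^ m) 0 = (r::complex) ^ m"
  by (simp add: coeff_0_power)

lemma coeff_dehom_power_1:
  "coeff ([:r, q, p:] ^ m) (Suc 0) = of_nat m * (r::complex) ^ (m - 1) * q"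
proof (induction m)
  case (Suc m)
  then show ?case
    by (cases m) (simp_all add: coeff_pCons coeff_0_power algebra_simps)
qed simp

lemma coeff_dehom_power_2:
  fixes r :: complex
  assumes "m \<ge> 2"
  shows "coeff ([:r, q, p:] ^ m) 2 =
     of_nat m * r ^ (m - 1) * p + of_nat (m choose 2) * r ^ (m - 2) * q\<^sup>2"
  using assms
proof (induction m rule: dec_induct)
  case base
  show ?case
    by (simp add: power2_eq_square coeff_pCons numeral_2_eq_2)
next
  case (step m)
  have ch: "Suc m choose 2 = m + (m choose 2)"
    by (simp add: numeral_2_eq_2)
  define B where "B = m choose 2"
  obtain n where m: "m = Suc (Suc n)"
    using step by (metis add_2_eq_Suc le_Suc_ex)
  have "coeff ([:r, q, p:] ^ Suc m) 2 =
     r * coeff ([:r, q, p:] ^ m) 2 + q * coeff ([:r, q, p:] ^ m) 1 + p * coeff ([:r, q, p:] ^ m) 0"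
    by (simp add: coeff_pCons numeral_2_eq_2)
  then show ?case
    unfolding step.IH ch
    by (simp add: coeff_dehom_power_0 coeff_dehom_power_1 B_def[symmetric])
      (simp add: algebra_simps m power2_eq_square)
qed

section \<open>Four forms in general position\<close>

definition general_position :: "'i set \<Rightarrow> ('i \<Rightarrow> qform) \<Rightarrow> bool" where
  "general_position I v \<longleftrightarrow>
     (\<forall>i\<in>I. \<forall>j\<in>I. \<forall>k\<in>I. distinct [i, j, k] \<longrightarrow> det3 (v i) (v j) (v k) \<noteq> 0)"

lemma card_4_obtain:
  assumes "card I = 4" "l \<in> I"
  obtains i j k where "I = {i, j, k, l}" "distinct [i, j, k, l]"
proof -
  have "card (I - {l}) = 3"
    using assms by (simp add: card_Diff_singleton)
  then obtain i j k where "I - {l} = {i, j, k}" "i \<noteq> j" "i \<noteq> k" "j \<noteq> k"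
    by (auto simp: card_3_iff)
  then show ?thesis
    using assms(2) by (intro that[of i j k]) auto
qed

lemma card_4_elements:
  assumes "card I = 4"
  obtains i j k l where "I = {i, j, k, l}" "distinct [i, j, k, l]"
  using assms card_4_obtain by (metis card.empty ex_in_conv zero_neq_numeral)

lemma det3_relation_trivial:
  assumes "det3 (p1, q1, r1) (p2, q2, r2) (p3, q3, r3) \<noteq> 0"
    and "x1 * p1 + x2 * p2 + x3 * p3 = 0" "x1 * q1 + x2 * q2 + x3 * q3 = 0"
      "x1 * r1 + x2 * r2 + x3 * r3 = 0"
  shows "x1 = 0 \<and> x2 = 0 \<and> x3 = 0"
proof -
  let ?d = "det3 (p1, q1, r1) (p2, q2, r2) (p3, q3, r3)"
  have "x1 * ?d = 0" "x2 * ?d = 0" "x3 * ?d = 0"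
    using assms(2-) unfolding det3.simps by algebra+
  then show ?thesis
    using assms(1) by simp
qed

lemma det3_solve:
  assumes "det3 (p1, q1, r1) (p2, q2, r2) (p3, q3, r3) \<noteq> 0"
  obtains x y z where "x * p1 + y * q1 + z * r1 = g1" "x * p2 + y * q2 + z * r2 = g2"
      "x * p3 + y * q3 + z * r3 = g3"
proof -
  define d where "d = det3 (p1, q1, r1) (p2, q2, r2) (p3, q3, r3)"
  define X where "X = g1 * (q2 * r3 - q3 * r2) - q1 * (g2 * r3 - g3 * r2) + r1 * (g2 * q3 - g3 * q2)"
  define Y where "Y = p1 * (g2 * r3 - g3 * r2) - g1 * (p2 * r3 - p3 * r2) + r1 * (p2 * g3 - p3 * g2)"
  define Z where "Z = p1 * (q2 * g3 - q3 * g2) - q1 * (p2 * g3 - p3 * g2) + g1 * (p2 * q3 - p3 * q2)"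
  have "X * p1 + Y * q1 + Z * r1 = d * g1" "X * p2 + Y * q2 + Z * r2 = d * g2"
    "X * p3 + Y * q3 + Z * r3 = d * g3"
    unfolding X_def Y_def Z_def d_def det3.simps by algebra+
  moreover have "d \<noteq> 0"
    using assms d_def by simp
  ultimately show ?thesis
    by (intro that[of "X / d" "Y / d" "Z / d"]) (simp_all add: field_simps)
qed

text \<open>By Cramer's rule the coefficients of the linear relation are the four \<open>3
  \<times> 3\<close> minors, and none of them vanishes.\<close>

lemma general_position_relation:
  assumes "card I = 4" "general_position I (\<lambda>i. (p i, q i, r i))"
  obtains a where "\<forall>i\<in>I. a i \<noteq> 0" "(\<Sum>i\<in>I. a i * p i) = 0" "(\<Sum>i\<in>I. a i * q i) = 0"
    "(\<Sum>i\<in>I. a i * r i) = 0"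
proof -
  obtain i j k l where I: "I = {i, j, k, l}" and d: "distinct [i, j, k, l]"
    using card_4_elements[OF assms(1)] .
  let ?v = "\<lambda>i. (p i, q i, r i)"
  define a where "a = (\<lambda>_. 0)(i := det3 (?v j) (?v k) (?v l), j := - det3 (?v i) (?v k) (?v l),
     k := det3 (?v i) (?v j) (?v l), l := - det3 (?v i) (?v j) (?v k))"
  have a: "a i = det3 (?v j) (?v k) (?v l)" "a j = - det3 (?v i) (?v k) (?v l)"
     "a k = det3 (?v i) (?v j) (?v l)" "a l = - det3 (?v i) (?v j) (?v k)"
    using d by (auto simp: a_def)
  show ?thesis
  proof
    show "\<forall>i\<in>I. a i \<noteq> 0"
      using assms(2) d unfolding general_position_def I
      by (simp add: a del: det3.simps)
    show "(\<Sum>i\<in>I. a i * p i) = 0" "(\<Sum>i\<in>I. a i * q i) = 0" "(\<Sum>i\<in>I. a i * r i) = 0"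
      using d unfolding I by (simp_all add: a algebra_simps)
  qed
qed

text \<open>Subtracting a multiple of the known relation removes one of the four forms, and the
  other three are independent.\<close>

lemma general_position_relation_unique:
  assumes "card I = 4" "general_position I (\<lambda>i. (p i, q i, r i))" "\<forall>i\<in>I. a i \<noteq> 0"
    and a: "(\<Sum>i\<in>I. a i * p i) = 0" "(\<Sum>i\<in>I. a i * q i) = 0" "(\<Sum>i\<in>I. a i * r i) = 0"
    and g: "(\<Sum>i\<in>I. g i * p i) = 0" "(\<Sum>i\<in>I. g i * q i) = 0" "(\<Sum>i\<in>I. g i * r i) = 0"
  obtains s where "\<forall>i\<in>I. g i = s * a i"
proof -
  obtain i j k l where I: "I = {i, j, k, l}" and d: "distinct [i, j, k, l]"
    using card_4_elements[OF assms(1)] .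
  define s where "s = g l / a l"
  have al: "g l = s * a l"
    using assms(3) by (simp add: s_def I)
  have "(\<Sum>i\<in>I. (g i - s * a i) * p i) = 0" "(\<Sum>i\<in>I. (g i - s * a i) * q i) = 0"
    "(\<Sum>i\<in>I. (g i - s * a i) * r i) = 0"
    using a g by (simp_all add: algebra_simps sum_subtractf flip: sum_distrib_left)
  then have "g i - s * a i = 0 \<and> g j - s * a j = 0 \<and> g k - s * a k = 0"
    using d assms(2) unfolding I general_position_def
    by (intro det3_relation_trivial[of "p i" "q i" "r i" "p j" "q j" "r j" "p k" "q k" "r k"])
      (simp_all add: al add_ac del: det3.simps)
  then show ?thesis
    by (intro that[of s]) (simp add: I al)
qed

text \<open>The vectors \<open>(p\<^sub>i)\<close>, \<open>(q\<^sub>i)\<close>,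
  \<open>(r\<^sub>i)\<close> span the orthogonal complement of \<open>(a\<^sub>i)\<close>:
  interpolate at three indices, and the relation carries the identity over to the fourth.\<close>

lemma general_position_interpolate:
  assumes "card I = 4" "general_position I (\<lambda>i. (p i, q i, r i))" "\<forall>i\<in>I. a i \<noteq> 0"
    and a: "(\<Sum>i\<in>I. a i * p i) = 0" "(\<Sum>i\<in>I. a i * q i) = 0" "(\<Sum>i\<in>I. a i * r i) = 0"
    and g: "(\<Sum>i\<in>I. a i * g i) = 0"
  obtains x y z where "\<forall>i\<in>I. g i = x * p i + y * q i + z * r i"
proof -
  obtain i j k l where I: "I = {i, j, k, l}" and d: "distinct [i, j, k, l]"
    using card_4_elements[OF assms(1)] .
  have "det3 (p i, q i, r i) (p j, q j, r j) (p k, q k, r k) \<noteq> 0"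
    using d assms(2) unfolding I general_position_def by (simp del: det3.simps)
  then obtain x y z where xyz: "x * p i + y * q i + z * r i = g i" "x * p j + y * q j + z * r j = g j"
      "x * p k + y * q k + z * r k = g k"
    using det3_solve by blast
  have "(\<Sum>i\<in>I. a i * (g i - (x * p i + y * q i + z * r i))) =
    (\<Sum>i\<in>I. a i * g i) - x * (\<Sum>i\<in>I. a i * p i) - y * (\<Sum>i\<in>I. a i * q i) - z * (\<Sum>i\<in>I. a i * r i)"
    by (simp add: algebra_simps sum_subtractf sum.distrib sum_distrib_left)
  then have "a l * (g l - (x * p l + y * q l + z * r l)) = 0"
    using d a g xyz unfolding I by simp
  then have "g l = x * p l + y * q l + z * r l"
    using assms(3) I by simp
  then show ?thesis
    using xyz by (intro that[of x y z]) (simp add: I)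
qed

lemma quad_common_zero:
  assumes "quad u x y = 0" "quad v x y = 0" "quad w x y = 0" "(x, y) \<noteq> (0, 0)"
  shows "det3 u v w = 0"
proof (rule ccontr)
  assume d: "det3 u v w \<noteq> 0"
  obtain p1 q1 r1 p2 q2 r2 p3 q3 r3
    where uvw: "u = (p1, q1, r1)" "v = (p2, q2, r2)" "w = (p3, q3, r3)"
    by (metis prod_cases3)
  have "x\<^sup>2 * det3 u v w = 0" "y\<^sup>2 * det3 u v w = 0"
    using assms(1-3) unfolding uvw quad.simps det3.simps by algebra+
  then show False
    using d assms(4) by simp
qed

text \<open>The Wronskian of the two forms is a nonzero polynomial, and a relation between their
  powers, combined with its derivative, would make \<open>s f\<^sup>n\<close> times the
  Wronskian vanish.\<close>

lemma two_powers_independent: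
  assumes "\<not> parallel u v" "m > 0"
    and "\<And>x y. s * quad u x y ^ m + t * quad v x y ^ m = 0"
  shows "s = 0"
proof -
  obtain p1 q1 r1 p2 q2 r2 where uv: "u = (p1, q1, r1)" "v = (p2, q2, r2)"
    by (metis prod_cases3)
  obtain n where m: "m = Suc n"
    using assms(2) gr0_implies_Suc by blast
  define f where "f = dehom u"
  define g where "g = dehom v"
  have *: "smult s (f ^ m) + smult t (g ^ m) = 0"
  proof -
    have "poly (smult s (f ^ m) + smult t (g ^ m)) x = 0" for x
      using assms(3)[of x 1] by (simp add: f_def g_def poly_dehom)
    then show ?thesis
      using poly_all_0_iff_0 by blast
  qed
  then have "pderiv (smult s (f ^ m) + smult t (g ^ m)) = 0"
    by (metis pderiv_0)
  then have **: "smult (of_nat m) (smult s (f ^ n * pderiv f) + smult t (g ^ n * pderiv g)) = 0"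
    by (simp add: m pderiv_add pderiv_smult pderiv_power_Suc smult_add_right mult.commute
        del: of_nat_Suc power_Suc)
  then have **: "smult s (f ^ n * pderiv f) + smult t (g ^ n * pderiv g) = 0"
    using assms(2) by (simp only: smult_eq_0_iff) simp
  let ?W = "f * pderiv g - g * pderiv f"
  have "smult s (f ^ n * ?W) = (smult s (f ^ m) + smult t (g ^ m)) * pderiv g -
     (smult s (f ^ n * pderiv f) + smult t (g ^ n * pderiv g)) * g"
    by (simp add: m algebra_simps smult_diff_right)
  also have "\<dots> = 0"
    by (simp add: * **)
  finally have "smult s (f ^ n * ?W) = 0" .
  moreover have "?W \<noteq> 0"
  proof -
    have "?W = [:r1 * q2 - r2 * q1, 2 * (r1 * p2 - r2 * p1), q1 * p2 - q2 * p1:]"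
      by (simp add: f_def g_def uv pderiv_pCons algebra_simps)
    then show ?thesis
      using assms(1) by (auto simp: uv algebra_simps)
  qed
  moreover have "f \<noteq> 0"
    using assms(1) by (auto simp: f_def uv)
  ultimately show ?thesis
    by simp
qed

lemma smult_sum_right: "smult a (\<Sum>i\<in>I. f i) = (\<Sum>i\<in>I. smult a (f i))"
  by (induction I rule: infinite_finite_induct) (simp_all add: smult_add_right)

lemma relation_derivative:
  assumes "\<And>x y. (\<Sum>i\<in>I. c i * quad (v i) x y ^ Suc n) = 0"
  shows "(\<Sum>i\<in>I. smult (c i) (dehom (v i) ^ n * pderiv (dehom (v i)))) = 0"
proof -
  have "pderiv (\<Sum>i\<in>I. smult (c i) (dehom (v i) ^ Suc n)) = 0"
    using relation_dehom[OF assms] by simp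
  then have "smult (of_nat (Suc n)) (\<Sum>i\<in>I. smult (c i) (dehom (v i) ^ n * pderiv (dehom (v i)))) = 0"
    by (simp add: higher_pderiv_sum[where n = 1, simplified] pderiv_smult pderiv_power_Suc smult_sum_right mult.commute
        del: of_nat_Suc power_Suc)
  then show ?thesis
    by (simp only: smult_eq_0_iff) (simp add: of_nat_eq_0_iff del: of_nat_Suc)
qed

lemma coeff_top_dehom_power: "coeff (dehom u ^ n) (2 * n) = quad u 1 0 ^ n"
proof -
  obtain p q r where u: "u = (p, q, r)" by (metis prod_cases3)
  have deg: "degree (dehom u) \<le> 2" by (simp add: u)
  show ?thesis
  proof (induction n)
    case (Suc n)
    have "degree (dehom u ^ n) \<le> 2 * n"
      by (rule order_trans[OF degree_power_le]) (use deg in simp)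
    then have "coeff (dehom u ^ n) (Suc (2 * n)) = 0" "coeff (dehom u ^ n) (Suc (Suc (2 * n))) = 0"
      by (simp_all add: coeff_eq_0)
    then show ?case
      using Suc by (simp add: u)
  qed simp
qed

text \<open>The combinations \<open>E\<^sub>x = a\<^sub>l c\<^sub>x f\<^sub>x\<^sup>n -
  a\<^sub>x c\<^sub>l f\<^sub>l\<^sup>n\<close> satisfy \<open>\<Sum>E\<^sub>x f\<^sub>x =
  \<Sum>E\<^sub>x f\<^sub>x' = 0\<close> over the three indices other than \<open>l\<close>.
  Hence the vector \<open>(E\<^sub>x)\<close> is a multiple \<open>M W\<close> of the cross
  product \<open>W\<close> of \<open>(f\<^sub>x)\<close> and \<open>(f\<^sub>x')\<close>, where
  \<open>M\<close> is a polynomial because the entries of \<open>W\<close> generate the unit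
  ideal. All \<open>E\<^sub>x\<close> vanish at a root of \<open>M\<close>; if \<open>M\<close>
  has no root, then it is constant, the \<open>E\<^sub>x\<close> have degree at most 2, and they
  vanish at infinity as forms of degree \<open>2 n\<close>.\<close>

lemma singular_point:
  fixes v :: "'i \<Rightarrow> qform"
  assumes I: "card I = 4" and gp: "general_position I v"
    and a: "\<forall>i\<in>I. a i \<noteq> 0" "\<And>x y. (\<Sum>i\<in>I. a i * quad (v i) x y) = 0"
    and c: "\<And>x y. (\<Sum>i\<in>I. c i * quad (v i) x y ^ Suc n) = 0" and n: "n \<ge> 2"
  obtains x y h where "(x, y) \<noteq> (0, 0)" "\<forall>i\<in>I. c i * quad (v i) x y ^ n = h * a i"
proof -
  obtain i j k l where Ieq: "I = {i, j, k, l}" and d: "distinct [i, j, k, l]"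
    using card_4_elements[OF I] .
  define f where "f = (\<lambda>i. dehom (v i))"
  define E where "E = (\<lambda>i. smult (a l * c i) (f i ^ n) - smult (a i * c l) (f l ^ n))"
  have sum4: "(\<Sum>x\<in>I. F x) = F i + F j + F k + F l" for F :: "'i \<Rightarrow> complex poly"
    using d by (simp add: Ieq add_ac)
  have s1: "smult (a i) (f i) + smult (a j) (f j) + smult (a k) (f k) + smult (a l) (f l) = 0"
    using relation_dehom[where I = I and c = a and v = v and m = 1] a(2) unfolding sum4 f_def by simp
  have s2: "smult (a i) (pderiv (f i)) + smult (a j) (pderiv (f j)) + smult (a k) (pderiv (f k)) +
      smult (a l) (pderiv (f l)) = 0"
    using relation_derivative[where I = I and c = a and v = v and n = 0] a(2) unfolding sum4 f_def by simp
  have s3: "smult (c i) (f i ^ Suc n) + smult (c j) (f j ^ Suc n) + smult (c k) (f k ^ Suc n) +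
      smult (c l) (f l ^ Suc n) = 0"
    using relation_dehom[where I = I and c = c and v = v and m = "Suc n"] c unfolding sum4 f_def by simp
  have s4: "smult (c i) (f i ^ n * pderiv (f i)) + smult (c j) (f j ^ n * pderiv (f j)) +
      smult (c k) (f k ^ n * pderiv (f k)) + smult (c l) (f l ^ n * pderiv (f l)) = 0"
    using relation_derivative[where I = I and c = c and v = v and n = n] c unfolding sum4 f_def by simp
  have e1: "E i * f i + E j * f j + E k * f k = 0"
  proof -
    have "E i * f i + E j * f j + E k * f k =
      smult (a l) (smult (c i) (f i ^ Suc n) + smult (c j) (f j ^ Suc n) + smult (c k) (f k ^ Suc n) +
      smult (c l) (f l ^ Suc n)) - smult (c l) (f l ^ n * (smult (a i) (f i) + smult (a j) (f j) +
      smult (a k) (f k) + smult (a l) (f l)))"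
      by (simp add: E_def algebra_simps smult_add_right)
    then show ?thesis
      by (simp only: s1 s3) simp
  qed
  have e2: "E i * pderiv (f i) + E j * pderiv (f j) + E k * pderiv (f k) = 0"
  proof -
    have "E i * pderiv (f i) + E j * pderiv (f j) + E k * pderiv (f k) =
      smult (a l) (smult (c i) (f i ^ n * pderiv (f i)) + smult (c j) (f j ^ n * pderiv (f j)) +
      smult (c k) (f k ^ n * pderiv (f k)) + smult (c l) (f l ^ n * pderiv (f l))) -
      smult (c l) (f l ^ n * (smult (a i) (pderiv (f i)) + smult (a j) (pderiv (f j)) +
      smult (a k) (pderiv (f k)) + smult (a l) (pderiv (f l))))"
      by (simp add: E_def algebra_simps smult_add_right)
    then show ?thesis
      by (simp only: s2 s4) simp
  qed
  define W where "W = (\<lambda>i j. f i * pderiv (f j) - f j * pderiv (f i))"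
  obtain p q r where v: "v = (\<lambda>i. (p i, q i, r i))"
    by (rule that[of "\<lambda>i. fst (v i)" "\<lambda>i. fst (snd (v i))" "\<lambda>i. snd (snd (v i))"]) simp
  have W: "W i j = [:r i * q j - r j * q i, 2 * (r i * p j - r j * p i), q i * p j - q j * p i:]" for i j
    by (simp add: W_def f_def v pderiv_pCons algebra_simps)
  define \<delta> where "\<delta> = det3 (v i) (v j) (v k)"
  have \<delta>0: "\<delta> \<noteq> 0"
    using gp d unfolding general_position_def Ieq \<delta>_def by simp
  \<comment> \<open>The three Wronskians form a basis of the quadratic polynomials.\<close>
  have one: "smult (p i) (W j k) + smult (p j) (W k i) + smult (p k) (W i j) = [:- \<delta>:]"
    by (simp add: W \<delta>_def v algebra_simps)
  have x1: "E i * W k i = E j * W j k"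
  proof -
    have "E i * W k i - E j * W j k = (E i * f i + E j * f j + E k * f k) * (- pderiv (f k)) +
       (E i * pderiv (f i) + E j * pderiv (f j) + E k * pderiv (f k)) * f k"
      by (simp add: W_def algebra_simps)
    then show ?thesis
      by (simp only: e1 e2) simp
  qed
  have x2: "E i * W i j = E k * W j k"
  proof -
    have "E i * W i j - E k * W j k = (E i * f i + E j * f j + E k * f k) * (pderiv (f j)) -
       (E i * pderiv (f i) + E j * pderiv (f j) + E k * pderiv (f k)) * f j"
      by (simp add: W_def algebra_simps)
    then show ?thesis
      by (simp only: e1 e2) simp
  qed
  have x3: "E j * W i j = E k * W k i"
  proof -
    have "E j * W i j - E k * W k i = (E i * f i + E j * f j + E k * f k) * (- pderiv (f i)) +
       (E i * pderiv (f i) + E j * pderiv (f j) + E k * pderiv (f k)) * f i"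
      by (simp add: W_def algebra_simps)
    then show ?thesis
      by (simp only: e1 e2) simp
  qed
  define M where "M = smult (- 1 / \<delta>) (smult (p i) (E i) + smult (p j) (E j) + smult (p k) (E k))"
  have unit: "smult (- 1 / \<delta>) (smult (p i) (W j k) + smult (p j) (W k i) + smult (p k) (W i j)) = 1"
    unfolding one using \<delta>0 by simp
  have M1: "E i = M * W j k"
  proof -
    have "M * W j k = E i * (smult (- 1 / \<delta>) (smult (p i) (W j k) + smult (p j) (W k i) + smult (p k) (W i j)))"
      by (simp add: M_def algebra_simps smult_add_right x1 x2)
    then show ?thesis unfolding unit by simp
  qed
  have M2: "E j = M * W k i"
  proof -
    have "M * W k i = E j * (smult (- 1 / \<delta>) (smult (p i) (W j k) + smult (p j) (W k i) + smult (p k) (W i j)))"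
      by (simp add: M_def algebra_simps smult_add_right x1 x3)
    then show ?thesis unfolding unit by simp
  qed
  have M3: "E k = M * W i j"
  proof -
    have "M * W i j = E k * (smult (- 1 / \<delta>) (smult (p i) (W j k) + smult (p j) (W k i) + smult (p k) (W i j)))"
      by (simp add: M_def algebra_simps smult_add_right x2 x3)
    then show ?thesis unfolding unit by simp
  qed
  have El: "E l = 0"
    by (simp add: E_def)
  have al: "a l \<noteq> 0"
    using a(1) Ieq by simp
  show ?thesis
  proof (cases "\<exists>t. poly M t = 0")
    case True
    then obtain t where t: "poly M t = 0" ..
    have "poly (E x) t = 0" if "x \<in> I" for x
      using that M1 M2 M3 El t by (auto simp: Ieq)
    then have "a l * (c x * quad (v x) t 1 ^ n) = a x * (c l * quad (v l) t 1 ^ n)" if "x \<in> I" for x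
      using that by (simp add: E_def f_def poly_dehom mult.assoc)
    then show ?thesis
      using al by (intro that[of t 1 "c l * quad (v l) t 1 ^ n / a l"]) (simp_all add: field_simps)
  next
    case False
    then have "constant (poly M)"
      using fundamental_theorem_of_algebra by blast
    then obtain \<mu> where \<mu>: "M = [:\<mu>:]"
      using constant_degree degree_eq_zeroE by metis
    have "degree (M * W x y) \<le> 2" for x y
      by (simp add: \<mu> W)
    then have "degree (M * W x y) < 2 * n" for x y
      by (rule le_less_trans) (use n in linarith)
    then have "coeff (M * W x y) (2 * n) = 0" for x y
      by (intro coeff_eq_0)
    then have "coeff (E x) (2 * n) = 0" if "x \<in> I" for x
      using that M1 M2 M3 El by (auto simp: Ieq)
    then have "a l * (c x * quad (v x) 1 0 ^ n) = a x * (c l * quad (v l) 1 0 ^ n)" if "x \<in> I" for x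
      using that by (simp add: E_def f_def coeff_top_dehom_power mult.assoc)
    then show ?thesis
      using al by (intro that[of 1 0 "c l * quad (v l) 1 0 ^ n / a l"]) (simp_all add: field_simps)
  qed
qed

lemma parallel_det3: "parallel u v \<Longrightarrow> det3 u v w = 0"
proof -
  assume p: "parallel u v"
  obtain p q r p' q' r' p'' q'' r'' where uvw: "u = (p, q, r)" "v = (p', q', r')" "w = (p'', q'', r'')"
    by (metis prod_cases3)
  have "det3 u v w = p'' * (q * r' - q' * r) - q'' * (p * r' - p' * r) + r'' * (p * q' - p' * q)"
    by (simp add: uvw algebra_simps)
  then show ?thesis
    using p by (simp add: uvw)
qed

lemma general_position_not_parallel:
  assumes "card I = 4" "general_position I v" "i \<in> I" "j \<in> I" "i \<noteq> j"
  shows "\<not> parallel (v i) (v j)"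
proof
  assume par: "parallel (v i) (v j)"
  obtain a b c where I: "I = {a, b, c, i}" and d: "distinct [a, b, c, i]"
    using card_4_obtain[OF assms(1,3)] .
  define k where "k = (if j = a then b else a)"
  have "k \<in> I" "distinct [i, j, k]"
    using I d assms(5) by (auto simp: k_def)
  then have "det3 (v i) (v j) (v k) \<noteq> 0"
    using assms(2-4) unfolding general_position_def by blast
  then show False
    using parallel_det3[OF par] by simp
qed

text \<open>At most two of the forms vanish at a point, and two powers alone are never
  dependent. This excludes a zero proportionality factor in \<open>singular_point\<close>.\<close>

lemma singular_point_nonzero:
  fixes v :: "'i \<Rightarrow> qform"
  assumes I: "card I = 4" and gp: "general_position I v" and "i0 \<in> I" "c i0 \<noteq> 0"
    and c: "\<And>x y. (\<Sum>i\<in>I. c i * quad (v i) x y ^ m) = 0" and "m > 0"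
    and xy: "(x, y) \<noteq> (0, 0)"
  shows "\<exists>i\<in>I. c i * quad (v i) x y \<noteq> 0"
proof (rule ccontr)
  assume "\<not> ?thesis"
  then have z: "quad (v i) x y = 0" if "i \<in> I" "c i \<noteq> 0" for i
    using that by auto
  obtain i j k where Ieq: "I = {i, j, k, i0}" and d: "distinct [i, j, k, i0]"
    using card_4_obtain[OF I \<open>i0 \<in> I\<close>] .
  have no3: "c a = 0 \<or> c b = 0" if "a \<in> I" "b \<in> I" "distinct [a, b, i0]" for a b
  proof (rule ccontr)
    assume "\<not> ?thesis"
    then have "det3 (v a) (v b) (v i0) = 0"
      using that \<open>i0 \<in> I\<close> \<open>c i0 \<noteq> 0\<close> by (intro quad_common_zero[OF _ _ _ xy] z) auto
    moreover have "det3 (v a) (v b) (v i0) \<noteq> 0"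
      using gp that \<open>i0 \<in> I\<close> unfolding general_position_def by blast
    ultimately show False by simp
  qed
  have sum4: "c i * quad (v i) x y ^ m + (c j * quad (v j) x y ^ m + (c k * quad (v k) x y ^ m +
     c i0 * quad (v i0) x y ^ m)) = 0" for x y
    using c[of x y] d by (simp add: Ieq)
  have "\<exists>a. a \<in> I \<and> a \<noteq> i0 \<and> (\<forall>x y. c i0 * quad (v i0) x y ^ m + c a * quad (v a) x y ^ m = 0)"
  proof (cases "c i = 0")
    case True
    show ?thesis
    proof (cases "c j = 0")
      case True
      show ?thesis
        using sum4 d Ieq True \<open>c i = 0\<close> by (intro exI[of _ k]) (auto simp: add.commute)
    next
      case False
      then have "c k = 0"
        using no3[of j k] d Ieq by auto
      then show ?thesis
        using sum4 d Ieq True by (intro exI[of _ j]) (auto simp: add.commute)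
    qed
  next
    case False
    then have "c j = 0" "c k = 0"
      using no3[of i j] no3[of i k] d Ieq by auto
    then show ?thesis
      using sum4 d Ieq by (intro exI[of _ i]) (auto simp: add.commute)
  qed
  then obtain a where "a \<in> I" "a \<noteq> i0" "\<And>x y. c i0 * quad (v i0) x y ^ m + c a * quad (v a) x y ^ m = 0"
    by blast
  then show False
    using two_powers_independent[of "v i0" "v a" m "c i0" "c a"]
      general_position_not_parallel[OF I gp, of i0 a] \<open>m > 0\<close> \<open>i0 \<in> I\<close> \<open>c i0 \<noteq> 0\<close> by auto
qed

lemma quad_relation_iff:
  "(\<forall>x y. (\<Sum>i\<in>I. a i * quad (p i, q i, r i) x y) = 0) \<longleftrightarrow>
   (\<Sum>i\<in>I. a i * p i) = 0 \<and> (\<Sum>i\<in>I. a i * q i) = 0 \<and> (\<Sum>i\<in>I. a i * r i) = 0"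
proof -
  have eq: "(\<Sum>i\<in>I. a i * quad (p i, q i, r i) x y) = x\<^sup>2 * (\<Sum>i\<in>I. a i * p i) +
     x * y * (\<Sum>i\<in>I. a i * q i) + y\<^sup>2 * (\<Sum>i\<in>I. a i * r i)" for x y
    by (simp add: algebra_simps sum.distrib sum_distrib_left)
  show ?thesis
  proof (intro iffI conjI)
    assume *: "\<forall>x y. (\<Sum>i\<in>I. a i * quad (p i, q i, r i) x y) = 0"
    show p: "(\<Sum>i\<in>I. a i * p i) = 0"
      using *[rule_format, of 1 0] by (simp del: quad.simps add: eq)
    show r: "(\<Sum>i\<in>I. a i * r i) = 0"
      using *[rule_format, of 0 1] by (simp del: quad.simps add: eq)
    show "(\<Sum>i\<in>I. a i * q i) = 0"
      using *[rule_format, of 1 1] p r by (simp del: quad.simps add: eq)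
  qed (simp add: eq del: quad.simps)
qed

section \<open>The normal form of a relation in general position\<close>

text \<open>Forms \<open>\<eta>\<^sub>i x\<^sup>2 + \<beta>\<^sub>i x y + y\<^sup>2\<close> for
  which the same weights \<open>\<alpha>\<^sub>i\<close> give a linear relation and a relation
  between the \<open>m\<close>-th powers.\<close>

locale balanced =
  fixes I :: "'i set" and \<alpha> \<beta> \<eta> :: "'i \<Rightarrow> complex" and m :: nat
  assumes card_I: "card I = 4" and m3: "m \<ge> 3"
    and gp: "general_position I (\<lambda>i. (\<eta> i, \<beta> i, 1))"
    and nonzero: "\<forall>i\<in>I. \<alpha> i \<noteq> 0"
    and sum_\<alpha>: "(\<Sum>i\<in>I. \<alpha> i) = 0" and sum_\<beta>: "(\<Sum>i\<in>I. \<alpha> i * \<beta> i) = 0"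
    and sum_\<eta>: "(\<Sum>i\<in>I. \<alpha> i * \<eta> i) = 0"
    and relation: "\<And>x y. (\<Sum>i\<in>I. \<alpha> i * quad (\<eta> i, \<beta> i, 1) x y ^ m) = 0"

text \<open>Move the point of \<open>singular_point\<close> to \<open>(0, 1)\<close> and divide
  each form by its value there. Since \<open>c\<^sub>i f\<^sub>i ^ (m - 1)\<close> and
  \<open>a\<^sub>i\<close> are proportional at this point, the weights of the two relations
  become proportional.\<close>

lemma balanced_normal_form:
  fixes v :: "'i \<Rightarrow> qform"
  assumes I: "card I = 4" and gp: "general_position I v" and dep: "dependent_powers I v m" and m: "m \<ge> 3"
  obtains \<alpha> \<beta> \<eta> where "balanced I \<alpha> \<beta> \<eta> m"
    "\<And>k. dependent_powers I v k \<longleftrightarrow> dependent_powers I (\<lambda>i. (\<eta> i, \<beta> i, 1)) k"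
proof -
  obtain n where mn: "m = Suc n" and n: "n \<ge> 2"
    using m by (cases m) auto
  obtain c i0 where c: "\<And>x y. (\<Sum>i\<in>I. c i * quad (v i) x y ^ Suc n) = 0" and i0: "i0 \<in> I" "c i0 \<noteq> 0"
    using dep by (auto simp: dependent_powers_def mn)
  obtain p q r where v: "v = (\<lambda>i. (p i, q i, r i))"
    by (rule that[of "\<lambda>i. fst (v i)" "\<lambda>i. fst (snd (v i))" "\<lambda>i. snd (snd (v i))"]) simp
  obtain a where a0: "\<forall>i\<in>I. a i \<noteq> 0" and a: "(\<Sum>i\<in>I. a i * p i) = 0" "(\<Sum>i\<in>I. a i * q i) = 0"
    "(\<Sum>i\<in>I. a i * r i) = 0"
    using general_position_relation[OF I gp[unfolded v]] .
  have a': "(\<Sum>i\<in>I. a i * quad (v i) x y) = 0" for x y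
    using quad_relation_iff[where I = I and a = a and p = p and q = q and r = r] a unfolding v by blast
  obtain x y h where xy: "(x, y) \<noteq> (0, 0)" and h: "\<forall>i\<in>I. c i * quad (v i) x y ^ n = h * a i"
    using singular_point[OF I gp a0 a' c n] by blast
  have "h \<noteq> 0"
  proof
    assume "h = 0"
    then have "\<forall>i\<in>I. c i * quad (v i) x y = 0"
      using h n by auto
    then show False
      using singular_point_nonzero[OF I gp i0 c _ xy] by blast
  qed
  define F where "F = (\<lambda>i. quad (v i) x y)"
  have F0: "F i \<noteq> 0" if "i \<in> I" for i
    using h[rule_format, OF that] a0[rule_format, OF that] \<open>h \<noteq> 0\<close> n by (auto simp: F_def power_0_left)
  obtain u w where uw: "u * y - x * w \<noteq> 0"
  proof (cases "y = 0")
    case True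
    then show ?thesis using xy that[of 0 1] by simp
  next
    case False
    then show ?thesis using that[of 1 0] by simp
  qed
  define W where "W = (\<lambda>i. substitute u x w y (v i))"
  define P Q where "P = (\<lambda>i. fst (W i))" and "Q = (\<lambda>i. fst (snd (W i)))"
  have W: "W i = (P i, Q i, F i)" for i
    by (cases "v i") (simp add: P_def Q_def W_def F_def)
  define \<alpha> \<beta> \<eta> where "\<alpha> = (\<lambda>i. a i * F i)" and "\<beta> = (\<lambda>i. Q i / F i)" and "\<eta> = (\<lambda>i. P i / F i)"
  have scale: "quad (W i) x y = F i * quad (\<eta> i, \<beta> i, 1) x y" if "i \<in> I" for i x y
    using F0[OF that] by (simp add: W \<beta>_def \<eta>_def field_simps)
  have PQ: "P i = F i * \<eta> i" "Q i = F i * \<beta> i" if "i \<in> I" for i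
    using F0[OF that] by (simp_all add: \<beta>_def \<eta>_def)
  have dp: "dependent_powers I v k \<longleftrightarrow> dependent_powers I (\<lambda>i. (\<eta> i, \<beta> i, 1)) k" for k
    using dependent_powers_substitute[OF uw, of I v k]
      dependent_powers_scale[of I F W "\<lambda>i. (\<eta> i, \<beta> i, 1)" k] F0 scale
    by (simp add: W_def)
  have "(\<Sum>i\<in>I. a i * quad (W i) x y) = 0" for x y
    unfolding W_def quad_substitute by (rule a')
  then have aW: "(\<Sum>i\<in>I. a i * P i) = 0" "(\<Sum>i\<in>I. a i * Q i) = 0" "(\<Sum>i\<in>I. a i * F i) = 0"
    using quad_relation_iff[where I = I and a = a and p = P and q = Q and r = F] unfolding W by blast+
  have "balanced I \<alpha> \<beta> \<eta> m"
  proof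
    show "card I = 4" "m \<ge> 3" by fact+
    show "\<forall>i\<in>I. \<alpha> i \<noteq> 0"
      using a0 F0 by (simp add: \<alpha>_def)
    have "\<alpha> i * \<beta> i = a i * Q i" "\<alpha> i * \<eta> i = a i * P i" if "i \<in> I" for i
      using F0[OF that] by (simp_all add: \<alpha>_def \<beta>_def \<eta>_def)
    then show "(\<Sum>i\<in>I. \<alpha> i * \<beta> i) = 0" "(\<Sum>i\<in>I. \<alpha> i * \<eta> i) = 0"
      using aW by (simp_all cong: sum.cong)
    show "(\<Sum>i\<in>I. \<alpha> i) = 0"
      using aW(3) by (simp add: \<alpha>_def)
    show "general_position I (\<lambda>i. (\<eta> i, \<beta> i, 1))"
      unfolding general_position_def
    proof (intro ballI impI)
      fix i j k assume ijk: "i \<in> I" "j \<in> I" "k \<in> I" "distinct [i, j, k]"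
      then have "det3 (W i) (W j) (W k) \<noteq> 0"
        using gp uw unfolding W_def det3_substitute general_position_def by simp
      moreover have "det3 (W i) (W j) (W k) =
          F i * F j * F k * det3 (\<eta> i, \<beta> i, 1) (\<eta> j, \<beta> j, 1) (\<eta> k, \<beta> k, 1)"
        unfolding W PQ[OF ijk(1)] PQ[OF ijk(2)] PQ[OF ijk(3)] det3.simps by algebra
      ultimately show "det3 (\<eta> i, \<beta> i, 1) (\<eta> j, \<beta> j, 1) (\<eta> k, \<beta> k, 1) \<noteq> 0"
        by auto
    qed
    fix x y
    have "\<alpha> i * quad (\<eta> i, \<beta> i, 1) x y ^ m = (c i * quad (W i) x y ^ Suc n) / h" if "i \<in> I" for i
    proof -
      have "h * (\<alpha> i * quad (\<eta> i, \<beta> i, 1) x y ^ m) = (h * a i) * F i * quad (\<eta> i, \<beta> i, 1) x y ^ m"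
        by (simp add: \<alpha>_def)
      also have "\<dots> = c i * quad (W i) x y ^ Suc n"
        using h[rule_format, OF that] by (simp add: scale[OF that] mn power_mult_distrib F_def mult_ac del: quad.simps)
      finally show ?thesis
        using \<open>h \<noteq> 0\<close> by (simp add: field_simps)
    qed
    then have "(\<Sum>i\<in>I. \<alpha> i * quad (\<eta> i, \<beta> i, 1) x y ^ m) = (\<Sum>i\<in>I. c i * quad (W i) x y ^ Suc n) / h"
      by (simp add: sum_divide_distrib)
    also have "\<dots> = 0"
      unfolding W_def quad_substitute c by simp
    finally show "(\<Sum>i\<in>I. \<alpha> i * quad (\<eta> i, \<beta> i, 1) x y ^ m) = 0" .
  qed
  then show ?thesis
    using that dp by blast
qed

lemma coeff_low:
  fixes \<eta> \<beta> :: complex and m :: nat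
  defines "M \<equiv> of_nat m" and "P \<equiv> \<lambda>k. coeff ([:1, \<beta>, \<eta>:] ^ m) k"
  shows "P 0 = 1" "P 1 = M * \<beta>"
    and "2 * P 2 = M * ((M - 1) * \<beta>\<^sup>2 + 2 * \<eta>)"
    and "6 * P 3 = M * (M - 1) * ((M - 2) * \<beta> ^ 3 + 6 * (\<beta> * \<eta>))"
    and "24 * P 4 = M * (M - 1) * ((M - 2) * (M - 3) * \<beta> ^ 4 + 12 * (M - 2) * (\<beta>\<^sup>2 * \<eta>) + 12 * \<eta>\<^sup>2)"
proof -
  show c0: "P 0 = 1"
    by (simp add: P_def coeff_dehom_power_0)
  show c1: "P 1 = M * \<beta>"
    by (simp add: P_def M_def coeff_dehom_power_1)
  have rec: "(of_nat k + 2) * P (Suc (Suc k)) =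
     (M - of_nat k - 1) * \<beta> * P (Suc k) + (2 * M - of_nat k) * \<eta> * P k" for k
    using coeff_dehom_power_Suc[of 1 k \<beta> \<eta> m] by (simp add: P_def M_def)
  show c2: "2 * P 2 = M * ((M - 1) * \<beta>\<^sup>2 + 2 * \<eta>)"
    using rec[of 0] c0 c1 by (simp add: numeral_2_eq_2[symmetric] algebra_simps power2_eq_square)
  have c3: "3 * P 3 = (M - 2) * \<beta> * P 2 + (2 * M - 1) * \<eta> * P 1"
    using rec[of 1] by (simp add: eval_nat_numeral algebra_simps)
  show c3': "6 * P 3 = M * (M - 1) * ((M - 2) * \<beta> ^ 3 + 6 * (\<beta> * \<eta>))"
    using c3 c2 c1 by algebra
  have "4 * P 4 = (M - 3) * \<beta> * P 3 + (2 * M - 2) * \<eta> * P 2"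
    using rec[of 2] by (simp add: eval_nat_numeral algebra_simps)
  then show "24 * P 4 = M * (M - 1) * ((M - 2) * (M - 3) * \<beta> ^ 4 + 12 * (M - 2) * (\<beta>\<^sup>2 * \<eta>) + 12 * \<eta>\<^sup>2)"
    using c3' c2 by algebra
qed

lemma relation_low:
  fixes \<beta> \<eta> :: "'i \<Rightarrow> complex"
  assumes rel: "\<And>x y. (\<Sum>i\<in>I. c i * quad (\<eta> i, \<beta> i, 1) x y ^ m) = 0"
  defines "M \<equiv> of_nat m :: complex"
  shows "(\<Sum>i\<in>I. c i) = 0"
    and "M * (\<Sum>i\<in>I. c i * \<beta> i) = 0"
    and "M * ((M - 1) * (\<Sum>i\<in>I. c i * (\<beta> i)\<^sup>2) + 2 * (\<Sum>i\<in>I. c i * \<eta> i)) = 0"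
    and "M * (M - 1) * ((M - 2) * (\<Sum>i\<in>I. c i * \<beta> i ^ 3) + 6 * (\<Sum>i\<in>I. c i * (\<beta> i * \<eta> i))) = 0"
    and "M * (M - 1) * ((M - 2) * (M - 3) * (\<Sum>i\<in>I. c i * \<beta> i ^ 4) +
      12 * (M - 2) * (\<Sum>i\<in>I. c i * ((\<beta> i)\<^sup>2 * \<eta> i)) + 12 * (\<Sum>i\<in>I. c i * (\<eta> i)\<^sup>2)) = 0"
proof -
  define P where "P = (\<lambda>i k. coeff ([:1, \<beta> i, \<eta> i:] ^ m) k)"
  have P: "(\<Sum>i\<in>I. c i * P i k) = 0" for k
    using relation_coeff[OF rel, of k] by (simp add: P_def)
  have scaled: "(\<Sum>i\<in>I. c i * (N * P i k)) = 0" for N k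
  proof -
    have "(\<Sum>i\<in>I. c i * (N * P i k)) = N * (\<Sum>i\<in>I. c i * P i k)"
      by (simp add: sum_distrib_left mult_ac)
    then show ?thesis by (simp add: P)
  qed
  show "(\<Sum>i\<in>I. c i) = 0"
    using P[of 0] by (simp add: P_def coeff_dehom_power_0)
  show "M * (\<Sum>i\<in>I. c i * \<beta> i) = 0"
    using P[of 1] by (simp add: P_def coeff_dehom_power_1 M_def sum_distrib_left mult_ac)
  have "2 * P i 2 = M * ((M - 1) * (\<beta> i)\<^sup>2 + 2 * \<eta> i)"
    "6 * P i 3 = M * (M - 1) * ((M - 2) * \<beta> i ^ 3 + 6 * (\<beta> i * \<eta> i))"
    "24 * P i 4 = M * (M - 1) * ((M - 2) * (M - 3) * \<beta> i ^ 4 + 12 * (M - 2) * ((\<beta> i)\<^sup>2 * \<eta> i) + 12 * (\<eta> i)\<^sup>2)" for i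
    using coeff_low(3-5)[where m = m and \<beta> = "\<beta> i" and \<eta> = "\<eta> i"] unfolding P_def M_def by blast+
  note low = this[symmetric]
  have "M * ((M - 1) * (\<Sum>i\<in>I. c i * (\<beta> i)\<^sup>2) + 2 * (\<Sum>i\<in>I. c i * \<eta> i)) =
    (\<Sum>i\<in>I. c i * (M * ((M - 1) * (\<beta> i)\<^sup>2 + 2 * \<eta> i)))"
    by (simp add: algebra_simps sum.distrib sum_distrib_left sum_subtractf)
  then show "M * ((M - 1) * (\<Sum>i\<in>I. c i * (\<beta> i)\<^sup>2) + 2 * (\<Sum>i\<in>I. c i * \<eta> i)) = 0"
    unfolding low scaled .
  have "M * (M - 1) * ((M - 2) * (\<Sum>i\<in>I. c i * \<beta> i ^ 3) + 6 * (\<Sum>i\<in>I. c i * (\<beta> i * \<eta> i))) =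
    (\<Sum>i\<in>I. c i * (M * (M - 1) * ((M - 2) * \<beta> i ^ 3 + 6 * (\<beta> i * \<eta> i))))"
  proof -
    have "c i * (M * (M - 1) * ((M - 2) * \<beta> i ^ 3 + 6 * (\<beta> i * \<eta> i))) =
      M * (M - 1) * (M - 2) * (c i * \<beta> i ^ 3) + 6 * M * (M - 1) * (c i * (\<beta> i * \<eta> i))" for i
      by algebra
    note * = this
    show ?thesis
      by (simp only: * sum.distrib flip: sum_distrib_left) algebra
  qed
  then show "M * (M - 1) * ((M - 2) * (\<Sum>i\<in>I. c i * \<beta> i ^ 3) + 6 * (\<Sum>i\<in>I. c i * (\<beta> i * \<eta> i))) = 0"
    unfolding low scaled .
  have "M * (M - 1) * ((M - 2) * (M - 3) * (\<Sum>i\<in>I. c i * \<beta> i ^ 4) +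
      12 * (M - 2) * (\<Sum>i\<in>I. c i * ((\<beta> i)\<^sup>2 * \<eta> i)) + 12 * (\<Sum>i\<in>I. c i * (\<eta> i)\<^sup>2)) =
    (\<Sum>i\<in>I. c i * (M * (M - 1) * ((M - 2) * (M - 3) * \<beta> i ^ 4 + 12 * (M - 2) * ((\<beta> i)\<^sup>2 * \<eta> i) + 12 * (\<eta> i)\<^sup>2)))"
  proof -
    have "c i * (M * (M - 1) * ((M - 2) * (M - 3) * \<beta> i ^ 4 + 12 * (M - 2) * ((\<beta> i)\<^sup>2 * \<eta> i) + 12 * (\<eta> i)\<^sup>2)) =
      M * (M - 1) * (M - 2) * (M - 3) * (c i * \<beta> i ^ 4) +
      12 * M * (M - 1) * (M - 2) * (c i * ((\<beta> i)\<^sup>2 * \<eta> i)) + 12 * M * (M - 1) * (c i * (\<eta> i)\<^sup>2)" for i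
      by algebra
    note * = this
    show ?thesis
      by (simp only: * sum.distrib flip: sum_distrib_left) algebra
  qed
  then show "M * (M - 1) * ((M - 2) * (M - 3) * (\<Sum>i\<in>I. c i * \<beta> i ^ 4) +
      12 * (M - 2) * (\<Sum>i\<in>I. c i * ((\<beta> i)\<^sup>2 * \<eta> i)) + 12 * (\<Sum>i\<in>I. c i * (\<eta> i)\<^sup>2)) = 0"
    unfolding low scaled .
qed

context balanced begin

abbreviation M :: complex where "M \<equiv> of_nat m"

abbreviation avg :: "('i \<Rightarrow> complex) \<Rightarrow> complex" where
  "avg g \<equiv> (\<Sum>i\<in>I. \<alpha> i * g i)"

lemma M_neq: "M \<noteq> 0" "M - 1 \<noteq> 0" "M - 2 \<noteq> 0"
proof -
  have "M \<noteq> of_nat 0" "M \<noteq> of_nat 1" "M \<noteq> of_nat 2"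
    using m3 by (simp_all only: of_nat_eq_iff)
  then show "M \<noteq> 0" "M - 1 \<noteq> 0" "M - 2 \<noteq> 0"
    by simp_all
qed

lemma avg_square: "avg (\<lambda>i. (\<beta> i)\<^sup>2) = 0"
  using relation_low(3)[OF relation] M_neq sum_\<eta> by simp

lemma avg_3: "(M - 2) * avg (\<lambda>i. \<beta> i ^ 3) + 6 * avg (\<lambda>i. \<beta> i * \<eta> i) = 0"
  using relation_low(4)[OF relation] M_neq by simp

lemma avg_4: "(M - 2) * (M - 3) * avg (\<lambda>i. \<beta> i ^ 4) +
      12 * (M - 2) * avg (\<lambda>i. (\<beta> i)\<^sup>2 * \<eta> i) + 12 * avg (\<lambda>i. (\<eta> i)\<^sup>2) = 0"
  using relation_low(5)[OF relation] M_neq by simp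

lemma interpolate:
  assumes "avg g = 0"
  obtains A B C where "\<forall>i\<in>I. g i = A + B * \<beta> i + C * \<eta> i"
proof -
  have "(\<Sum>i\<in>I. \<alpha> i * 1) = 0"
    using sum_\<alpha> by simp
  then obtain x y z where "\<forall>i\<in>I. g i = x * \<eta> i + y * \<beta> i + z * 1"
    using general_position_interpolate[OF card_I gp nonzero sum_\<eta> sum_\<beta> _ assms] by blast
  then show ?thesis
    by (intro that[of z y x]) auto
qed

text \<open>Otherwise the weights annihilate all polynomials of degree at most 2 in
  \<open>\<beta>\<close> and \<open>\<eta>\<close>. But the product of two lines through three
  of the four points, both avoiding the fourth, is such a polynomial, and it is nonzero at the
  fourth point only.\<close>

lemma not_all_conics:
  assumes "avg (\<lambda>i. \<beta> i * \<eta> i) = 0"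
  shows "avg (\<lambda>i. (\<eta> i)\<^sup>2) \<noteq> 0"
proof
  assume z: "avg (\<lambda>i. (\<eta> i)\<^sup>2) = 0"
  obtain i j k l where Ieq: "I = {i, j, k, l}" and d: "distinct [i, j, k, l]"
    using card_4_elements[OF card_I] .
  let ?v = "\<lambda>i. (\<eta> i, \<beta> i, 1)"
  define L where "L = (\<lambda>a b x. det3 (?v a) (?v b) (?v x))"
  have L: "L a b x = (\<eta> a * \<beta> b - \<eta> b * \<beta> a) + (\<eta> b - \<eta> a) * \<beta> x + (\<beta> a - \<beta> b) * \<eta> x" for a b x
    by (simp add: L_def algebra_simps)
  have L0: "L a b a = 0" "L a b b = 0" for a b
    by (simp_all add: L algebra_simps)
  have product: "avg (\<lambda>x. (a0 + a1 * \<beta> x + a2 * \<eta> x) * (b0 + b1 * \<beta> x + b2 * \<eta> x)) = 0" for a0 a1 a2 b0 b1 b2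
  proof -
    have "avg (\<lambda>x. (a0 + a1 * \<beta> x + a2 * \<eta> x) * (b0 + b1 * \<beta> x + b2 * \<eta> x)) =
      a0 * b0 * (\<Sum>i\<in>I. \<alpha> i) + (a0 * b1 + a1 * b0) * avg \<beta> + (a0 * b2 + a2 * b0) * avg \<eta> +
      a1 * b1 * avg (\<lambda>i. (\<beta> i)\<^sup>2) + (a1 * b2 + a2 * b1) * avg (\<lambda>i. \<beta> i * \<eta> i) +
      a2 * b2 * avg (\<lambda>i. (\<eta> i)\<^sup>2)"
      by (simp add: algebra_simps sum.distrib sum_distrib_left power2_eq_square)
    then show ?thesis
      by (simp add: sum_\<alpha> sum_\<beta> sum_\<eta> avg_square assms z)
  qed
  have "avg (\<lambda>x. L i j x * L i k x) = 0"
    unfolding L by (rule product)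
  then have "\<alpha> l * (L i j l * L i k l) = 0"
    using d by (simp add: Ieq L0)
  moreover have "L i j l \<noteq> 0" "L i k l \<noteq> 0"
    using gp d unfolding general_position_def L_def Ieq by (simp_all del: det3.simps)
  ultimately show False
    using nonzero Ieq by simp
qed

lemma avg_linear:
  "avg (\<lambda>i. g i * (A + B * \<beta> i + C * \<eta> i)) =
    A * avg g + B * avg (\<lambda>i. g i * \<beta> i) + C * avg (\<lambda>i. g i * \<eta> i)"
  by (simp add: algebra_simps sum.distrib sum_distrib_left)

lemma avg_cong: "\<forall>i\<in>I. g i = h i \<Longrightarrow> avg g = avg h"
  by (intro sum.cong) auto

text \<open>If the average of \<open>\<beta> \<eta>\<close> vanished, then
  \<open>\<beta>\<^sup>2\<close> and \<open>\<beta> \<eta>\<close> would both be affine in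
  \<open>(\<beta>, \<eta>)\<close>. Multiplying these equations by \<open>\<beta>\<close> and
  \<open>\<beta>\<^sup>2\<close> makes the averages of \<open>\<beta>\<^sup>3\<close>,
  \<open>\<beta>\<^sup>2 \<eta>\<close> and \<open>\<beta>\<^sup>4\<close> vanish, and
  \<open>avg_4\<close> leaves the average of \<open>\<eta>\<^sup>2\<close> zero, against
  \<open>not_all_conics\<close>.\<close>

lemma avg_mixed: "avg (\<lambda>i. \<beta> i * \<eta> i) \<noteq> 0"
proof
  assume y: "avg (\<lambda>i. \<beta> i * \<eta> i) = 0"
  obtain A B C where b2: "\<forall>i\<in>I. (\<beta> i)\<^sup>2 = A + B * \<beta> i + C * \<eta> i"
    using interpolate[OF avg_square] .
  obtain A' B' C' where be: "\<forall>i\<in>I. \<beta> i * \<eta> i = A' + B' * \<beta> i + C' * \<eta> i"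
    using interpolate[OF y] .
  have "avg (\<lambda>i. (\<beta> i)\<^sup>2 * \<eta> i) = avg (\<lambda>i. \<beta> i * (A' + B' * \<beta> i + C' * \<eta> i))"
    using be by (intro avg_cong) (simp add: power2_eq_square)
  then have b2e: "avg (\<lambda>i. (\<beta> i)\<^sup>2 * \<eta> i) = 0"
    using avg_square y sum_\<beta> by (simp add: avg_linear power2_eq_square)
  have "avg (\<lambda>i. \<beta> i ^ 3) = avg (\<lambda>i. \<beta> i * (A + B * \<beta> i + C * \<eta> i))"
    using b2 by (intro avg_cong) (auto simp: power2_eq_square power3_eq_cube)
  then have b3: "avg (\<lambda>i. \<beta> i ^ 3) = 0"
    using avg_square y sum_\<beta> by (simp add: avg_linear power2_eq_square)
  have "avg (\<lambda>i. \<beta> i ^ 4) = avg (\<lambda>i. (\<beta> i)\<^sup>2 * (A + B * \<beta> i + C * \<eta> i))"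
  proof (intro avg_cong ballI)
    fix i assume "i \<in> I"
    then have "(\<beta> i)\<^sup>2 * (\<beta> i)\<^sup>2 = (\<beta> i)\<^sup>2 * (A + B * \<beta> i + C * \<eta> i)"
      using b2 by simp
    then show "\<beta> i ^ 4 = (\<beta> i)\<^sup>2 * (A + B * \<beta> i + C * \<eta> i)"
      by (simp flip: power_add)
  qed
  moreover have cube: "(\<beta> i)\<^sup>2 * \<beta> i = \<beta> i ^ 3" for i
    by (simp add: power2_eq_square power3_eq_cube)
  ultimately have "avg (\<lambda>i. \<beta> i ^ 4) = 0"
    using avg_square b2e b3 unfolding avg_linear cube by simp
  then show False
    using avg_4 b2e not_all_conics[OF y] by simp
qed

text \<open>Since \<open>\<beta>\<^sup>2\<close> averages to zero, it is affine in
  \<open>(\<beta>, \<eta>)\<close>; the coefficient of \<open>\<eta>\<close> is then determined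
  by \<open>avg_3\<close>, because \<open>\<beta> \<eta>\<close> has nonzero average.\<close>

lemma conic:
  obtains A B where "\<forall>i\<in>I. (M - 2) * (\<beta> i)\<^sup>2 = A + B * \<beta> i - 6 * \<eta> i"
proof -
  obtain A B C where b2: "\<forall>i\<in>I. (\<beta> i)\<^sup>2 = A + B * \<beta> i + C * \<eta> i"
    using interpolate[OF avg_square] .
  have "avg (\<lambda>i. \<beta> i ^ 3) = avg (\<lambda>i. \<beta> i * (A + B * \<beta> i + C * \<eta> i))"
    using b2 by (intro avg_cong) (auto simp: power2_eq_square power3_eq_cube)
  then have "avg (\<lambda>i. \<beta> i ^ 3) = C * avg (\<lambda>i. \<beta> i * \<eta> i)"
    using avg_square sum_\<beta> by (simp add: avg_linear power2_eq_square)
  then have "((M - 2) * C + 6) * avg (\<lambda>i. \<beta> i * \<eta> i) = 0"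
    using avg_3 by (simp add: algebra_simps)
  then have "(M - 2) * C = - 6"
    using avg_mixed by (simp add: add_eq_0_iff2)
  then have "\<forall>i\<in>I. (M - 2) * (\<beta> i)\<^sup>2 = (M - 2) * A + (M - 2) * B * \<beta> i - 6 * \<eta> i"
    using b2 by (simp add: distrib_left flip: mult.assoc)
  then show ?thesis
    by (rule that)
qed

end

text \<open>The parabola of \<open>conic\<close> without its linear term in
  \<open>\<beta>\<close>.\<close>

locale centred = balanced +
  fixes A :: complex
  assumes \<eta>_eq: "i \<in> I \<Longrightarrow> \<eta> i = (M - 2) / 6 * (A - (\<beta> i)\<^sup>2)"

text \<open>The substitution \<open>y \<mapsto> s x + y\<close> fixes the point \<open>(0,
  1)\<close>, so it preserves the shape \<open>1 + \<beta> t + \<eta> t\<^sup>2\<close>, and a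
  suitable \<open>s\<close> removes the linear term of the parabola.\<close>

lemma (in balanced) centred_form:
  obtains \<beta>' \<eta>' A where "centred I \<alpha> \<beta>' \<eta>' m A"
    "\<And>k. dependent_powers I (\<lambda>i. (\<eta>' i, \<beta>' i, 1)) k \<longleftrightarrow> dependent_powers I (\<lambda>i. (\<eta> i, \<beta> i, 1)) k"
proof -
  obtain a B where conic: "\<forall>i\<in>I. (M - 2) * (\<beta> i)\<^sup>2 = a + B * \<beta> i - 6 * \<eta> i"
    using conic .
  have "2 * M - 1 \<noteq> 0"
  proof -
    have "of_nat (2 * m) \<noteq> (of_nat 1 :: complex)"
      by (simp only: of_nat_eq_iff) presburger
    then show ?thesis by simp
  qed
  \<comment> \<open>The linear term of the shifted parabola is \<open>B + 4 (M - 2) s + 6 s\<close>.\<close>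
  define s where "s = - B / (2 * (2 * M - 1))"
  define \<beta>' where "\<beta>' = (\<lambda>i. \<beta> i + 2 * s)"
  define \<eta>' where "\<eta>' = (\<lambda>i. \<eta> i + s * \<beta> i + s\<^sup>2)"
  have sub: "substitute 1 0 s 1 (\<eta> i, \<beta> i, 1) = (\<eta>' i, \<beta>' i, 1)" for i
    by (simp add: \<eta>'_def \<beta>'_def mult_ac)
  define A where "A = (a + 4 * (M - 2) * s\<^sup>2 + 6 * s\<^sup>2) / (M - 2)"
  have "centred I \<alpha> \<beta>' \<eta>' m A"
  proof
    show "card I = 4" "m \<ge> 3" "\<forall>i\<in>I. \<alpha> i \<noteq> 0" "(\<Sum>i\<in>I. \<alpha> i) = 0"
      using card_I m3 nonzero sum_\<alpha> by auto
    have "(\<Sum>i\<in>I. \<alpha> i * \<beta>' i) = avg \<beta> + 2 * s * sum \<alpha> I"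
      by (simp add: \<beta>'_def algebra_simps sum.distrib sum_distrib_left sum_distrib_right)
    then show "(\<Sum>i\<in>I. \<alpha> i * \<beta>' i) = 0"
      using sum_\<alpha> sum_\<beta> by simp
    have "(\<Sum>i\<in>I. \<alpha> i * \<eta>' i) = avg \<eta> + s * avg \<beta> + s\<^sup>2 * sum \<alpha> I"
      by (simp add: \<eta>'_def algebra_simps sum.distrib sum_distrib_left sum_distrib_right)
    then show "(\<Sum>i\<in>I. \<alpha> i * \<eta>' i) = 0"
      using sum_\<alpha> sum_\<beta> sum_\<eta> by simp
    show "general_position I (\<lambda>i. (\<eta>' i, \<beta>' i, 1))"
      using gp unfolding general_position_def sub[symmetric] det3_substitute by simp
    show "(\<Sum>i\<in>I. \<alpha> i * quad (\<eta>' i, \<beta>' i, 1) x y ^ m) = 0" for x y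
      unfolding sub[symmetric] quad_substitute by (rule relation)
    fix i assume "i \<in> I"
    then have c: "(M - 2) * (\<beta> i)\<^sup>2 = a + B * \<beta> i - 6 * \<eta> i"
      using conic by blast
    have "2 * (2 * M - 1) * s = - B"
      using \<open>2 * M - 1 \<noteq> 0\<close> by (simp add: s_def)
    moreover have "(M - 2) * A = a + 4 * (M - 2) * s\<^sup>2 + 6 * s\<^sup>2"
      using M_neq by (simp add: A_def)
    ultimately have "6 * \<eta>' i = (M - 2) * (A - (\<beta>' i)\<^sup>2)"
      using c unfolding \<eta>'_def \<beta>'_def by algebra
    then show "\<eta>' i = (M - 2) / 6 * (A - (\<beta>' i)\<^sup>2)"
      by (simp add: mult.commute)
  qed
  moreover have "dependent_powers I (\<lambda>i. (\<eta>' i, \<beta>' i, 1)) k \<longleftrightarrow> dependent_powers I (\<lambda>i. (\<eta> i, \<beta> i, 1)) k" for k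
    using dependent_powers_substitute[of 1 1 0 s I "\<lambda>i. (\<eta> i, \<beta> i, 1)" k] unfolding sub by simp
  ultimately show ?thesis
    by (rule that)
qed

section \<open>Exponents in general position\<close>

text \<open>On the centred parabola the coefficient of \<open>t\<^sup>k\<close> in
  \<open>f\<^sup>m\<close> is an odd or even polynomial in \<open>\<beta>\<close> according to
  the parity of \<open>k\<close>. Its leading term vanishes for \<open>k = 3\<close>; it
  vanishes for \<open>k = 7\<close> and \<open>m = 5\<close> too, which is why 5 behaves
  differently from the larger exponents.\<close>

lemma coeff_centred:
  fixes \<eta> \<beta> A :: complex and m :: nat
  defines "M \<equiv> of_nat m" and "P \<equiv> \<lambda>k. coeff ([:1, \<beta>, \<eta>:] ^ m) k"
  assumes \<eta>: "\<eta> = (M - 2) / 6 * (A - \<beta>\<^sup>2)"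
  shows "72 * P 4 = M * (M - 1) * (M - 2) *
      (- (2 * M - 1) * \<beta> ^ 4 + 4 * (M - 2) * A * \<beta>\<^sup>2 + (M - 2) * A\<^sup>2)"
    and "360 * P 5 = M * (M - 1) * (M - 2) *
      (- (2 * M - 1) * (M - 4) * \<beta> ^ 5 - 10 * (M - 2) * A * \<beta> ^ 3 + 5 * (M - 2)\<^sup>2 * A\<^sup>2 * \<beta>)"
    and "6480 * P 6 = M * (M - 1) * (M - 2) *
      ((2 * M - 1) * (2 * M\<^sup>2 + 7 * M - 40) * \<beta> ^ 6 - 15 * (M - 2) * (2 * M\<^sup>2 - 5 * M - 4) * A * \<beta> ^ 4
       + 15 * (M - 2)\<^sup>2 * (2 * M - 7) * A\<^sup>2 * \<beta>\<^sup>2 + 5 * (M - 2) ^ 3 * A ^ 3)"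
    and "45360 * P 7 = M * (M - 1) * (M - 2) * (M - 3) *
      (8 * (M + 1) * (2 * M - 1) * (M - 5) * \<beta> ^ 7 - 21 * M * (M - 2) * (2 * M - 13) * A * \<beta> ^ 5
       - 210 * (M - 2)\<^sup>2 * A\<^sup>2 * \<beta> ^ 3 + 35 * (M - 2) ^ 3 * A ^ 3 * \<beta>)"
    and "1088640 * P 9 = M * (M - 1) * (M - 2) * (M - 3) * (M - 4) *
      (- 3 * (2 * M + 11) * M * (2 * M - 1) * (M - 6) * \<beta> ^ 9
       + 4 * (M - 2) * (16 * M ^ 3 - 78 * M\<^sup>2 - 213 * M + 70) * A * \<beta> ^ 7
       - 42 * (M - 2)\<^sup>2 * (2 * M\<^sup>2 - 17 * M - 10) * A\<^sup>2 * \<beta> ^ 5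
       - 420 * (M - 2) ^ 3 * A ^ 3 * \<beta> ^ 3 + 35 * (M - 2) ^ 4 * A ^ 4 * \<beta>)"
proof -
  have \<eta>6: "6 * \<eta> = (M - 2) * (A - \<beta>\<^sup>2)"
    using \<eta> by (simp add: mult.commute)
  have rec: "(of_nat k + 2) * P (Suc (Suc k)) =
     (M - of_nat k - 1) * \<beta> * P (Suc k) + (2 * M - of_nat k) * \<eta> * P k" for k
    using coeff_dehom_power_Suc[of 1 k \<beta> \<eta> m] by (simp add: P_def M_def)
  note low = coeff_low[where m = m and \<beta> = \<beta> and \<eta> = \<eta>, folded P_def M_def]
  have p2: "6 * P 2 = M * ((2 * M - 1) * \<beta>\<^sup>2 + (M - 2) * A)"
    using low(3) \<eta>6 by algebra
  have p3: "6 * P 3 = M * (M - 1) * (M - 2) * A * \<beta>"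
    using low(4) \<eta>6 by algebra
  have r4: "4 * P 4 = (M - 3) * \<beta> * P 3 + (2 * M - 2) * \<eta> * P 2"
    using rec[of 2] by (simp add: eval_nat_numeral algebra_simps)
  show p4: "72 * P 4 = M * (M - 1) * (M - 2) *
      (- (2 * M - 1) * \<beta> ^ 4 + 4 * (M - 2) * A * \<beta>\<^sup>2 + (M - 2) * A\<^sup>2)"
  proof -
    have "2 * (72 * P 4) = 6 * (M - 3) * \<beta> * (6 * P 3) + 1 * (2 * M - 2) * (6 * \<eta>) * (6 * P 2)"
      using r4 by algebra
    also have "\<dots> = 2 * (M * (M - 1) * (M - 2) *
      (- (2 * M - 1) * \<beta> ^ 4 + 4 * (M - 2) * A * \<beta>\<^sup>2 + (M - 2) * A\<^sup>2))"
      unfolding p3 p2 \<eta>6 by algebra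
    finally show ?thesis by simp
  qed
  have r5: "5 * P 5 = (M - 4) * \<beta> * P 4 + (2 * M - 3) * \<eta> * P 3"
    using rec[of 3] by (simp add: eval_nat_numeral algebra_simps)
  show p5: "360 * P 5 = M * (M - 1) * (M - 2) *
      (- (2 * M - 1) * (M - 4) * \<beta> ^ 5 - 10 * (M - 2) * A * \<beta> ^ 3 + 5 * (M - 2)\<^sup>2 * A\<^sup>2 * \<beta>)"
  proof -
    have "1 * (360 * P 5) = 1 * (M - 4) * \<beta> * (72 * P 4) + 2 * (2 * M - 3) * (6 * \<eta>) * (6 * P 3)"
      using r5 by algebra
    also have "\<dots> = 1 * (M * (M - 1) * (M - 2) *
      (- (2 * M - 1) * (M - 4) * \<beta> ^ 5 - 10 * (M - 2) * A * \<beta> ^ 3 + 5 * (M - 2)\<^sup>2 * A\<^sup>2 * \<beta>))"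
      unfolding p4 p3 \<eta>6 by algebra
    finally show ?thesis by simp
  qed
  have r6: "6 * P 6 = (M - 5) * \<beta> * P 5 + (2 * M - 4) * \<eta> * P 4"
    using rec[of 4] by (simp add: eval_nat_numeral algebra_simps)
  show p6: "6480 * P 6 = M * (M - 1) * (M - 2) *
      ((2 * M - 1) * (2 * M\<^sup>2 + 7 * M - 40) * \<beta> ^ 6 - 15 * (M - 2) * (2 * M\<^sup>2 - 5 * M - 4) * A * \<beta> ^ 4
       + 15 * (M - 2)\<^sup>2 * (2 * M - 7) * A\<^sup>2 * \<beta>\<^sup>2 + 5 * (M - 2) ^ 3 * A ^ 3)"
  proof -
    have "2 * (6480 * P 6) = 6 * (M - 5) * \<beta> * (360 * P 5) + 5 * (2 * M - 4) * (6 * \<eta>) * (72 * P 4)"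
      using r6 by algebra
    also have "\<dots> = 2 * (M * (M - 1) * (M - 2) *
      ((2 * M - 1) * (2 * M\<^sup>2 + 7 * M - 40) * \<beta> ^ 6 - 15 * (M - 2) * (2 * M\<^sup>2 - 5 * M - 4) * A * \<beta> ^ 4
       + 15 * (M - 2)\<^sup>2 * (2 * M - 7) * A\<^sup>2 * \<beta>\<^sup>2 + 5 * (M - 2) ^ 3 * A ^ 3))"
      unfolding p5 p4 \<eta>6 by algebra
    finally show ?thesis by simp
  qed
  have r7: "7 * P 7 = (M - 6) * \<beta> * P 6 + (2 * M - 5) * \<eta> * P 5"
    using rec[of 5] by (simp add: eval_nat_numeral algebra_simps)
  show p7: "45360 * P 7 = M * (M - 1) * (M - 2) * (M - 3) *
      (8 * (M + 1) * (2 * M - 1) * (M - 5) * \<beta> ^ 7 - 21 * M * (M - 2) * (2 * M - 13) * A * \<beta> ^ 5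
       - 210 * (M - 2)\<^sup>2 * A\<^sup>2 * \<beta> ^ 3 + 35 * (M - 2) ^ 3 * A ^ 3 * \<beta>)"
  proof -
    have "1 * (45360 * P 7) = 1 * (M - 6) * \<beta> * (6480 * P 6) + 3 * (2 * M - 5) * (6 * \<eta>) * (360 * P 5)"
      using r7 by algebra
    also have "\<dots> = 1 * (M * (M - 1) * (M - 2) * (M - 3) *
      (8 * (M + 1) * (2 * M - 1) * (M - 5) * \<beta> ^ 7 - 21 * M * (M - 2) * (2 * M - 13) * A * \<beta> ^ 5
       - 210 * (M - 2)\<^sup>2 * A\<^sup>2 * \<beta> ^ 3 + 35 * (M - 2) ^ 3 * A ^ 3 * \<beta>))"
      unfolding p6 p5 \<eta>6 by algebra
    finally show ?thesis by simp
  qed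
  have r8: "8 * P 8 = (M - 7) * \<beta> * P 7 + (2 * M - 6) * \<eta> * P 6"
    using rec[of 6] by (simp add: eval_nat_numeral algebra_simps)
  have p8: "1088640 * P 8 = M * (M - 1) * (M - 2) * (M - 3) *
      (5 * (2 * M - 1) * (2 * M ^ 3 - 57 * M ^ 2 + 186 * M + 56) * \<beta> ^ 8
       + 56 * (M - 2) * (2 * M ^ 3 + 15 * M ^ 2 - 102 * M + 20) * A * \<beta> ^ 6
       - 210 * (M - 2) ^ 2 * (2 * M ^ 2 - 5 * M - 16) * A ^ 2 * \<beta> ^ 4
       + 280 * (M - 2) ^ 3 * (M - 5) * A ^ 3 * \<beta>\<^sup>2 + 35 * (M - 2) ^ 4 * A ^ 4)"
  proof -
    have "2 * (1088640 * P 8) = 6 * (M - 7) * \<beta> * (45360 * P 7) + 7 * (2 * M - 6) * (6 * \<eta>) * (6480 * P 6)"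
      using r8 by algebra
    also have "\<dots> = 2 * (M * (M - 1) * (M - 2) * (M - 3) *
      (5 * (2 * M - 1) * (2 * M ^ 3 - 57 * M ^ 2 + 186 * M + 56) * \<beta> ^ 8
       + 56 * (M - 2) * (2 * M ^ 3 + 15 * M ^ 2 - 102 * M + 20) * A * \<beta> ^ 6
       - 210 * (M - 2) ^ 2 * (2 * M ^ 2 - 5 * M - 16) * A ^ 2 * \<beta> ^ 4
       + 280 * (M - 2) ^ 3 * (M - 5) * A ^ 3 * \<beta>\<^sup>2 + 35 * (M - 2) ^ 4 * A ^ 4))"
      unfolding p7 p6 \<eta>6 by algebra
    finally show ?thesis by simp
  qed
  have r9: "9 * P 9 = (M - 8) * \<beta> * P 8 + (2 * M - 7) * \<eta> * P 7"
    using rec[of 7] by (simp add: eval_nat_numeral algebra_simps)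
  show "1088640 * P 9 = M * (M - 1) * (M - 2) * (M - 3) * (M - 4) *
      (- 3 * (2 * M + 11) * M * (2 * M - 1) * (M - 6) * \<beta> ^ 9
       + 4 * (M - 2) * (16 * M ^ 3 - 78 * M\<^sup>2 - 213 * M + 70) * A * \<beta> ^ 7
       - 42 * (M - 2)\<^sup>2 * (2 * M\<^sup>2 - 17 * M - 10) * A\<^sup>2 * \<beta> ^ 5
       - 420 * (M - 2) ^ 3 * A ^ 3 * \<beta> ^ 3 + 35 * (M - 2) ^ 4 * A ^ 4 * \<beta>)"
  proof -
    have "9 * (1088640 * P 9) = 1 * (M - 8) * \<beta> * (1088640 * P 8) + 4 * (2 * M - 7) * (6 * \<eta>) * (45360 * P 7)"
      using r9 by algebra
    also have "\<dots> = 9 * (M * (M - 1) * (M - 2) * (M - 3) * (M - 4) *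
      (- 3 * (2 * M + 11) * M * (2 * M - 1) * (M - 6) * \<beta> ^ 9
       + 4 * (M - 2) * (16 * M ^ 3 - 78 * M\<^sup>2 - 213 * M + 70) * A * \<beta> ^ 7
       - 42 * (M - 2)\<^sup>2 * (2 * M\<^sup>2 - 17 * M - 10) * A\<^sup>2 * \<beta> ^ 5
       - 420 * (M - 2) ^ 3 * A ^ 3 * \<beta> ^ 3 + 35 * (M - 2) ^ 4 * A ^ 4 * \<beta>))"
      unfolding p8 p7 \<eta>6 by algebra
    finally show ?thesis by simp
  qed
qed

context centred begin

lemma avg_cube: "avg (\<lambda>i. \<beta> i ^ 3) \<noteq> 0"
  using avg_3 avg_mixed by auto

text \<open>Let \<open>c\<close> be the weights of a relation of exponent \<open>k\<close>. The
  coefficient of \<open>t\<^sup>2\<close>, evaluated on the parabola, is \<open>3 k - m -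
  1\<close> times the \<open>c\<close>-average of \<open>\<beta>\<^sup>2\<close>, up to a
  nonzero factor. If this number is nonzero, then \<open>c\<close> is a multiple of
  \<open>\<alpha>\<close>, and the coefficients of \<open>t\<^sup>3\<close> for the exponents
  \<open>k\<close> and \<open>m\<close> differ by \<open>k - m\<close> times the nonzero average
  of \<open>\<beta>\<^sup>3\<close>.\<close>

lemma other_exponent:
  assumes dep: "dependent_powers I (\<lambda>i. (\<eta> i, \<beta> i, 1)) k" and k: "k \<ge> 2" "k \<noteq> m"
  shows "m + 1 = 3 * k"
proof (rule ccontr)
  assume neq: "m + 1 \<noteq> 3 * k"
  obtain c i0 where c: "\<And>x y. (\<Sum>i\<in>I. c i * quad (\<eta> i, \<beta> i, 1) x y ^ k) = 0" and i0: "i0 \<in> I" "c i0 \<noteq> 0"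
    using dep by (auto simp: dependent_powers_def)
  define K :: complex where "K = of_nat k"
  have K: "K \<noteq> 0" "K - 1 \<noteq> 0" "K - M \<noteq> 0" "3 * K - M - 1 \<noteq> 0"
  proof -
    have "k \<noteq> 0" "k \<noteq> 1" "k \<noteq> m" "3 * k \<noteq> m + 1"
      using k neq by simp_all
    then have "K \<noteq> of_nat 0" "K \<noteq> of_nat 1" "K \<noteq> of_nat m" "of_nat (3 * k) \<noteq> (of_nat (m + 1) :: complex)"
      unfolding K_def of_nat_eq_iff by blast+
    moreover have "of_nat (3 * k) = 3 * K" "of_nat (m + 1) = M + 1"
      by (simp_all add: K_def)
    ultimately show "K \<noteq> 0" "K - 1 \<noteq> 0" "K - M \<noteq> 0" "3 * K - M - 1 \<noteq> 0"
      by (simp_all add: diff_diff_eq add.commute)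
  qed
  have c0: "(\<Sum>i\<in>I. c i) = 0" and c1: "(\<Sum>i\<in>I. c i * \<beta> i) = 0"
    and c2: "(K - 1) * (\<Sum>i\<in>I. c i * (\<beta> i)\<^sup>2) + 2 * (\<Sum>i\<in>I. c i * \<eta> i) = 0"
    and c3: "(K - 2) * (\<Sum>i\<in>I. c i * \<beta> i ^ 3) + 6 * (\<Sum>i\<in>I. c i * (\<beta> i * \<eta> i)) = 0"
    using relation_low(1-4)[OF c] K unfolding K_def[symmetric] by simp_all
  define D where "D = (M - 2) / 6"
  have "(\<Sum>i\<in>I. c i * \<eta> i) = (\<Sum>i\<in>I. D * A * c i - D * (c i * (\<beta> i)\<^sup>2))"
    by (intro sum.cong refl) (simp add: \<eta>_eq D_def[symmetric] algebra_simps)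
  also have "\<dots> = D * A * (\<Sum>i\<in>I. c i) - D * (\<Sum>i\<in>I. c i * (\<beta> i)\<^sup>2)"
    by (simp only: sum_subtractf sum_distrib_left)
  finally have eta: "(\<Sum>i\<in>I. c i * \<eta> i) = - ((M - 2) / 6 * (\<Sum>i\<in>I. c i * (\<beta> i)\<^sup>2))"
    using c0 by (simp add: D_def)
  have "(3 * K - M - 1) * (\<Sum>i\<in>I. c i * (\<beta> i)\<^sup>2) = 0"
  proof -
    have "6 * (\<Sum>i\<in>I. c i * \<eta> i) = - ((M - 2) * (\<Sum>i\<in>I. c i * (\<beta> i)\<^sup>2))"
      unfolding eta by simp
    then show ?thesis
      using c2 by algebra
  qed
  then have "(\<Sum>i\<in>I. c i * \<eta> i) = 0"
    using eta K by simp
  moreover have "(\<Sum>i\<in>I. \<alpha> i * 1) = 0" "(\<Sum>i\<in>I. c i * 1) = 0"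
    using sum_\<alpha> c0 by simp_all
  ultimately obtain s where s: "\<forall>i\<in>I. c i = s * \<alpha> i"
    using general_position_relation_unique[OF card_I gp nonzero sum_\<eta> sum_\<beta> _ _ c1] by blast
  have "s \<noteq> 0"
    using s i0 by auto
  have "(\<Sum>i\<in>I. c i * \<beta> i ^ 3) = s * avg (\<lambda>i. \<beta> i ^ 3)"
    "(\<Sum>i\<in>I. c i * (\<beta> i * \<eta> i)) = s * avg (\<lambda>i. \<beta> i * \<eta> i)"
    using s by (simp_all add: sum_distrib_left mult.assoc)
  then have "s * ((K - 2) * avg (\<lambda>i. \<beta> i ^ 3) + 6 * avg (\<lambda>i. \<beta> i * \<eta> i)) = 0"
    using c3 by (simp add: algebra_simps)
  then have "(K - 2) * avg (\<lambda>i. \<beta> i ^ 3) + 6 * avg (\<lambda>i. \<beta> i * \<eta> i) = 0"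
    using \<open>s \<noteq> 0\<close> by simp
  then have "(K - M) * avg (\<lambda>i. \<beta> i ^ 3) = 0"
    using avg_3 by algebra
  then show False
    using K avg_cube by simp
qed

lemma avg_coeff: "avg (\<lambda>i. N * coeff ([:1, \<beta> i, \<eta> i:] ^ m) k) = 0"
proof -
  have "avg (\<lambda>i. N * coeff ([:1, \<beta> i, \<eta> i:] ^ m) k) = N * avg (\<lambda>i. coeff ([:1, \<beta> i, \<eta> i:] ^ m) k)"
    unfolding sum_distrib_left by (intro sum.cong refl) algebra
  also have "\<dots> = 0"
    using relation_coeff[OF relation, of k] by simp
  finally show ?thesis .
qed

lemma avg_scale_eq_0:
  assumes "avg (\<lambda>i. K * g i) = 0" "K \<noteq> 0"
  shows "avg g = 0"
proof -
  have "avg (\<lambda>i. K * g i) = K * avg g"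
    unfolding sum_distrib_left by (intro sum.cong refl) algebra
  then show ?thesis
    using assms by simp
qed

lemma avg_odd:
  "avg (\<lambda>i. x9 * \<beta> i ^ 9 + x7 * \<beta> i ^ 7 + x5 * \<beta> i ^ 5 + x3 * \<beta> i ^ 3 + x1 * \<beta> i) =
   x9 * avg (\<lambda>i. \<beta> i ^ 9) + x7 * avg (\<lambda>i. \<beta> i ^ 7) + x5 * avg (\<lambda>i. \<beta> i ^ 5) + x3 * avg (\<lambda>i. \<beta> i ^ 3)"
proof -
  have "avg (\<lambda>i. x9 * \<beta> i ^ 9 + x7 * \<beta> i ^ 7 + x5 * \<beta> i ^ 5 + x3 * \<beta> i ^ 3 + x1 * \<beta> i) =
    x9 * avg (\<lambda>i. \<beta> i ^ 9) + x7 * avg (\<lambda>i. \<beta> i ^ 7) + x5 * avg (\<lambda>i. \<beta> i ^ 5) + x3 * avg (\<lambda>i. \<beta> i ^ 3)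
     + x1 * avg \<beta>"
    unfolding sum_distrib_left sum.distrib[symmetric] by (intro sum.cong refl) algebra
  then show ?thesis
    using sum_\<beta> by simp
qed

lemma avg_even:
  "avg (\<lambda>i. x6 * \<beta> i ^ 6 + x4 * \<beta> i ^ 4 + x2 * (\<beta> i)\<^sup>2 + x0) =
   x6 * avg (\<lambda>i. \<beta> i ^ 6) + x4 * avg (\<lambda>i. \<beta> i ^ 4)"
proof -
  have "avg (\<lambda>i. x6 * \<beta> i ^ 6 + x4 * \<beta> i ^ 4 + x2 * (\<beta> i)\<^sup>2 + x0) =
    x6 * avg (\<lambda>i. \<beta> i ^ 6) + x4 * avg (\<lambda>i. \<beta> i ^ 4) + x2 * avg (\<lambda>i. (\<beta> i)\<^sup>2) + x0 * sum \<alpha> I"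
    unfolding sum_distrib_left sum.distrib[symmetric] by (intro sum.cong refl) algebra
  then show ?thesis
    using sum_\<alpha> avg_square by simp
qed

lemma of_nat_linear_neq: "of_nat a * M \<noteq> of_nat b" if "a * m \<noteq> b"
proof -
  have "(of_nat (a * m) :: complex) \<noteq> of_nat b"
    using that unfolding of_nat_eq_iff .
  then show ?thesis by simp
qed

lemma M_odd: "2 * M - 1 \<noteq> 0"
proof -
  have "2 * m \<noteq> 1" by presburger
  then show ?thesis
    using of_nat_linear_neq[of 2 1] by simp
qed

text \<open>The equations \<open>moment_4\<close> to \<open>moment_9\<close> are the
  coefficients of \<open>t\<^sup>4\<close> to \<open>t\<^sup>9\<close> in the relation, after
  cancelling nonzero factors. The averages of \<open>1\<close>, \<open>\<beta>\<close> and
  \<open>\<beta>\<^sup>2\<close> vanish, so only few terms remain.\<close>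

lemma moment_4: "avg (\<lambda>i. \<beta> i ^ 4) = 0"
proof -
  have "avg (\<lambda>i. M * (M - 1) * (M - 2) * (0 * \<beta> i ^ 6 + (- (2 * M - 1)) * \<beta> i ^ 4 +
      4 * (M - 2) * A * (\<beta> i)\<^sup>2 + (M - 2) * A\<^sup>2)) = avg (\<lambda>i. 72 * coeff ([:1, \<beta> i, \<eta> i:] ^ m) 4)"
    by (intro avg_cong ballI) (simp only: coeff_centred(1)[OF \<eta>_eq], algebra)
  then have "avg (\<lambda>i. 0 * \<beta> i ^ 6 + (- (2 * M - 1)) * \<beta> i ^ 4 + 4 * (M - 2) * A * (\<beta> i)\<^sup>2 + (M - 2) * A\<^sup>2) = 0"
    unfolding avg_coeff by (rule avg_scale_eq_0) (use M_neq in simp)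
  then show ?thesis
    unfolding avg_even using M_odd by simp
qed

lemma moment_5: "(2 * M - 1) * (M - 4) * avg (\<lambda>i. \<beta> i ^ 5) + 10 * ((M - 2) * A) * avg (\<lambda>i. \<beta> i ^ 3) = 0"
proof -
  have "avg (\<lambda>i. (- M * (M - 1) * (M - 2)) * (0 * \<beta> i ^ 9 + 0 * \<beta> i ^ 7 + ((2 * M - 1) * (M - 4)) * \<beta> i ^ 5
      + (10 * ((M - 2) * A)) * \<beta> i ^ 3 + (- 5 * (M - 2)\<^sup>2 * A\<^sup>2) * \<beta> i)) =
      avg (\<lambda>i. 360 * coeff ([:1, \<beta> i, \<eta> i:] ^ m) 5)"
    by (intro avg_cong ballI) (simp only: coeff_centred(2)[OF \<eta>_eq], algebra)
  then have "avg (\<lambda>i. 0 * \<beta> i ^ 9 + 0 * \<beta> i ^ 7 + ((2 * M - 1) * (M - 4)) * \<beta> i ^ 5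
      + (10 * ((M - 2) * A)) * \<beta> i ^ 3 + (- 5 * (M - 2)\<^sup>2 * A\<^sup>2) * \<beta> i) = 0"
    unfolding avg_coeff by (rule avg_scale_eq_0) (use M_neq in simp)
  then show ?thesis
    unfolding avg_odd by simp
qed

lemma moment_6: "avg (\<lambda>i. \<beta> i ^ 6) = 0"
proof -
  have "avg (\<lambda>i. M * (M - 1) * (M - 2) * (((2 * M - 1) * (2 * M\<^sup>2 + 7 * M - 40)) * \<beta> i ^ 6 +
      (- 15 * (M - 2) * (2 * M\<^sup>2 - 5 * M - 4) * A) * \<beta> i ^ 4 +
      15 * (M - 2)\<^sup>2 * (2 * M - 7) * A\<^sup>2 * (\<beta> i)\<^sup>2 + 5 * (M - 2) ^ 3 * A ^ 3)) =
      avg (\<lambda>i. 6480 * coeff ([:1, \<beta> i, \<eta> i:] ^ m) 6)"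
    by (intro avg_cong ballI) (simp only: coeff_centred(3)[OF \<eta>_eq], algebra)
  then have "avg (\<lambda>i. ((2 * M - 1) * (2 * M\<^sup>2 + 7 * M - 40)) * \<beta> i ^ 6 +
      (- 15 * (M - 2) * (2 * M\<^sup>2 - 5 * M - 4) * A) * \<beta> i ^ 4 +
      15 * (M - 2)\<^sup>2 * (2 * M - 7) * A\<^sup>2 * (\<beta> i)\<^sup>2 + 5 * (M - 2) ^ 3 * A ^ 3) = 0"
    unfolding avg_coeff by (rule avg_scale_eq_0) (use M_neq in simp)
  then have "(2 * M - 1) * (2 * M\<^sup>2 + 7 * M - 40) * avg (\<lambda>i. \<beta> i ^ 6) = 0"
    unfolding avg_even moment_4 by simp
  \<comment> \<open>The value is \<open>- 1\<close> for the exponent 3 and positive for larger ones.\<close>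
  moreover have "2 * M\<^sup>2 + 7 * M - 40 \<noteq> 0"
  proof -
    have "2 * m\<^sup>2 + 7 * m \<noteq> 40"
    proof (cases "m = 3")
      case False
      then have "4 * 4 \<le> m\<^sup>2" "4 \<le> m"
        using m3 unfolding power2_eq_square by (intro mult_le_mono, simp_all)
      then show ?thesis by linarith
    qed simp
    then have "(of_nat (2 * m\<^sup>2 + 7 * m) :: complex) \<noteq> of_nat 40"
      unfolding of_nat_eq_iff .
    then show ?thesis by simp
  qed
  ultimately show ?thesis
    using M_odd by simp
qed

lemma moment_7:
  assumes "m \<noteq> 3"
  shows "(8 * (M + 1) * (2 * M - 1) * (M - 5)) * avg (\<lambda>i. \<beta> i ^ 7) +
     (- 21 * M * (2 * M - 13) * ((M - 2) * A)) * avg (\<lambda>i. \<beta> i ^ 5) +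
     (- 210 * ((M - 2) * A)\<^sup>2) * avg (\<lambda>i. \<beta> i ^ 3) = 0"
proof -
  have "M - 3 \<noteq> 0"
    using of_nat_linear_neq[of 1 3] assms by simp
  have "avg (\<lambda>i. (M * (M - 1) * (M - 2) * (M - 3)) * (0 * \<beta> i ^ 9 +
      (8 * (M + 1) * (2 * M - 1) * (M - 5)) * \<beta> i ^ 7 + (- 21 * M * (2 * M - 13) * ((M - 2) * A)) * \<beta> i ^ 5
      + (- 210 * ((M - 2) * A)\<^sup>2) * \<beta> i ^ 3 + 35 * (M - 2) ^ 3 * A ^ 3 * \<beta> i)) =
      avg (\<lambda>i. 45360 * coeff ([:1, \<beta> i, \<eta> i:] ^ m) 7)"
    by (intro avg_cong ballI) (simp only: coeff_centred(4)[OF \<eta>_eq], algebra)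
  then have "avg (\<lambda>i. 0 * \<beta> i ^ 9 +
      (8 * (M + 1) * (2 * M - 1) * (M - 5)) * \<beta> i ^ 7 + (- 21 * M * (2 * M - 13) * ((M - 2) * A)) * \<beta> i ^ 5
      + (- 210 * ((M - 2) * A)\<^sup>2) * \<beta> i ^ 3 + 35 * (M - 2) ^ 3 * A ^ 3 * \<beta> i) = 0"
    unfolding avg_coeff by (rule avg_scale_eq_0) (use M_neq \<open>M - 3 \<noteq> 0\<close> in simp)
  then show ?thesis
    unfolding avg_odd by simp
qed

lemma moment_9:
  assumes "m \<noteq> 3" "m \<noteq> 4"
  shows "(- 3 * (2 * M + 11) * M * (2 * M - 1) * (M - 6)) * avg (\<lambda>i. \<beta> i ^ 9)
       + (4 * (16 * M ^ 3 - 78 * M\<^sup>2 - 213 * M + 70) * ((M - 2) * A)) * avg (\<lambda>i. \<beta> i ^ 7)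
       + (- 42 * (2 * M\<^sup>2 - 17 * M - 10) * ((M - 2) * A)\<^sup>2) * avg (\<lambda>i. \<beta> i ^ 5)
       + (- 420 * ((M - 2) * A) ^ 3) * avg (\<lambda>i. \<beta> i ^ 3) = 0"
proof -
  have "M - 3 \<noteq> 0" "M - 4 \<noteq> 0"
    using of_nat_linear_neq[of 1 3] of_nat_linear_neq[of 1 4] assms by simp_all
  have "avg (\<lambda>i. (M * (M - 1) * (M - 2) * (M - 3) * (M - 4)) *
      ((- 3 * (2 * M + 11) * M * (2 * M - 1) * (M - 6)) * \<beta> i ^ 9
       + (4 * (16 * M ^ 3 - 78 * M\<^sup>2 - 213 * M + 70) * ((M - 2) * A)) * \<beta> i ^ 7
       + (- 42 * (2 * M\<^sup>2 - 17 * M - 10) * ((M - 2) * A)\<^sup>2) * \<beta> i ^ 5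
       + (- 420 * ((M - 2) * A) ^ 3) * \<beta> i ^ 3 + 35 * (M - 2) ^ 4 * A ^ 4 * \<beta> i)) =
      avg (\<lambda>i. 1088640 * coeff ([:1, \<beta> i, \<eta> i:] ^ m) 9)"
    by (intro avg_cong ballI) (simp only: coeff_centred(5)[OF \<eta>_eq], algebra)
  then have "avg (\<lambda>i. (- 3 * (2 * M + 11) * M * (2 * M - 1) * (M - 6)) * \<beta> i ^ 9
       + (4 * (16 * M ^ 3 - 78 * M\<^sup>2 - 213 * M + 70) * ((M - 2) * A)) * \<beta> i ^ 7
       + (- 42 * (2 * M\<^sup>2 - 17 * M - 10) * ((M - 2) * A)\<^sup>2) * \<beta> i ^ 5
       + (- 420 * ((M - 2) * A) ^ 3) * \<beta> i ^ 3 + 35 * (M - 2) ^ 4 * A ^ 4 * \<beta> i) = 0"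
    unfolding avg_coeff by (rule avg_scale_eq_0) (use M_neq \<open>M - 3 \<noteq> 0\<close> \<open>M - 4 \<noteq> 0\<close> in simp)
  then show ?thesis
    unfolding avg_odd .
qed

text \<open>The averages of the powers of \<open>\<beta>\<close> obey the recurrence of the
  quartic \<open>z\<^sup>4 - e\<^sub>1 z\<^sup>3 + e\<^sub>2 z\<^sup>2 - e\<^sub>3 z +
  e\<^sub>4\<close> whose roots are the \<open>\<beta>\<^sub>i\<close>. The vanishing averages
  of \<open>\<beta>\<^sup>4\<close> and \<open>\<beta>\<^sup>6\<close> give \<open>e\<^sub>1 =
  e\<^sub>3 = 0\<close>.\<close>

lemma quartic:
  obtains e2 e4 where "\<forall>i\<in>I. \<beta> i ^ 4 = - e2 * (\<beta> i)\<^sup>2 - e4"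
    "(\<Sum>i\<in>I. \<beta> i) = 0" "(\<Sum>i\<in>I. (\<beta> i)\<^sup>2) = - 2 * e2" "(\<Sum>i\<in>I. \<beta> i ^ 3) = 0"
    "avg (\<lambda>i. \<beta> i ^ 5) = - e2 * avg (\<lambda>i. \<beta> i ^ 3)"
    "avg (\<lambda>i. \<beta> i ^ 7) = (e2\<^sup>2 - e4) * avg (\<lambda>i. \<beta> i ^ 3)"
    "avg (\<lambda>i. \<beta> i ^ 9) = (2 * e2 * e4 - e2 ^ 3) * avg (\<lambda>i. \<beta> i ^ 3)"
proof -
  obtain a b c d where Ieq: "I = {a, b, c, d}" and dist: "distinct [a, b, c, d]"
    using card_4_elements[OF card_I] .
  define e1 e2 e3 e4 where "e1 = \<beta> a + \<beta> b + \<beta> c + \<beta> d"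
    and "e2 = \<beta> a * \<beta> b + \<beta> a * \<beta> c + \<beta> a * \<beta> d + \<beta> b * \<beta> c + \<beta> b * \<beta> d + \<beta> c * \<beta> d"
    and "e3 = \<beta> a * \<beta> b * \<beta> c + \<beta> a * \<beta> b * \<beta> d + \<beta> a * \<beta> c * \<beta> d + \<beta> b * \<beta> c * \<beta> d"
    and "e4 = \<beta> a * \<beta> b * \<beta> c * \<beta> d"
  have "\<beta> a ^ 4 = e1 * \<beta> a ^ 3 - e2 * (\<beta> a)\<^sup>2 + e3 * \<beta> a - e4"
    "\<beta> b ^ 4 = e1 * \<beta> b ^ 3 - e2 * (\<beta> b)\<^sup>2 + e3 * \<beta> b - e4"
    "\<beta> c ^ 4 = e1 * \<beta> c ^ 3 - e2 * (\<beta> c)\<^sup>2 + e3 * \<beta> c - e4"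
    "\<beta> d ^ 4 = e1 * \<beta> d ^ 3 - e2 * (\<beta> d)\<^sup>2 + e3 * \<beta> d - e4"
    unfolding e1_def e2_def e3_def e4_def by algebra+
  then have root: "\<beta> i ^ 4 = e1 * \<beta> i ^ 3 - e2 * (\<beta> i)\<^sup>2 + e3 * \<beta> i - e4" if "i \<in> I" for i
    using that Ieq by auto
  have newton: "avg (\<lambda>i. \<beta> i ^ (k + 4)) = e1 * avg (\<lambda>i. \<beta> i ^ (k + 3)) - e2 * avg (\<lambda>i. \<beta> i ^ (k + 2)) +
      e3 * avg (\<lambda>i. \<beta> i ^ (k + 1)) - e4 * avg (\<lambda>i. \<beta> i ^ k)" for k
  proof -
    have "avg (\<lambda>i. \<beta> i ^ (k + 4)) = (\<Sum>i\<in>I. e1 * (\<alpha> i * \<beta> i ^ (k + 3)) - e2 * (\<alpha> i * \<beta> i ^ (k + 2)) +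
      e3 * (\<alpha> i * \<beta> i ^ (k + 1)) - e4 * (\<alpha> i * \<beta> i ^ k))"
      by (intro sum.cong refl) (simp only: power_add root, simp add: algebra_simps power2_eq_square power3_eq_cube)
    then show ?thesis
      by (simp only: sum.distrib sum_subtractf sum_distrib_left)
  qed
  define s where "s = (\<lambda>k::nat. avg (\<lambda>i. \<beta> i ^ k))"
  have newton: "s (k + 4) = e1 * s (k + 3) - e2 * s (k + 2) + e3 * s (k + 1) - e4 * s k" for k
    unfolding s_def by (rule newton)
  have s: "s 0 = 0" "s 1 = 0" "s 2 = 0" "s 4 = 0" "s 6 = 0" "s 3 \<noteq> 0"
    using sum_\<alpha> sum_\<beta> avg_square moment_4 moment_6 avg_cube by (simp_all add: s_def)
  have "e1 * s 3 = 0"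
    using newton[of 0] s by (simp add: numeral_2_eq_2[symmetric])
  then have e1: "e1 = 0"
    using s by simp
  have s5': "s 5 = - e2 * s 3"
    using newton[of 1] s e1 by (simp add: numeral_2_eq_2[symmetric])
  have "e3 * s 3 = 0"
    using newton[of 2] s e1 by (simp add: numeral_2_eq_2[symmetric])
  then have e3: "e3 = 0"
    using s by simp
  have s7': "s 7 = (e2\<^sup>2 - e4) * s 3"
    using newton[of 3] s5' e1 e3 by (simp add: power2_eq_square algebra_simps)
  have s9': "s 9 = (2 * e2 * e4 - e2 ^ 3) * s 3"
    using newton[of 5] s5' s7' e1 e3 by (simp add: power2_eq_square power3_eq_cube algebra_simps)
  note s5 = s5'[unfolded s_def] and s7 = s7'[unfolded s_def] and s9 = s9'[unfolded s_def]
  show ?thesis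
  proof (rule that[OF _ _ _ _ s5 s7 s9])
    show "\<forall>i\<in>I. \<beta> i ^ 4 = - e2 * (\<beta> i)\<^sup>2 - e4"
      using root e1 e3 by simp
    have sums: "(\<Sum>i\<in>I. g i) = g a + g b + g c + g d" for g :: "'a \<Rightarrow> complex"
      using dist by (simp add: Ieq)
    show "(\<Sum>i\<in>I. \<beta> i) = 0"
      using e1 by (simp add: sums e1_def)
    show "(\<Sum>i\<in>I. (\<beta> i)\<^sup>2) = - 2 * e2"
      using e1 unfolding sums e1_def e2_def by algebra
    show "(\<Sum>i\<in>I. \<beta> i ^ 3) = 0"
      using e1 e3 unfolding sums e1_def e3_def by algebra
  qed
qed

text \<open>For \<open>m \<ge> 6\<close> the equations \<open>moment_5\<close> and
  \<open>moment_7\<close> determine \<open>e\<^sub>2\<close> and \<open>e\<^sub>4\<close> from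
  \<open>A\<close>. After substitution \<open>moment_9\<close> is a rational function of
  \<open>m\<close> times \<open>A\<^sup>3\<close>, and the numerator splits into linear factors,
  none of which vanishes at an integer above 4. So \<open>A = 0\<close>, the quartic is
  \<open>z\<^sup>4\<close>, and all \<open>\<beta>\<^sub>i\<close> vanish, which is absurd.\<close>

lemma exponent_le_5: "m \<le> 5"
proof (rule ccontr)
  assume "\<not> m \<le> 5"
  then have m: "m \<noteq> 3" "m \<noteq> 4" "m \<noteq> 5"
    by auto
  have M: "M - 4 \<noteq> 0" "M - 5 \<noteq> 0" "M + 1 \<noteq> 0" "2 * M + 11 \<noteq> 0" "2 * M - 3 \<noteq> 0"
  proof -
    show "M - 4 \<noteq> 0" "M - 5 \<noteq> 0"
      using of_nat_linear_neq[of 1 4] of_nat_linear_neq[of 1 5] m by simp_all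
    have "of_nat (m + 1) \<noteq> (0 :: complex)" "of_nat (2 * m + 11) \<noteq> (0 :: complex)"
      by (simp_all only: of_nat_eq_0_iff)
    then show "M + 1 \<noteq> 0" "2 * M + 11 \<noteq> 0"
      by (simp_all add: add.commute)
    have "2 * m \<noteq> 3" by presburger
    then show "2 * M - 3 \<noteq> 0"
      using of_nat_linear_neq[of 2 3] by simp
  qed
  obtain e2 e4 where q: "\<forall>i\<in>I. \<beta> i ^ 4 = - e2 * (\<beta> i)\<^sup>2 - e4"
    and p1: "(\<Sum>i\<in>I. \<beta> i) = 0" and p2: "(\<Sum>i\<in>I. (\<beta> i)\<^sup>2) = - 2 * e2" and p3: "(\<Sum>i\<in>I. \<beta> i ^ 3) = 0"
    and s5: "avg (\<lambda>i. \<beta> i ^ 5) = - e2 * avg (\<lambda>i. \<beta> i ^ 3)"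
    and s7: "avg (\<lambda>i. \<beta> i ^ 7) = (e2\<^sup>2 - e4) * avg (\<lambda>i. \<beta> i ^ 3)"
    and s9: "avg (\<lambda>i. \<beta> i ^ 9) = (2 * e2 * e4 - e2 ^ 3) * avg (\<lambda>i. \<beta> i ^ 3)"
    using quartic .
  let ?s = "avg (\<lambda>i. \<beta> i ^ 3)"
  \<comment> \<open>The solution will be \<open>e2 = 10 \<kappa>\<close> and \<open>(M - 5) (e2\<^sup>2 - e4) = 105 (M - 4) \<kappa>\<^sup>2\<close>.\<close>
  define \<kappa> where "\<kappa> = A * (M - 2) / ((2 * M - 1) * (M - 4))"
  have A: "(M - 2) * A = \<kappa> * ((2 * M - 1) * (M - 4))"
    using M M_odd by (simp add: \<kappa>_def mult.commute)
  have "?s * ((2 * M - 1) * (M - 4) * (10 * \<kappa> - e2)) =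
      (2 * M - 1) * (M - 4) * (- e2 * ?s) + 10 * (\<kappa> * ((2 * M - 1) * (M - 4))) * ?s"
    by algebra
  also have "\<dots> = 0"
    using moment_5 unfolding s5 A .
  finally have e2: "e2 = 10 * \<kappa>"
    using M M_odd avg_cube by simp
  define S where "S = e2\<^sup>2 - e4"
  have S_eq: "(10 * \<kappa>)\<^sup>2 - e4 = S"
    by (simp add: S_def e2)
  have "?s * (8 * (M + 1) * (2 * M - 1) * ((M - 5) * S - 105 * (M - 4) * \<kappa>\<^sup>2)) =
     (8 * (M + 1) * (2 * M - 1) * (M - 5)) * (S * ?s) +
     (- 21 * M * (2 * M - 13) * (\<kappa> * ((2 * M - 1) * (M - 4)))) * (- (10 * \<kappa>) * ?s) +
     (- 210 * (\<kappa> * ((2 * M - 1) * (M - 4)))\<^sup>2) * ?s"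
    by algebra
  also have "\<dots> = 0"
    using moment_7[OF m(1)] unfolding s5 s7 e2 S_eq A .
  finally have "(M - 5) * S - 105 * (M - 4) * \<kappa>\<^sup>2 = 0"
    using M M_odd avg_cube zero_neq_numeral[symmetric, where 'a = complex]
    by (simp only: mult_eq_0_iff simp_thms)
  then have S: "(M - 5) * S = 105 * (M - 4) * \<kappa>\<^sup>2"
    by simp
  have s9': "2 * (10 * \<kappa>) * e4 - (10 * \<kappa>) ^ 3 = 1000 * \<kappa> ^ 3 - 20 * \<kappa> * S"
    unfolding S_eq[symmetric] by algebra
  have m9: "(- 3 * (2 * M + 11) * M * (2 * M - 1) * (M - 6)) * ((1000 * \<kappa> ^ 3 - 20 * \<kappa> * S) * ?s)
       + (4 * (16 * M ^ 3 - 78 * M\<^sup>2 - 213 * M + 70) * (\<kappa> * ((2 * M - 1) * (M - 4)))) * (S * ?s)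
       + (- 42 * (2 * M\<^sup>2 - 17 * M - 10) * (\<kappa> * ((2 * M - 1) * (M - 4)))\<^sup>2) * (- (10 * \<kappa>) * ?s)
       + (- 420 * (\<kappa> * ((2 * M - 1) * (M - 4))) ^ 3) * ?s = 0"
    using moment_9[OF m(1,2)] unfolding s5 s7 s9 e2 s9' S_eq A .
  have "?s * ((- 240) * (2 * M + 11) * M * (2 * M - 1) * (M + 1) * (2 * M - 3) * \<kappa> ^ 3) =
      ?s * ((- 3 * (2 * M + 11) * M * (2 * M - 1) * (M - 6)) * (1000 * \<kappa> ^ 3 * (M - 5) - 20 * \<kappa> * (105 * (M - 4) * \<kappa>\<^sup>2))
       + (4 * (16 * M ^ 3 - 78 * M\<^sup>2 - 213 * M + 70) * (\<kappa> * ((2 * M - 1) * (M - 4)))) * (105 * (M - 4) * \<kappa>\<^sup>2)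
       + (- 42 * (2 * M\<^sup>2 - 17 * M - 10) * (\<kappa> * ((2 * M - 1) * (M - 4)))\<^sup>2) * (- (10 * \<kappa>) * (M - 5))
       + (- 420 * (\<kappa> * ((2 * M - 1) * (M - 4))) ^ 3) * (M - 5))"
    by algebra
  also have "\<dots> = (M - 5) *
     ((- 3 * (2 * M + 11) * M * (2 * M - 1) * (M - 6)) * ((1000 * \<kappa> ^ 3 - 20 * \<kappa> * S) * ?s)
       + (4 * (16 * M ^ 3 - 78 * M\<^sup>2 - 213 * M + 70) * (\<kappa> * ((2 * M - 1) * (M - 4)))) * (S * ?s)
       + (- 42 * (2 * M\<^sup>2 - 17 * M - 10) * (\<kappa> * ((2 * M - 1) * (M - 4)))\<^sup>2) * (- (10 * \<kappa>) * ?s)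
       + (- 420 * (\<kappa> * ((2 * M - 1) * (M - 4))) ^ 3) * ?s)"
    unfolding S[symmetric] by algebra
  also have "\<dots> = 0"
    unfolding m9 by simp
  finally have "\<kappa> ^ 3 = 0"
    using M M_odd M_neq avg_cube zero_neq_numeral[symmetric, where 'a = complex]
    by (simp only: mult_eq_0_iff neg_equal_0_iff_equal simp_thms)
  then have "\<kappa> = 0"
    by simp
  then have "e2 = 0" "e4 = 0"
    using e2 S M by (simp_all add: S_def)
  then have "\<beta> i = 0" if "i \<in> I" for i
    using q that by simp
  then show False
    using avg_cube by simp
qed

text \<open>For \<open>m = 5\<close> the leading coefficient of \<open>moment_7\<close> is zero,
  and what remains forces \<open>A = 0\<close>. The quartic is then \<open>z\<^sup>4 +
  e\<^sub>4\<close>, so all odd power sums of the \<open>\<beta>\<^sub>i\<close>, and those of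
  exponents 2 and 6, vanish; the coefficients of \<open>\<Sum>\<beta>\<^sub>i\<^sup>2
  f\<^sub>i\<^sup>2\<close> are multiples of such sums.\<close>

lemma quintic_square:
  assumes m: "m = 5"
  shows "dependent_powers I (\<lambda>i. (\<eta> i, \<beta> i, 1)) 2"
proof -
  obtain e2 e4 where q: "\<forall>i\<in>I. \<beta> i ^ 4 = - e2 * (\<beta> i)\<^sup>2 - e4"
    and p1: "(\<Sum>i\<in>I. \<beta> i) = 0" and p2: "(\<Sum>i\<in>I. (\<beta> i)\<^sup>2) = - 2 * e2" and p3: "(\<Sum>i\<in>I. \<beta> i ^ 3) = 0"
    and s5: "avg (\<lambda>i. \<beta> i ^ 5) = - e2 * avg (\<lambda>i. \<beta> i ^ 3)"
    and s7: "avg (\<lambda>i. \<beta> i ^ 7) = (e2\<^sup>2 - e4) * avg (\<lambda>i. \<beta> i ^ 3)"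
    and s9: "avg (\<lambda>i. \<beta> i ^ 9) = (2 * e2 * e4 - e2 ^ 3) * avg (\<lambda>i. \<beta> i ^ 3)"
    using quartic .
  let ?s = "avg (\<lambda>i. \<beta> i ^ 3)"
  have M: "M = 5" using m by simp
  have "?s * (30 * A - 9 * e2) = (2 * 5 - 1) * (5 - 4) * (- e2 * ?s) + 10 * ((5 - 2) * A) * ?s"
    by algebra
  also have "\<dots> = 0"
    using moment_5 unfolding s5 M .
  finally have "30 * A - 9 * e2 = 0"
    using avg_cube by simp
  then have e2A: "9 * e2 = 30 * A"
    by simp
  have "?s * (- 5040 * A\<^sup>2) =
    (8 * (5 + 1) * (2 * 5 - 1) * (5 - 5)) * ((e2\<^sup>2 - e4) * ?s) +
     (- 35 * (2 * 5 - 13) * ((5 - 2) * A)) * (- (9 * e2) * ?s) * (1 / 3) + (- 210 * ((5 - 2) * A)\<^sup>2) * ?s"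
    unfolding e2A by (simp add: power2_eq_square)
  also have "\<dots> = (8 * (5 + 1) * (2 * 5 - 1) * (5 - 5)) * ((e2\<^sup>2 - e4) * ?s) +
     (- 21 * 5 * (2 * 5 - 13) * ((5 - 2) * A)) * (- e2 * ?s) + (- 210 * ((5 - 2) * A)\<^sup>2) * ?s"
    by simp
  also have "\<dots> = 0"
    using moment_7 m unfolding s5 s7 M by simp
  finally have A: "A = 0"
    using avg_cube by simp
  then have e2: "e2 = 0"
    using e2A by simp
  have eta: "\<eta> i = - (\<beta> i)\<^sup>2 / 2" if "i \<in> I" for i
    using \<eta>_eq[OF that] M A by simp
  have p5: "(\<Sum>i\<in>I. \<beta> i ^ 5) = 0" and p6: "(\<Sum>i\<in>I. \<beta> i ^ 6) = 0"
  proof -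
    have "\<beta> i ^ 5 = - e4 * \<beta> i" "\<beta> i ^ 6 = - e4 * (\<beta> i)\<^sup>2" if "i \<in> I" for i
    proof -
      have *: "\<beta> i ^ 4 = - e4"
        using q that e2 by simp
      show "\<beta> i ^ 5 = - e4 * \<beta> i" "\<beta> i ^ 6 = - e4 * (\<beta> i)\<^sup>2"
        using power_add[of "\<beta> i" 4 1] power_add[of "\<beta> i" 4 2] * by simp_all
    qed
    then have "(\<Sum>i\<in>I. \<beta> i ^ 5) = - e4 * (\<Sum>i\<in>I. \<beta> i)" "(\<Sum>i\<in>I. \<beta> i ^ 6) = - e4 * (\<Sum>i\<in>I. (\<beta> i)\<^sup>2)"
      unfolding sum_distrib_left by (auto intro!: sum.cong)
    then show "(\<Sum>i\<in>I. \<beta> i ^ 5) = 0" "(\<Sum>i\<in>I. \<beta> i ^ 6) = 0"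
      unfolding p1 p2 e2 by simp_all
  qed
  have "(\<Sum>i\<in>I. 4 * (\<beta> i)\<^sup>2 * quad (\<eta> i, \<beta> i, 1) x y ^ 2) = 0" for x y
  proof -
    have "4 * (\<beta> i)\<^sup>2 * quad (\<eta> i, \<beta> i, 1) x y ^ 2 =
      4 * y ^ 4 * (\<beta> i)\<^sup>2 + 8 * x * y ^ 3 * \<beta> i ^ 3 - 4 * x ^ 3 * y * \<beta> i ^ 5 + x ^ 4 * \<beta> i ^ 6"
      if "i \<in> I" for i
    proof -
      have two: "2 * quad (\<eta> i, \<beta> i, 1) x y = - (\<beta> i)\<^sup>2 * x\<^sup>2 + 2 * \<beta> i * x * y + 2 * y\<^sup>2"
        by (simp add: eta[OF that])
      have "4 * (\<beta> i)\<^sup>2 * quad (\<eta> i, \<beta> i, 1) x y ^ 2 = (\<beta> i)\<^sup>2 * (2 * quad (\<eta> i, \<beta> i, 1) x y)\<^sup>2"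
        by (simp only: power_mult_distrib) simp
      also have "\<dots> = 4 * y ^ 4 * (\<beta> i)\<^sup>2 + 8 * x * y ^ 3 * \<beta> i ^ 3 - 4 * x ^ 3 * y * \<beta> i ^ 5 + x ^ 4 * \<beta> i ^ 6"
        unfolding two by algebra
      finally show ?thesis .
    qed
    then have "(\<Sum>i\<in>I. 4 * (\<beta> i)\<^sup>2 * quad (\<eta> i, \<beta> i, 1) x y ^ 2) =
      (\<Sum>i\<in>I. 4 * y ^ 4 * (\<beta> i)\<^sup>2 + 8 * x * y ^ 3 * \<beta> i ^ 3 - 4 * x ^ 3 * y * \<beta> i ^ 5 + x ^ 4 * \<beta> i ^ 6)"
      by (rule sum.cong[OF refl])
    also have "\<dots> = 4 * y ^ 4 * (\<Sum>i\<in>I. (\<beta> i)\<^sup>2) + 8 * x * y ^ 3 * (\<Sum>i\<in>I. \<beta> i ^ 3) -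
      4 * x ^ 3 * y * (\<Sum>i\<in>I. \<beta> i ^ 5) + x ^ 4 * (\<Sum>i\<in>I. \<beta> i ^ 6)"
      by (simp only: sum.distrib sum_subtractf sum_distrib_left)
    also have "\<dots> = 0"
      unfolding p2 p3 p5 p6 e2 by simp
    finally show ?thesis .
  qed
  moreover have "\<exists>i\<in>I. 4 * (\<beta> i)\<^sup>2 \<noteq> 0"
  proof (rule ccontr)
    assume "\<not> ?thesis"
    then have "\<beta> i = 0" if "i \<in> I" for i
      using that by simp
    then show False
      using avg_cube by simp
  qed
  ultimately show ?thesis
    unfolding dependent_powers_def by (intro exI[of _ "\<lambda>i. 4 * (\<beta> i)\<^sup>2"]) blast
qed

end

theorem general_position_exponents:
  assumes "card I = 4" "general_position I v" "dependent_powers I v m" "m \<ge> 3"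
  shows "m \<le> 5"
    and "m = 5 \<Longrightarrow> dependent_powers I v 2"
    and "dependent_powers I v k \<Longrightarrow> k \<ge> 2 \<Longrightarrow> k \<noteq> m \<Longrightarrow> m + 1 = 3 * k"
proof -
  obtain \<alpha> \<beta> \<eta> where b: "balanced I \<alpha> \<beta> \<eta> m"
    and d1: "\<And>k. dependent_powers I v k \<longleftrightarrow> dependent_powers I (\<lambda>i. (\<eta> i, \<beta> i, 1)) k"
    using balanced_normal_form[OF assms] by blast
  obtain \<beta>' \<eta>' A where c: "centred I \<alpha> \<beta>' \<eta>' m A"
    and d2: "\<And>k. dependent_powers I (\<lambda>i. (\<eta>' i, \<beta>' i, 1)) k \<longleftrightarrow> dependent_powers I (\<lambda>i. (\<eta> i, \<beta> i, 1)) k"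
    using balanced.centred_form[OF b] by blast
  show "m \<le> 5"
    by (rule centred.exponent_le_5[OF c])
  show "m = 5 \<Longrightarrow> dependent_powers I v 2"
    using centred.quintic_square[OF c] d1 d2 by blast
  show "dependent_powers I v k \<Longrightarrow> k \<ge> 2 \<Longrightarrow> k \<noteq> m \<Longrightarrow> m + 1 = 3 * k"
    using centred.other_exponent[OF c] d1 d2 by blast
qed

section \<open>Three forms in a pencil\<close>

text \<open>Gaussian elimination: the last equation is solved for an unknown that occurs in it.\<close>

lemma homogeneous_system:
  fixes a :: "'i \<Rightarrow> nat \<Rightarrow> complex"
  assumes "finite I" "n < card I"
  shows "\<exists>c. (\<exists>i\<in>I. c i \<noteq> 0) \<and> (\<forall>k<n. (\<Sum>i\<in>I. c i * a i k) = 0)"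
  using assms
proof (induction n arbitrary: I a)
  case 0
  then show ?case
    by (intro exI[of _ "\<lambda>_. 1"]) (auto simp: card_gt_0_iff)
next
  case (Suc n)
  show ?case
  proof (cases "\<forall>i\<in>I. a i n = 0")
    case True
    obtain c where "\<exists>i\<in>I. c i \<noteq> 0" "\<forall>k<n. (\<Sum>i\<in>I. c i * a i k) = 0"
      using Suc.IH[of I a] Suc.prems by auto
    then show ?thesis
      using True by (intro exI[of _ c]) (auto simp: less_Suc_eq)
  next
    case False
    then obtain l where l: "l \<in> I" "a l n \<noteq> 0"
      by blast
    define J where "J = I - {l}"
    have J: "finite J" "n < card J" "I = insert l J" "l \<notin> J"
      using Suc.prems l by (auto simp: J_def)
    define b where "b = (\<lambda>i k. a i k - a i n / a l n * a l k)"
    obtain c where c: "\<exists>i\<in>J. c i \<noteq> 0" "\<forall>k<n. (\<Sum>i\<in>J. c i * b i k) = 0"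
      using Suc.IH[OF J(1,2)] by blast
    define d where "d = c(l := - (\<Sum>i\<in>J. c i * (a i n / a l n)))"
    have d: "(\<Sum>i\<in>I. d i * a i k) = (\<Sum>i\<in>J. c i * b i k)" for k
    proof -
      have "(\<Sum>i\<in>I. d i * a i k) = d l * a l k + (\<Sum>i\<in>J. d i * a i k)"
        using J by simp
      also have "(\<Sum>i\<in>J. d i * a i k) = (\<Sum>i\<in>J. c i * a i k)"
        using J(4) by (intro sum.cong) (auto simp: d_def)
      also have "d l * a l k + \<dots> = (\<Sum>i\<in>J. c i * b i k)"
        by (simp add: d_def b_def right_diff_distrib sum_subtractf sum_distrib_right mult.assoc)
      finally show ?thesis .
    qed
    have "(\<Sum>i\<in>J. c i * b i n) = 0"
      using l(2) by (simp add: b_def)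
    then have "\<forall>k<Suc n. (\<Sum>i\<in>I. d i * a i k) = 0"
      using c(2) by (simp add: d less_Suc_eq)
    moreover have "\<exists>i\<in>I. d i \<noteq> 0"
      using c(1) J by (metis d_def fun_upd_other insertCI)
    ultimately show ?thesis
      by blast
  qed
qed

lemma dependent_first_powers:
  assumes "card I = 4"
  shows "dependent_powers I v 1"
proof -
  have fin: "finite I"
    using assms card.infinite by fastforce
  obtain p q r where v: "v = (\<lambda>i. (p i, q i, r i))"
    by (rule that[of "\<lambda>i. fst (v i)" "\<lambda>i. fst (snd (v i))" "\<lambda>i. snd (snd (v i))"]) simp
  define a where "a = (\<lambda>i (k::nat). if k = 0 then p i else if k = 1 then q i else r i)"
  obtain c where c: "\<exists>i\<in>I. c i \<noteq> 0" "\<forall>k<3. (\<Sum>i\<in>I. c i * a i k) = 0"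
    using homogeneous_system[OF fin, of 3 a] assms by auto
  have "(\<Sum>i\<in>I. c i * p i) = 0" "(\<Sum>i\<in>I. c i * q i) = 0" "(\<Sum>i\<in>I. c i * r i) = 0"
    using c(2)[rule_format, of 0] c(2)[rule_format, of 1] c(2)[rule_format, of 2] by (simp_all add: a_def)
  then have "\<forall>x y. (\<Sum>i\<in>I. c i * quad (v i) x y) = 0"
    using quad_relation_iff[where I = I and a = c and p = p and q = q and r = r] v by blast
  then show ?thesis
    using c(1) unfolding dependent_powers_def by (intro exI[of _ c]) simp
qed

lemma det3_swap: "det3 u w v = - det3 u v w"
  by (cases u; cases v; cases w) (simp add: algebra_simps)

lemma det3_rotate: "det3 v w u = det3 u v w"
  by (cases u; cases v; cases w) (simp add: algebra_simps)

text \<open>The matrix of this system is a homogenised Vandermonde matrix with the nodes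
  \<open>q / r\<close>.\<close>

lemma vandermonde_3:
  fixes d1 :: complex
  assumes "d1 * r1\<^sup>2 + d2 * r2\<^sup>2 + d3 * r3\<^sup>2 = 0" "d1 * (r1 * q1) + d2 * (r2 * q2) + d3 * (r3 * q3) = 0"
    "d1 * q1\<^sup>2 + d2 * q2\<^sup>2 + d3 * q3\<^sup>2 = 0"
    and "q1 * r2 \<noteq> q2 * r1" "q1 * r3 \<noteq> q3 * r1" "q2 * r3 \<noteq> q3 * r2"
  shows "d1 = 0 \<and> d2 = 0 \<and> d3 = 0"
proof -
  have "d1 * ((q1 * r2 - q2 * r1) * (q1 * r3 - q3 * r1)) = 0"
    "d2 * ((q1 * r2 - q2 * r1) * (q2 * r3 - q3 * r2)) = 0"
    "d3 * ((q1 * r3 - q3 * r1) * (q2 * r3 - q3 * r2)) = 0"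
    using assms(1-3) by algebra+
  then show ?thesis
    using assms(4-6) by simp
qed

fun discriminant :: "qform \<Rightarrow> complex" where
  "discriminant (p, q, r) = q\<^sup>2 - 4 * p * r"

lemma discriminant_substitute:
  "discriminant (substitute a b c d u) = (a * d - b * c)\<^sup>2 * discriminant u"
proof -
  obtain p q r where u: "u = (p, q, r)"
    by (metis prod_cases3)
  show ?thesis
    unfolding u substitute.simps discriminant.simps by algebra
qed

text \<open>The forms with indices \<open>i\<close>, \<open>j\<close>, \<open>k\<close> lie in a
  pencil, a two-dimensional space of forms.\<close>

locale pencil =
  fixes I :: "'i set" and v :: "'i \<Rightarrow> qform" and i j k l :: 'i
  assumes I_eq: "I = {i, j, k, l}" and dist: "distinct [i, j, k, l]"
    and nonpar: "\<And>x y. x \<in> I \<Longrightarrow> y \<in> I \<Longrightarrow> x \<noteq> y \<Longrightarrow> \<not> parallel (v x) (v y)"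
    and det: "det3 (v i) (v j) (v k) = 0"
begin

lemma card_I: "card I = 4"
  using dist by (simp add: I_eq)

lemma sum_I: "sum g I = g i + g j + g k + g l" for g :: "'i \<Rightarrow> complex"
  using dist by (simp add: I_eq add_ac)

text \<open>If only one of the three forms in the pencil has a nonzero coefficient, then the
  relation has at most two terms.\<close>

lemma two_terms_vanish:
  assumes rel: "\<And>x y. (\<Sum>a\<in>I. c a * quad (v a) x y ^ m) = 0" and "m > 0"
    and "a \<in> {i, j, k}" "\<And>b. b \<in> {i, j, k} \<Longrightarrow> b \<noteq> a \<Longrightarrow> c b = 0"
  shows "\<forall>a\<in>I. c a = 0"
proof -
  have al: "a \<in> I" "l \<in> I" "a \<noteq> l"
    using assms(3) dist I_eq by auto
  have *: "c a * quad (v a) x y ^ m + c l * quad (v l) x y ^ m = 0" for x y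
  proof -
    have "sum (\<lambda>a. c a * quad (v a) x y ^ m) I = sum (\<lambda>a. c a * quad (v a) x y ^ m) {a, l}"
      using al assms(4) by (intro sum.mono_neutral_right) (auto simp: I_eq)
    then have "sum (\<lambda>a. c a * quad (v a) x y ^ m) I = c a * quad (v a) x y ^ m + c l * quad (v l) x y ^ m"
      using al(3) by simp
    then show ?thesis
      using rel by simp
  qed
  then have **: "c l * quad (v l) x y ^ m + c a * quad (v a) x y ^ m = 0" for x y
    by (subst add.commute) (rule *)
  have "c a = 0"
    by (rule two_powers_independent[OF nonpar[OF al] \<open>m > 0\<close> *])
  moreover have "c l = 0"
    by (rule two_powers_independent[OF nonpar[OF al(2,1) al(3)[symmetric]] \<open>m > 0\<close> **])
  ultimately show ?thesis
    using assms(3,4) unfolding I_eq by blast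
qed

text \<open>At most one of the weights \<open>w\<close> is zero, so at most one of the three
  coefficients survives.\<close>

lemma weights_vanish:
  assumes rel: "\<And>x y. (\<Sum>a\<in>I. c a * quad (v a) x y ^ m) = 0" and "m > 0"
    and w: "c i * w i ^ n = 0" "c j * w j ^ n = 0" "c k * w k ^ n = 0"
    and w0: "w i \<noteq> 0 \<or> w j \<noteq> 0" "w i \<noteq> 0 \<or> w k \<noteq> 0" "w j \<noteq> 0 \<or> w k \<noteq> (0 :: complex)"
  shows "\<forall>a\<in>I. c a = 0"
proof -
  have "c i = 0 \<or> w i = 0" "c j = 0 \<or> w j = 0" "c k = 0 \<or> w k = 0"
    using w by auto
  then have "\<exists>a\<in>{i, j, k}. \<forall>b\<in>{i, j, k}. b \<noteq> a \<longrightarrow> c b = 0"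
    using w0 by auto
  then show ?thesis
    using two_terms_vanish[OF rel \<open>m > 0\<close>] by blast
qed

text \<open>The point \<open>(0, 1)\<close> is a zero of the fourth form. Were the pencil
  unramified there, then \<open>q\<close> and \<open>r\<close> would be coordinates on it. As
  the fourth form contributes nothing to the coefficients of \<open>1\<close>, \<open>t\<close>,
  \<open>t\<^sup>2\<close>, these coefficients would be three linear equations for the weights
  \<open>c r ^ (m - 2)\<close> to which \<open>vandermonde_3\<close> applies.\<close>

lemma zero_is_ramified:
  assumes v: "v = (\<lambda>a. (p a, q a, r a))" and rl: "r l = 0"
    and dep: "dependent_powers I v m" and m: "m \<ge> 3"
  shows "q i * r j = q j * r i"
proof (rule ccontr)
  assume D: "q i * r j \<noteq> q j * r i"
  obtain c where rel: "\<And>x y. (\<Sum>a\<in>I. c a * quad (v a) x y ^ m) = 0" and c: "\<exists>a\<in>I. c a \<noteq> 0"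
    using dep by (auto simp: dependent_powers_def)
  define n where "n = m - 2"
  have mn: "m = Suc (Suc n)" "n > 0" "m - 1 = Suc n"
    using m by (simp_all add: n_def)
  define D where "D = q i * r j - q j * r i"
  have D0: "D \<noteq> 0"
    using D by (simp add: D_def)
  define A where "A = (p i * r j - p j * r i) / D"
  define B where "B = (q i * p j - q j * p i) / D"
  have AB: "p i = A * q i + B * r i" "p j = A * q j + B * r j" "p k = A * q k + B * r k"
  proof -
    have div: "z = x / D * s + y / D * t" if "D * z = x * s + y * t" for x y z s t
      using D0 that by (simp add: field_simps)
    have d: "D * p i = (p i * r j - p j * r i) * q i + (q i * p j - q j * p i) * r i"
      "D * p j = (p i * r j - p j * r i) * q j + (q i * p j - q j * p i) * r j"
      by (simp_all add: D_def algebra_simps)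
    have d': "D * p k = (p i * r j - p j * r i) * q k + (q i * p j - q j * p i) * r k"
      using det unfolding v det3.simps D_def by algebra
    show "p i = A * q i + B * r i" "p j = A * q j + B * r j" "p k = A * q k + B * r k"
      unfolding A_def B_def by (rule div, fact d d')+
  qed
  have nonzero: "q a * r b \<noteq> q b * r a" if "a \<in> {i, j, k}" "b \<in> {i, j, k}" "a \<noteq> b" for a b
  proof
    assume eq: "q a * r b = q b * r a"
    have ab: "p a = A * q a + B * r a" "p b = A * q b + B * r b"
      using AB that by auto
    have "p a * q b = p b * q a" "p a * r b = p b * r a"
      using eq unfolding ab by algebra+
    then have "parallel (v a) (v b)"
      using eq by (simp add: v)
    then show False
      using nonpar[of a b] that I_eq by auto
  qed
  have e0: "c i * r i ^ m + c j * r j ^ m + c k * r k ^ m = 0"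
    using relation_coeff[OF rel, of 0] m unfolding sum_I
    by (simp add: v rl coeff_dehom_power_0 power_0_left)
  have "of_nat m * (c i * r i ^ Suc n * q i + c j * r j ^ Suc n * q j + c k * r k ^ Suc n * q k) = 0"
    using relation_coeff[OF rel, of 1] m mn(3) unfolding sum_I
    by (simp add: v rl coeff_dehom_power_1 algebra_simps)
  then have e1: "c i * r i ^ Suc n * q i + c j * r j ^ Suc n * q j + c k * r k ^ Suc n * q k = 0"
    using m by simp
  define C where "C = (of_nat (m choose 2) :: complex)"
  have "C \<noteq> 0"
    using m by (simp add: C_def)
  have m2: "m \<ge> 2"
    using m by simp
  have "c i * (of_nat m * r i ^ Suc n * p i + C * r i ^ n * (q i)\<^sup>2) +
    c j * (of_nat m * r j ^ Suc n * p j + C * r j ^ n * (q j)\<^sup>2) +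
    c k * (of_nat m * r k ^ Suc n * p k + C * r k ^ n * (q k)\<^sup>2) = 0"
    using relation_coeff[OF rel, of 2] mn(2)
    unfolding sum_I v dehom.simps rl coeff_dehom_power_2[OF m2] n_def[symmetric] C_def[symmetric] mn(3)
    by (simp add: power_0_left)
  then have "C * (c i * r i ^ n * (q i)\<^sup>2 + c j * r j ^ n * (q j)\<^sup>2 + c k * r k ^ n * (q k)\<^sup>2) +
    of_nat m * A * (c i * r i ^ Suc n * q i + c j * r j ^ Suc n * q j + c k * r k ^ Suc n * q k) +
    of_nat m * B * (c i * r i ^ m + c j * r j ^ m + c k * r k ^ m) = 0"
    unfolding AB mn(1) by (simp add: algebra_simps)
  then have e2: "c i * r i ^ n * (q i)\<^sup>2 + c j * r j ^ n * (q j)\<^sup>2 + c k * r k ^ n * (q k)\<^sup>2 = 0"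
    unfolding e0 e1 using \<open>C \<noteq> 0\<close> by simp
  have "c i * r i ^ n = 0 \<and> c j * r j ^ n = 0 \<and> c k * r k ^ n = 0"
  proof (rule vandermonde_3)
    show "c i * r i ^ n * (r i)\<^sup>2 + c j * r j ^ n * (r j)\<^sup>2 + c k * r k ^ n * (r k)\<^sup>2 = 0"
      using e0 by (simp add: mn(1) power2_eq_square algebra_simps)
    show "c i * r i ^ n * (r i * q i) + c j * r j ^ n * (r j * q j) + c k * r k ^ n * (r k * q k) = 0"
      using e1 by (simp add: algebra_simps)
    show "c i * r i ^ n * (q i)\<^sup>2 + c j * r j ^ n * (q j)\<^sup>2 + c k * r k ^ n * (q k)\<^sup>2 = 0"
      by (rule e2)
  qed (use nonzero dist in auto)
  then have "\<forall>a\<in>I. c a = 0"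
    using nonzero[of i j] nonzero[of i k] nonzero[of j k] dist m
    by (intro weights_vanish[OF rel, of r n]) auto
  then show False
    using c by blast
qed

lemma swap_jk: "pencil I v i k j l"
  using I_eq dist nonpar det3_swap[of "v i" "v j" "v k"] det unfolding pencil_def by auto


lemma pencil_substitute:
  assumes "a * d - b * c \<noteq> 0"
  shows "pencil I (\<lambda>x. substitute a b c d (v x)) i j k l"
proof
  show "I = {i, j, k, l}" "distinct [i, j, k, l]" by (fact I_eq dist)+
  show "\<not> parallel (substitute a b c d (v x)) (substitute a b c d (v y))"
    if "x \<in> I" "y \<in> I" "x \<noteq> y" for x y
    using parallel_substitute[OF assms] nonpar[OF that] by blast
  show "det3 (substitute a b c d (v i)) (substitute a b c d (v j)) (substitute a b c d (v k)) = 0"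
    by (simp add: det3_substitute det)
qed

text \<open>Put \<open>T = t\<^sup>2\<close>. The relation becomes \<open>\<Sum>c (p T +
  r)\<^sup>m + e T ^ (m div 2) = 0\<close>, where the last term is absent for odd
  \<open>m\<close>. If it is absent or \<open>m div 2 \<ge> 3\<close>, then it does not affect
  the coefficients of \<open>1\<close>, \<open>T\<close>, \<open>T\<^sup>2\<close>, and
  \<open>vandermonde_3\<close> applies again.\<close>

lemma squares_exponent:
  assumes v: "v = (\<lambda>a. (p a, q a, r a))" and q: "q i = 0" "q j = 0" "q k = 0"
    and l: "p l = 0" "r l = 0"
    and dep: "dependent_powers I v m" and m: "m \<ge> 3"
  shows "m = 4"
proof (rule ccontr)
  assume m4: "m \<noteq> 4"
  obtain c where rel: "\<And>x y. (\<Sum>a\<in>I. c a * quad (v a) x y ^ m) = 0" and c: "\<exists>a\<in>I. c a \<noteq> 0"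
    using dep by (auto simp: dependent_powers_def)
  have nonzero: "p a * r b \<noteq> p b * r a" if "a \<in> {i, j, k}" "b \<in> {i, j, k}" "a \<noteq> b" for a b
  proof
    assume "p a * r b = p b * r a"
    then have "parallel (v a) (v b)"
      using that q by (auto simp: v)
    then show False
      using nonpar[of a b] that I_eq by auto
  qed
  have rel2: "c i * (p i * x + r i) ^ m + c j * (p j * x + r j) ^ m + c k * (p k * x + r k) ^ m +
      c l * q l ^ m * s ^ m = 0" if "x = s\<^sup>2" for x s
    using rel[of s 1] q l that unfolding sum_I by (simp add: v power_mult_distrib mult.assoc)
  define e where "e = (if odd m then 0 else c l * q l ^ m)"
  define h where "h = m div 2"
  have h: "e = 0 \<or> h \<ge> 3"
  proof (cases "odd m")
    case False
    then have "h \<ge> 3"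
      using m m4 unfolding h_def by presburger
    then show ?thesis
      by simp
  qed (simp add: e_def)
  have rel3: "c i * (p i * x + r i) ^ m + c j * (p j * x + r j) ^ m + c k * (p k * x + r k) ^ m +
      e * x ^ h = 0" for x
  proof -
    obtain s where s: "x = s\<^sup>2"
      by (metis power2_csqrt)
    show ?thesis
    proof (cases "odd m")
      case True
      define N where "N = c i * (p i * 1 + r i) ^ m + c j * (p j * 1 + r j) ^ m + c k * (p k * 1 + r k) ^ m"
      have "N + c l * q l ^ m * 1 ^ m = 0" "N + c l * q l ^ m * (- 1) ^ m = 0"
        unfolding N_def by (rule rel2, simp)+
      then have z: "c l * q l ^ m = 0"
        using True by (simp add: add_eq_0_iff)
      then show ?thesis
        using rel2[OF s] True unfolding z by (simp add: e_def)
    next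
      case False
      then have "s ^ m = x ^ h"
        by (simp add: s h_def flip: power_mult)
      then show ?thesis
        using rel2[OF s] False by (simp add: e_def)
    qed
  qed
  define n where "n = m - 2"
  have mn: "m = Suc (Suc n)" "n > 0" "m - 1 = Suc n"
    using m by (simp_all add: n_def)
  define P where "P = (\<lambda>a. [:r a, p a, 0:] ^ m)"
  have "smult (c i) (P i) + smult (c j) (P j) + smult (c k) (P k) + monom e h = 0"
  proof -
    have "poly (smult (c i) (P i) + smult (c j) (P j) + smult (c k) (P k) + monom e h) x = 0" for x
      using rel3[of x] by (simp add: P_def poly_monom algebra_simps)
    then show ?thesis
      using poly_all_0_iff_0 by blast
  qed
  then have coeffs: "c i * coeff (P i) u + c j * coeff (P j) u + c k * coeff (P k) u = 0" if "u < 3" for u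
  proof -
    assume *: "smult (c i) (P i) + smult (c j) (P j) + smult (c k) (P k) + monom e h = 0"
    have "coeff (smult (c i) (P i) + smult (c j) (P j) + smult (c k) (P k) + monom e h) u = 0"
      unfolding * by simp
    moreover have "coeff (monom e h) u = 0"
      using h that by auto
    ultimately show ?thesis
      by simp
  qed
  have e0: "c i * r i ^ m + c j * r j ^ m + c k * r k ^ m = 0"
    using coeffs[of 0] by (simp add: P_def coeff_0_power)
  have "of_nat m * (c i * r i ^ Suc n * p i + c j * r j ^ Suc n * p j + c k * r k ^ Suc n * p k) = 0"
    using coeffs[of 1] mn(3) unfolding P_def One_nat_def coeff_dehom_power_1 by (simp add: algebra_simps)
  then have e1: "c i * r i ^ Suc n * p i + c j * r j ^ Suc n * p j + c k * r k ^ Suc n * p k = 0"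
    using m by (simp only: mult_eq_0_iff of_nat_eq_0_iff) simp
  define C where "C = (of_nat (m choose 2) :: complex)"
  have "C \<noteq> 0"
    using m by (simp add: C_def)
  have m2: "m \<ge> 2" using m by simp
  have "C * (c i * r i ^ n * (p i)\<^sup>2 + c j * r j ^ n * (p j)\<^sup>2 + c k * r k ^ n * (p k)\<^sup>2) = 0"
    using coeffs[of 2] unfolding P_def coeff_dehom_power_2[OF m2] n_def[symmetric] C_def[symmetric]
    by (simp add: algebra_simps)
  then have e2: "c i * r i ^ n * (p i)\<^sup>2 + c j * r j ^ n * (p j)\<^sup>2 + c k * r k ^ n * (p k)\<^sup>2 = 0"
    using \<open>C \<noteq> 0\<close> by simp
  have "c i * r i ^ n = 0 \<and> c j * r j ^ n = 0 \<and> c k * r k ^ n = 0"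
  proof (rule vandermonde_3)
    show "c i * r i ^ n * (r i)\<^sup>2 + c j * r j ^ n * (r j)\<^sup>2 + c k * r k ^ n * (r k)\<^sup>2 = 0"
      using e0 by (simp add: mn(1) power2_eq_square algebra_simps)
    show "c i * r i ^ n * (r i * p i) + c j * r j ^ n * (r j * p j) + c k * r k ^ n * (r k * p k) = 0"
      using e1 by (simp add: algebra_simps)
    show "c i * r i ^ n * (p i)\<^sup>2 + c j * r j ^ n * (p j)\<^sup>2 + c k * r k ^ n * (p k)\<^sup>2 = 0"
      by (rule e2)
  qed (use nonzero dist in auto)
  then have "\<forall>a\<in>I. c a = 0"
    using nonzero[of i j] nonzero[of i k] nonzero[of j k] dist m
    by (intro weights_vanish[OF rel, of r n]) auto
  then show False
    using c by blast
qed

text \<open>The four squares lie in the three-dimensional space spanned by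
  \<open>x\<^sup>4\<close>, \<open>x\<^sup>2 y\<^sup>2\<close>, \<open>y\<^sup>4\<close>.\<close>

lemma squares_dependent:
  assumes v: "v = (\<lambda>a. (p a, q a, r a))" and q: "q i = 0" "q j = 0" "q k = 0"
    and l: "p l = 0" "r l = 0"
  shows "dependent_powers I v 2"
proof -
  define a where "a = (\<lambda>x (u::nat). if u = 0 then (p x)\<^sup>2 else if u = 1 then 2 * p x * r x + (q x)\<^sup>2 else (r x)\<^sup>2)"
  have "finite I"
    by (simp add: I_eq)
  then obtain c where c: "\<exists>x\<in>I. c x \<noteq> 0" "\<forall>u<3. (\<Sum>x\<in>I. c x * a x u) = 0"
    using homogeneous_system[of I 3 a] card_I by auto
  have sums: "(\<Sum>x\<in>I. c x * (p x)\<^sup>2) = 0" "(\<Sum>x\<in>I. c x * (2 * p x * r x + (q x)\<^sup>2)) = 0" "(\<Sum>x\<in>I. c x * (r x)\<^sup>2) = 0"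
    using c(2)[rule_format, of 0] c(2)[rule_format, of 1] c(2)[rule_format, of 2] by (simp_all add: a_def)
  have "(\<Sum>x\<in>I. c x * quad (v x) s t ^ 2) = 0" for s t
  proof -
    have "(\<Sum>x\<in>I. c x * quad (v x) s t ^ 2) = (\<Sum>x\<in>I. s ^ 4 * (c x * (p x)\<^sup>2) +
      s\<^sup>2 * t\<^sup>2 * (c x * (2 * p x * r x + (q x)\<^sup>2)) + t ^ 4 * (c x * (r x)\<^sup>2))"
    proof (intro sum.cong refl)
      fix x assume "x \<in> I"
      then have "q x = 0 \<or> p x = 0 \<and> r x = 0"
        using I_eq q l by auto
      then show "c x * quad (v x) s t ^ 2 = s ^ 4 * (c x * (p x)\<^sup>2) +
          s\<^sup>2 * t\<^sup>2 * (c x * (2 * p x * r x + (q x)\<^sup>2)) + t ^ 4 * (c x * (r x)\<^sup>2)"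
      proof
        assume "q x = 0"
        then show ?thesis by (simp add: v algebra_simps eval_nat_numeral)
      next
        assume "p x = 0 \<and> r x = 0"
        then show ?thesis by (simp add: v algebra_simps eval_nat_numeral)
      qed
    qed
    also have "\<dots> = 0"
      by (simp only: sum.distrib flip: sum_distrib_left) (simp only: sums, simp)
    finally show ?thesis .
  qed
  then show ?thesis
    using c(1) unfolding dependent_powers_def by (intro exI[of _ c]) blast
qed

text \<open>If the fourth form has two different zeros, take them as coordinate points.
  Ramification at both of them removes the mixed term from every form in the pencil.\<close>

lemma nondegenerate_exponent:
  assumes disc: "discriminant (v l) \<noteq> 0"
    and dep: "dependent_powers I v m" and m: "m \<ge> 3"
  shows "m = 4" "dependent_powers I v 2" "det3 (v i) (v j) (v l) \<noteq> 0"
proof -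
  obtain P Q R where vl: "v l = (P, Q, R)"
    by (metis prod_cases3)
  obtain a b c d where D: "a * d - b * c \<noteq> 0"
    and z: "P * a\<^sup>2 + Q * a * c + R * c\<^sup>2 = 0" "P * b\<^sup>2 + Q * b * d + R * d\<^sup>2 = 0"
  proof (cases "P = 0")
    case True
    then show ?thesis
      using disc by (intro that[of 1 Q "- R" 0]) (auto simp: vl power2_eq_square)
  next
    case False
    define w where "w = csqrt (Q\<^sup>2 - 4 * P * R)"
    have w: "w\<^sup>2 = Q\<^sup>2 - 4 * P * R" "w \<noteq> 0"
      using disc by (simp_all add: w_def vl)
    show ?thesis
    proof (rule that[of "- Q + w" "2 * P" "- Q - w" "2 * P"])
      show "(- Q + w) * (2 * P) - (- Q - w) * (2 * P) \<noteq> 0"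
        using w(2) False by (simp add: algebra_simps)
      show "P * (- Q + w)\<^sup>2 + Q * (- Q + w) * (2 * P) + R * (2 * P)\<^sup>2 = 0"
        "P * (- Q - w)\<^sup>2 + Q * (- Q - w) * (2 * P) + R * (2 * P)\<^sup>2 = 0"
        using w(1) by algebra+
    qed
  qed
  define W where "W = (\<lambda>x. substitute a b c d (v x))"
  interpret W: pencil I W i j k l
    unfolding W_def by (rule pencil_substitute[OF D])
  obtain p q r where W: "W = (\<lambda>i. (p i, q i, r i))"
    by (rule that[of "\<lambda>i. fst (W i)" "\<lambda>i. fst (snd (W i))" "\<lambda>i. snd (snd (W i))"]) simp
  have l: "p l = 0" "r l = 0"
    using fun_cong[OF W, of l] z by (simp_all add: W_def vl)
  have dW: "dependent_powers I W u \<longleftrightarrow> dependent_powers I v u" for u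
    unfolding W_def by (rule dependent_powers_substitute[OF D])
  have depW: "dependent_powers I W m"
    using dep dW by simp
  define V where "V = (\<lambda>x. substitute 0 1 1 0 (W x))"
  have V: "V = (\<lambda>i. (r i, q i, p i))"
    by (simp add: V_def W)
  interpret V: pencil I V i j k l
    unfolding V_def by (rule W.pencil_substitute) simp
  have depV: "dependent_powers I V m"
    unfolding V_def using depW dependent_powers_substitute[of 0 0 1 1 I W m] by simp
  have r1: "q i * r j = q j * r i" "q i * p j = q j * p i"
    using W.zero_is_ramified[OF W l(2) depW m] V.zero_is_ramified[OF V l(1) depV m] .
  have r2: "q i * r k = q k * r i" "q i * p k = q k * p i"
    using pencil.zero_is_ramified[OF W.swap_jk W l(2) depW m]
      pencil.zero_is_ramified[OF V.swap_jk V l(1) depV m] .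
  have npar: "\<not> parallel (W i) (W j)" "\<not> parallel (W i) (W k)"
    using W.nonpar[of i j] W.nonpar[of i k] I_eq dist by auto
  have "q i = 0 \<and> q j = 0" if "q i * r j = q j * r i" "q i * p j = q j * p i" "\<not> parallel (W i) (W j)" for j
  proof (rule ccontr)
    assume n: "\<not> ?thesis"
    have "q i * (p i * r j - p j * r i) = 0" "q j * (p i * r j - p j * r i) = 0"
      using that(1,2) by algebra+
    then have "p i * r j = p j * r i"
      using n by auto
    then show False
      using that by (simp add: W mult.commute)
  qed
  then have q: "q i = 0" "q j = 0" "q k = 0"
    using r1 r2 npar by blast+
  show "m = 4"
    using W.squares_exponent[OF W q l depW m] .
  show "dependent_powers I v 2"
    using W.squares_dependent[OF W q l] dW by simp
  have "q l \<noteq> 0"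
    using W.nonpar[of l i] l I_eq dist by (auto simp: W)
  moreover have "p i * r j \<noteq> p j * r i"
    using npar(1) q by (simp add: W)
  ultimately have "det3 (W i) (W j) (W l) \<noteq> 0"
    using q l by (simp add: W algebra_simps)
  then show "det3 (v i) (v j) (v l) \<noteq> 0"
    unfolding W_def det3_substitute by auto
qed

text \<open>If the fourth form is the square of a linear form, then ramification at its zero
  puts it into the pencil. A pencil contains at most two squares of linear forms up to scaling,
  so one of the other forms has a nonzero discriminant.\<close>

lemma degenerate_last:
  assumes disc: "discriminant (v l) = 0"
    and dep: "dependent_powers I v m" and m: "m \<ge> 3"
  shows "det3 (v i) (v j) (v l) = 0" "discriminant (v i) \<noteq> 0 \<or> discriminant (v j) \<noteq> 0"
proof -
  obtain P Q R where vl: "v l = (P, Q, R)"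
    by (metis prod_cases3)
  obtain a b c d where D: "a * d - b * c \<noteq> 0" and z: "P * b\<^sup>2 + Q * b * d + R * d\<^sup>2 = 0"
      "2 * P * a * b + Q * (a * d + b * c) + 2 * R * c * d = 0"
  proof (cases "P = 0")
    case True
    then have "Q = 0"
      using disc by (simp add: vl)
    then show ?thesis
      using True by (intro that[of 0 0 1 1]) auto
  next
    case False
    show ?thesis
    proof (rule that[of 1 "2 * P" "- Q" 0])
      show "P * (- Q)\<^sup>2 + Q * (- Q) * (2 * P) + R * (2 * P)\<^sup>2 = 0"
        using disc unfolding vl discriminant.simps by algebra
    qed (use False in \<open>simp_all add: algebra_simps\<close>)
  qed
  define W where "W = (\<lambda>x. substitute a b c d (v x))"
  interpret W: pencil I W i j k l
    unfolding W_def by (rule pencil_substitute[OF D])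
  obtain p q r where W: "W = (\<lambda>i. (p i, q i, r i))"
    by (rule that[of "\<lambda>i. fst (W i)" "\<lambda>i. fst (snd (W i))" "\<lambda>i. snd (snd (W i))"]) simp
  have l: "q l = 0" "r l = 0"
    using fun_cong[OF W, of l] z by (simp_all add: W_def vl)
  have "dependent_powers I W m"
    using dep unfolding W_def dependent_powers_substitute[OF D] .
  then have ram: "q i * r j = q j * r i"
    using W.zero_is_ramified[OF W l(2) _ m] by blast
  then have "det3 (W i) (W j) (W l) = 0"
    using l by (simp add: W)
  then show "det3 (v i) (v j) (v l) = 0"
    using D unfolding W_def det3_substitute by simp
  show "discriminant (v i) \<noteq> 0 \<or> discriminant (v j) \<noteq> 0"
  proof (rule ccontr)
    assume "\<not> ?thesis"
    then have "discriminant (W i) = 0" "discriminant (W j) = 0"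
      unfolding W_def discriminant_substitute by auto
    then have d: "(q i)\<^sup>2 = 4 * p i * r i" "(q j)\<^sup>2 = 4 * p j * r j"
      by (simp_all add: W)
    have npar: "\<not> parallel (W i) (W j)" "\<not> parallel (W i) (W l)" "\<not> parallel (W j) (W l)"
      using W.nonpar[of i j] W.nonpar[of i l] W.nonpar[of j l] I_eq dist by auto
    have r0: "r i \<noteq> 0" "r j \<noteq> 0"
      using d npar(2,3) l by (auto simp: W)
    have "4 * r i * r j * (p i * r j - p j * r i) = 0"
      using d ram by algebra
    then have pr: "p i * r j = p j * r i"
      using r0 by simp
    have "r i * (p i * q j - p j * q i) = 0"
      using pr ram by algebra
    then have "p i * q j = p j * q i"
      using r0 by simp
    then show False
      using pr ram npar(1) by (simp add: W)
  qed
qed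

lemma rotate: "pencil I v j k i l"
  using I_eq dist nonpar det det3_rotate[of "v j" "v k" "v i"] unfolding pencil_def by auto

text \<open>In the degenerate case all four forms lie in one pencil, and a form with nonzero
  discriminant can take the place of the fourth one. By \<open>nondegenerate_exponent\<close> it
  would lie outside the pencil of the others.\<close>

theorem exponent:
  assumes dep: "dependent_powers I v m" and m: "m \<ge> 3"
  shows "m = 4 \<and> dependent_powers I v 2"
proof (cases "discriminant (v l) = 0")
  case False
  then show ?thesis
    using nondegenerate_exponent[OF _ dep m] by blast
next
  case True
  have d: "det3 (v i) (v k) (v l) = 0" "det3 (v j) (v k) (v l) = 0"
    using pencil.degenerate_last(1)[OF swap_jk True dep m]
      pencil.degenerate_last(1)[OF rotate True dep m] .
  have p: "pencil I v j k l i" "pencil I v i k l j"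
    using I_eq dist nonpar d unfolding pencil_def by auto
  have "discriminant (v i) \<noteq> 0 \<Longrightarrow> det3 (v j) (v k) (v i) \<noteq> 0"
    "discriminant (v j) \<noteq> 0 \<Longrightarrow> det3 (v i) (v k) (v j) \<noteq> 0"
    by (rule pencil.nondegenerate_exponent(3)[OF p(1) _ dep m], assumption,
      rule pencil.nondegenerate_exponent(3)[OF p(2) _ dep m], assumption)
  then show ?thesis
    using degenerate_last(2)[OF True dep m] det det3_rotate[of "v j" "v k" "v i"]
      det3_swap[of "v i" "v j" "v k"] by auto
qed

end

theorem special_position_exponent:
  assumes "card I = 4" "\<not> general_position I v"
    and "\<And>x y. x \<in> I \<Longrightarrow> y \<in> I \<Longrightarrow> x \<noteq> y \<Longrightarrow> \<not> parallel (v x) (v y)"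
    and "dependent_powers I v m" "m \<ge> 3"
  shows "m = 4" "dependent_powers I v 2"
proof -
  obtain i j k where ijk: "i \<in> I" "j \<in> I" "k \<in> I" "distinct [i, j, k]" "det3 (v i) (v j) (v k) = 0"
    using assms(2) by (auto simp: general_position_def)
  have "card (I - {i, j, k}) = 1"
    using assms(1) ijk by (simp add: card_Diff_subset)
  then obtain l where "I - {i, j, k} = {l}"
    by (auto simp: card_1_singleton_iff)
  then have "pencil I v i j k l"
    using ijk assms(3) by unfold_locales auto
  from pencil.exponent[OF this assms(4,5)]
  show "m = 4" "dependent_powers I v 2"
    by simp_all
qed

section \<open>Tickets of families of polynomials\<close>

fun form :: "qform \<Rightarrow> bipoly" where
  "form (p, q, r) = [:[:0, 0, p:], [:0, q:], [:r:]:]"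

definition coeffs_of :: "bipoly \<Rightarrow> qform" where
  "coeffs_of f = (coeff (coeff f 0) 2, coeff (coeff f 1) 1, coeff (coeff f 2) 0)"

lemma coeffs_of_form [simp]: "coeffs_of (form u) = u"
  by (cases u) (simp add: coeffs_of_def numeral_2_eq_2)

lemma homogeneous_form: "homogeneous 2 (form u)"
  by (cases u) (auto simp: homogeneous_def coeff_pCons split: nat.splits)

lemma form_coeffs_of:
  assumes "homogeneous 2 f"
  shows "form (coeffs_of f) = f"
proof (intro poly_eqI)
  fix i j
  show "coeff (coeff (form (coeffs_of f)) j) i = coeff (coeff f j) i"
  proof (cases "i + j = 2")
    case True
    then consider "i = 2" "j = 0" | "i = 1" "j = 1" | "i = 0" "j = 2"
      by linarith
    then show ?thesis
      by cases (simp_all add: coeffs_of_def numeral_2_eq_2)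
  next
    case False
    then show ?thesis
      using assms homogeneous_form[of "coeffs_of f"] unfolding homogeneous_def by metis
  qed
qed

lemma poly_form: "poly (poly (form u) [:y:]) x = quad u x y"
  by (cases u) (simp add: algebra_simps power2_eq_square)

lemma bipoly_eq_0_iff: "P = 0 \<longleftrightarrow> (\<forall>x y. poly (poly P [:y:]) x = 0)" for P :: bipoly
proof
  assume *: "\<forall>x y. poly (poly P [:y:]) x = 0"
  have "poly P [:y:] = 0" for y
    using * by (metis poly_all_0_iff_0)
  then have "range (\<lambda>y. [:y:]) \<subseteq> {z. poly P z = 0}"
    by auto
  moreover have "infinite (range (\<lambda>y :: complex. [:y:]))"
    by (auto dest!: finite_imageD simp: inj_on_def infinite_UNIV_char_0)
  ultimately have "infinite {z. poly P z = 0}"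
    using finite_subset by blast
  then show "P = 0"
    using poly_roots_finite by blast
qed simp

lemma ticket_eq:
  assumes "\<forall>f\<in>F. homogeneous 2 f"
  shows "ticket F = {m. m > 0 \<and> dependent_powers F coeffs_of m}"
proof -
  have "(\<Sum>f\<in>F. cscale (c f) (f ^ m)) = 0 \<longleftrightarrow>
    (\<forall>x y. (\<Sum>f\<in>F. c f * quad (coeffs_of f) x y ^ m) = 0)" for c m
  proof -
    have "poly (poly (\<Sum>f\<in>F. cscale (c f) (f ^ m)) [:y:]) x = (\<Sum>f\<in>F. c f * quad (coeffs_of f) x y ^ m)" for x y
      unfolding poly_sum
    proof (intro sum.cong refl)
      fix f assume "f \<in> F"
      then have "poly (poly f [:y:]) x = quad (coeffs_of f) x y"
        using assms form_coeffs_of poly_form by metis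
      then show "poly (poly (cscale (c f) (f ^ m)) [:y:]) x = c f * quad (coeffs_of f) x y ^ m"
        by (simp add: cscale_def)
    qed
    then show ?thesis
      by (simp add: bipoly_eq_0_iff)
  qed
  then show ?thesis
    by (simp add: ticket_def dependent_powers_def)
qed

lemma cscale_form: "cscale c (form (p, q, r)) = form (c * p, c * q, c * r)"
  by (simp add: cscale_def)

lemma proportional_form: "proportional (form u) (form w) \<longleftrightarrow> parallel u w"
proof
  obtain p q r p' q' r' where uw: "u = (p, q, r)" "w = (p', q', r')"
    by (metis prod_cases3)
  show "parallel u w" if "proportional (form u) (form w)"
  proof -
    obtain c where "form u = form (c * p', c * q', c * r') \<or> form w = form (c * p, c * q, c * r)"
      using \<open>proportional (form u) (form w)\<close> unfolding proportional_def uw cscale_form by blast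
    then show ?thesis
      unfolding uw by (auto simp: mult_ac)
  qed
  assume par: "parallel u w"
  show "proportional (form u) (form w)"
  proof (cases "u = (0, 0, 0)")
    case True
    then have "form u = cscale 0 (form w)"
      unfolding uw cscale_form by simp
    then show ?thesis
      unfolding proportional_def by blast
  next
    case False
    define c where "c = (if p \<noteq> 0 then p' / p else if q \<noteq> 0 then q' / q else r' / r)"
    have "p' = c * p" "q' = c * q" "r' = c * r"
      using par False unfolding uw c_def by (auto simp: field_simps)
    then have "form w = cscale c (form u)"
      unfolding uw cscale_form by simp
    then show ?thesis
      unfolding proportional_def by blast
  qed
qed

lemma ticket_cases:
  assumes F: "F \<in> families 4 2"
  shows "ticket F \<in> {{1}, {1, 2}, {1, 3}, {1, 4}, {1, 2, 4}, {1, 2, 5}}"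
proof -
  have card: "card F = 4" and hom: "\<forall>f\<in>F. homogeneous 2 f" and
    pw: "pairwise (\<lambda>f g. \<not> proportional f g) F"
    using F by (auto simp: families_def)
  define T where "T = ticket F"
  have T: "T = {m. m > 0 \<and> dependent_powers F coeffs_of m}"
    unfolding T_def by (rule ticket_eq[OF hom])
  have npar: "\<not> parallel (coeffs_of f) (coeffs_of g)" if "f \<in> F" "g \<in> F" "f \<noteq> g" for f g
  proof -
    have "\<not> proportional f g"
      using pw that by (simp add: pairwise_def)
    moreover have "form (coeffs_of f) = f" "form (coeffs_of g) = g"
      using hom that by (simp_all add: form_coeffs_of)
    ultimately show ?thesis
      using proportional_form[of "coeffs_of f" "coeffs_of g"] by simp
  qed
  have T1: "1 \<in> T"
    using dependent_first_powers[OF card] by (simp add: T)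
  have T0: "0 \<notin> T"
    by (simp add: T)
  have small: "m \<in> {0, 1, 2} \<or> m \<ge> 3" for m :: nat
    by auto
  show ?thesis
  proof (cases "\<exists>m\<in>T. m \<ge> 3")
    case False
    then have "k \<in> {1, 2}" if "k \<in> T" for k
      using that T0 small[of k] by blast
    then have "T \<subseteq> {1, 2}"
      by blast
    then have "T = {1} \<or> T = {1, 2}"
      using T1 by blast
    then show ?thesis
      unfolding T_def by blast
  next
    case True
    then obtain m where m: "m \<in> T" "m \<ge> 3"
      by blast
    show ?thesis
    proof (cases "general_position F coeffs_of")
      case True
      have dep: "dependent_powers F coeffs_of k" if "k \<in> T" for k
        using that by (simp add: T)
      note gp = general_position_exponents[OF card True]
      have only: "k = 1 \<or> k = m \<or> k = 2 \<and> m = 5" if "k \<in> T" for k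
      proof (rule ccontr)
        assume n: "\<not> ?thesis"
        have "k \<noteq> 0" "k \<noteq> 1"
          using n that T0 by metis+
        then have k: "k \<ge> 2"
          by simp
        have e: "m + 1 = 3 * k"
          using gp(3)[OF dep[OF m(1)] m(2) dep[OF that] k] n by blast
        show False
        proof (cases "k = 2")
          case True
          then show ?thesis using e n by simp
        next
          case False
          then have "k \<ge> 3" "m \<ge> 2" "m \<noteq> k"
            using k m(2) n by auto
          then have "k + 1 = 3 * m"
            using gp(3)[OF dep[OF that] _ dep[OF m(1)]] by blast
          then show ?thesis
            using e k by linarith
        qed
      qed
      have "m \<in> {3, 4, 5}"
        using m(2) gp(1)[OF dep[OF m(1)] m(2)] by auto
      then consider "m = 3" | "m = 4" | "m = 5"
        by blast
      then show ?thesis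
      proof cases
        case 3
        then have "2 \<in> T"
          using gp(2)[OF dep[OF m(1)] m(2)] by (simp add: T)
        moreover have "k \<in> {1, 2, 5}" if "k \<in> T" for k
          using only[OF that] 3 by auto
        ultimately have "T = {1, 2, 5}"
          using 3 m(1) T1 by blast
        then show ?thesis
          unfolding T_def by blast
      next
        case 1
        then have "k \<in> {1, 3}" if "k \<in> T" for k
          using only[OF that] by simp
        then have "T = {1, 3}"
          using 1 m(1) T1 by blast
        then show ?thesis
          unfolding T_def by blast
      next
        case 2
        then have "k \<in> {1, 4}" if "k \<in> T" for k
          using only[OF that] by simp
        then have "T = {1, 4}"
          using 2 m(1) T1 by blast
        then show ?thesis
          unfolding T_def by blast
      qed
    next
      case False
      have sp: "k = 4" "2 \<in> T" if "k \<in> T" "k \<ge> 3" for k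
        using special_position_exponent[OF card False npar _ that(2)] that(1) by (auto simp: T)
      have "4 \<in> T" "2 \<in> T"
        using sp m by auto
      moreover have "k \<in> {1, 2, 4}" if "k \<in> T" for k
        using sp(1)[OF that] small[of k] that T0 by blast
      ultimately have "T = {1, 2, 4}"
        using T1 by blast
      then show ?thesis
        unfolding T_def by blast
    qed
  qed
qed

section \<open>Families realising the six tickets\<close>

text \<open>Explicit forms give a ticket, described by relations between four terms; the
  classification restricts it to six values, so that a few memberships determine it.\<close>

lemma ticket_of_forms:
  assumes "distinct [u1, u2, u3, u4]"
    and npar: "\<not> parallel u1 u2" "\<not> parallel u1 u3" "\<not> parallel u1 u4"
      "\<not> parallel u2 u3" "\<not> parallel u2 u4" "\<not> parallel u3 u4"
  obtains T where "T \<in> tickets 4 2" "T \<in> {{1}, {1, 2}, {1, 3}, {1, 4}, {1, 2, 4}, {1, 2, 5}}"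
    "\<And>m. m \<in> T \<longleftrightarrow> m > 0 \<and> (\<exists>c1 c2 c3 c4. (c1, c2, c3, c4) \<noteq> (0, 0, 0, 0) \<and>
       (\<forall>x y. c1 * quad u1 x y ^ m + c2 * quad u2 x y ^ m + c3 * quad u3 x y ^ m + c4 * quad u4 x y ^ m = 0))"
proof -
  define F where "F = {form u1, form u2, form u3, form u4}"
  have neq: "form u \<noteq> form w" if "u \<noteq> w" for u w
    using that by (metis coeffs_of_form)
  have dist: "distinct [form u1, form u2, form u3, form u4]"
    using assms(1) neq by simp
  have sym: "parallel w u" if "parallel u w" for u w
    using that by (cases u; cases w) auto
  have npar': "\<not> parallel u2 u1" "\<not> parallel u3 u1" "\<not> parallel u4 u1"
      "\<not> parallel u3 u2" "\<not> parallel u4 u2" "\<not> parallel u4 u3"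
    using npar sym by blast+
  have F: "F \<in> families 4 2"
    unfolding families_def mem_Collect_eq
  proof (intro conjI ballI)
    show "card F = 4"
      using dist by (simp add: F_def)
    show "homogeneous 2 f" if "f \<in> F" for f
      using that unfolding F_def by (auto intro: homogeneous_form)
    show "pairwise (\<lambda>f g. \<not> proportional f g) F"
    proof (rule pairwiseI)
      fix f g assume fg: "f \<in> F" "g \<in> F" "f \<noteq> g"
      have "\<exists>u\<in>{u1, u2, u3, u4}. f = form u" "\<exists>w\<in>{u1, u2, u3, u4}. g = form w"
        using fg unfolding F_def by blast+
      then obtain u w where uw: "u \<in> {u1, u2, u3, u4}" "w \<in> {u1, u2, u3, u4}" "f = form u" "g = form w"
        by blast
      then have "u \<noteq> w"
        using fg(3) by blast
      then have "\<not> parallel u w"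
        using uw(1,2) npar npar' by blast
      then show "\<not> proportional f g"
        by (simp only: uw(3,4) proportional_form not_False_eq_True)
    qed
  qed (simp add: F_def)
  have hom: "\<forall>f\<in>F. homogeneous 2 f"
    unfolding F_def by (auto intro: homogeneous_form)
  have sums: "(\<Sum>f\<in>F. g f) = g (form u1) + g (form u2) + g (form u3) + g (form u4)" for g :: "bipoly \<Rightarrow> complex"
    using dist by (simp add: F_def add_ac)
  have mem: "m \<in> ticket F \<longleftrightarrow> m > 0 \<and> (\<exists>c1 c2 c3 c4. (c1, c2, c3, c4) \<noteq> (0, 0, 0, 0) \<and>
       (\<forall>x y. c1 * quad u1 x y ^ m + c2 * quad u2 x y ^ m + c3 * quad u3 x y ^ m + c4 * quad u4 x y ^ m = 0))"
    (is "_ \<longleftrightarrow> _ \<and> ?R") for m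
  proof -
    have "dependent_powers F coeffs_of m \<longleftrightarrow> ?R"
    proof
      assume "dependent_powers F coeffs_of m"
      then obtain c where c: "\<exists>f\<in>F. c f \<noteq> 0"
        "\<forall>x y. (\<Sum>f\<in>F. c f * quad (coeffs_of f) x y ^ m) = 0"
        unfolding dependent_powers_def by blast
      have "c (form u1) \<noteq> 0 \<or> c (form u2) \<noteq> 0 \<or> c (form u3) \<noteq> 0 \<or> c (form u4) \<noteq> 0"
        using c(1) unfolding F_def by blast
      then have "(c (form u1), c (form u2), c (form u3), c (form u4)) \<noteq> (0, 0, 0, 0)"
        by simp
      with c(2) show ?R
        unfolding sums coeffs_of_form by blast
    next
      assume ?R
      then obtain c1 c2 c3 c4 where c: "(c1, c2, c3, c4) \<noteq> (0, 0, 0, 0)"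
        "\<forall>x y. c1 * quad u1 x y ^ m + c2 * quad u2 x y ^ m + c3 * quad u3 x y ^ m + c4 * quad u4 x y ^ m = 0"
        by blast
      define c where "c = (\<lambda>_. 0)(form u1 := c1, form u2 := c2, form u3 := c3, form u4 := c4)"
      have cs: "c (form u1) = c1" "c (form u2) = c2" "c (form u3) = c3" "c (form u4) = c4"
        using dist by (simp_all add: c_def)
      have "c (form u1) \<noteq> 0 \<or> c (form u2) \<noteq> 0 \<or> c (form u3) \<noteq> 0 \<or> c (form u4) \<noteq> 0"
        using c(1) by (simp add: cs)
      then have "\<exists>f\<in>F. c f \<noteq> 0"
        unfolding F_def by blast
      moreover have "(\<Sum>f\<in>F. c f * quad (coeffs_of f) x y ^ m) = 0" for x y
        unfolding sums cs coeffs_of_form using c(2) by blast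
      ultimately show "dependent_powers F coeffs_of m"
        unfolding dependent_powers_def by blast
    qed
    then show ?thesis
      unfolding ticket_eq[OF hom] by simp
  qed
  have "ticket F \<in> tickets 4 2"
    using F unfolding tickets_def by blast
  then show ?thesis
    by (rule that[OF _ ticket_cases[OF F] mem])
qed

lemma relation_witness:
  assumes "m > 0" "(c1, c2, c3, c4) \<noteq> (0, 0, 0, 0)"
    and "\<And>x y. c1 * quad u1 x y ^ m + c2 * quad u2 x y ^ m + c3 * quad u3 x y ^ m + c4 * quad u4 x y ^ m = 0"
  shows "m > 0 \<and> (\<exists>c1 c2 c3 c4. (c1, c2, c3, c4) \<noteq> (0, 0, 0, 0) \<and>
    (\<forall>x y. c1 * quad u1 x y ^ m + c2 * quad u2 x y ^ m + c3 * quad u3 x y ^ m + c4 * quad u4 x y ^ m = 0))"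
  using assms by blast

text \<open>The forms \<open>x\<^sup>2\<close>, \<open>y\<^sup>2\<close>, \<open>x\<^sup>2 +
  y\<^sup>2\<close>, \<open>x\<^sup>2 + x y\<close>: the last one is the only one that is not
  even in \<open>x\<close>.\<close>

lemma ticket_1: "{1} \<in> tickets 4 2"
proof -
  obtain T where T: "T \<in> tickets 4 2" "T \<in> {{1}, {1, 2}, {1, 3}, {1, 4}, {1, 2, 4}, {1, 2, 5}}"
    and mem: "\<And>m. m \<in> T \<longleftrightarrow> m > 0 \<and> (\<exists>c1 c2 c3 c4. (c1, c2, c3, c4) \<noteq> (0, 0, 0, 0) \<and>
       (\<forall>x y. c1 * quad (1, 0, 0) x y ^ m + c2 * quad (0, 0, 1) x y ^ m + c3 * quad (1, 0, 1) x y ^ m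
         + c4 * quad (1, 1, 0) x y ^ m = 0))"
    by (rule ticket_of_forms[of "(1, 0, 0)" "(0, 0, 1)" "(1, 0, 1)" "(1, 1, 0)"]) auto
  have "m \<notin> T" if m: "m \<ge> 2" for m
  proof
    assume "m \<in> T"
    then obtain c1 c2 c3 c4 where c: "(c1, c2, c3, c4) \<noteq> (0, 0, 0, 0)"
      and e: "\<And>x y. c1 * quad (1, 0, 0) x y ^ m + c2 * quad (0, 0, 1) x y ^ m + c3 * quad (1, 0, 1) x y ^ m
         + c4 * quad (1, 1, 0) x y ^ m = 0"
      unfolding mem by blast
    have m0: "m > 0" using m by simp
    have "c1 + c2 + c3 * 2 ^ m + c4 * 2 ^ m = 0" "c1 + c2 + c3 * 2 ^ m = 0"
      using e[of 1 1] e[of "- 1" 1] m0 by (simp_all add: power_0_left)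
    then have c4: "c4 = 0"
      by simp
    have "c1 + c3 = 0" "c2 + c3 = 0"
      using e[of 1 0] e[of 0 1] m0 c4 by (simp_all add: power_0_left)
    then have "c3 * (2 ^ m - 2) = 0" and c12: "c1 = - c3" "c2 = - c3"
      using \<open>c1 + c2 + c3 * 2 ^ m = 0\<close> by (simp_all add: add_eq_0_iff2 algebra_simps)
    moreover have "(2 :: complex) ^ m \<noteq> 2"
    proof -
      have "(2 :: nat) ^ m > 2 ^ 1"
        using m by (intro power_strict_increasing) auto
      then have "of_nat (2 ^ m) \<noteq> (of_nat 2 :: complex)"
        unfolding of_nat_eq_iff by simp
      then show ?thesis by simp
    qed
    ultimately show False
      using c c4 by simp
  qed
  then have "2 \<notin> T" "3 \<notin> T" "4 \<notin> T"
    by auto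
  then have "T = {1}"
    using T(2) by auto
  then show ?thesis
    using T(1) by simp
qed

text \<open>Four forms in the pencil spanned by \<open>x\<^sup>2\<close> and
  \<open>y\<^sup>2\<close>.\<close>

lemma ticket_1_2: "{1, 2} \<in> tickets 4 2"
proof -
  obtain T where T: "T \<in> tickets 4 2" "T \<in> {{1}, {1, 2}, {1, 3}, {1, 4}, {1, 2, 4}, {1, 2, 5}}"
    and mem: "\<And>m. m \<in> T \<longleftrightarrow> m > 0 \<and> (\<exists>c1 c2 c3 c4. (c1, c2, c3, c4) \<noteq> (0, 0, 0, 0) \<and>
       (\<forall>x y. c1 * quad (1, 0, 0) x y ^ m + c2 * quad (0, 0, 1) x y ^ m + c3 * quad (1, 0, 1) x y ^ m
         + c4 * quad (1, 0, - 1) x y ^ m = 0))"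
    by (rule ticket_of_forms[of "(1, 0, 0)" "(0, 0, 1)" "(1, 0, 1)" "(1, 0, - 1)"]) auto
  have rel: "- 2 * quad (1, 0, 0) x y ^ 2 + - 2 * quad (0, 0, 1) x y ^ 2 + 1 * quad (1, 0, 1) x y ^ 2
       + 1 * quad (1, 0, - 1) x y ^ 2 = 0" for x y
    unfolding quad.simps by algebra
  have "2 \<in> T"
    unfolding mem by (rule relation_witness[OF _ _ rel]) simp_all
  moreover have "4 \<notin> T"
  proof
    assume "4 \<in> T"
    then obtain c1 c2 c3 c4 where c: "(c1, c2, c3, c4) \<noteq> (0, 0, 0, 0)"
      and e: "\<And>x y. c1 * quad (1, 0, 0) x y ^ 4 + c2 * quad (0, 0, 1) x y ^ 4 + c3 * quad (1, 0, 1) x y ^ 4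
         + c4 * quad (1, 0, - 1) x y ^ 4 = 0"
      unfolding mem by blast
    have "c1 + c3 + c4 = 0" "c2 + c3 + c4 = 0" "c1 + c2 + 16 * c3 = 0" "256 * c1 + c2 + 625 * c3 + 81 * c4 = 0"
      using e[of 1 0] e[of 0 1] e[of 1 1] e[of 2 1] by (simp_all add: mult_ac)
    then have "c1 = 0" "c2 = 0" "c3 = 0" "c4 = 0"
      by algebra+
    then show False
      using c by simp
  qed
  moreover have "5 \<notin> T"
  proof
    assume "5 \<in> T"
    then obtain c1 c2 c3 c4 where c: "(c1, c2, c3, c4) \<noteq> (0, 0, 0, 0)"
      and e: "\<And>x y. c1 * quad (1, 0, 0) x y ^ 5 + c2 * quad (0, 0, 1) x y ^ 5 + c3 * quad (1, 0, 1) x y ^ 5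
         + c4 * quad (1, 0, - 1) x y ^ 5 = 0"
      unfolding mem by blast
    have "c1 + c3 + c4 = 0" "c2 + c3 - c4 = 0" "c1 + c2 + 32 * c3 = 0" "1024 * c1 + c2 + 3125 * c3 + 243 * c4 = 0"
      using e[of 1 0] e[of 0 1] e[of 1 1] e[of 2 1] by (simp_all add: mult_ac)
    then have "c1 = 0" "c2 = 0" "c3 = 0" "c4 = 0"
      by algebra+
    then show False
      using c by simp
  qed
  ultimately have "T = {1, 2}"
    using T(2) by auto
  then show ?thesis
    using T(1) by simp
qed

text \<open>Ramanujan's parametrisation of \<open>a\<^sup>3 + b\<^sup>3 + c\<^sup>3 =
  d\<^sup>3\<close>.\<close>

lemma ticket_1_3: "{1, 3} \<in> tickets 4 2"
proof -
  obtain T where T: "T \<in> tickets 4 2" "T \<in> {{1}, {1, 2}, {1, 3}, {1, 4}, {1, 2, 4}, {1, 2, 5}}"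
    and mem: "\<And>m. m \<in> T \<longleftrightarrow> m > 0 \<and> (\<exists>c1 c2 c3 c4. (c1, c2, c3, c4) \<noteq> (0, 0, 0, 0) \<and>
       (\<forall>x y. c1 * quad (3, 5, - 5) x y ^ m + c2 * quad (4, - 4, 6) x y ^ m + c3 * quad (5, - 5, - 3) x y ^ m
         + c4 * quad (6, - 4, 4) x y ^ m = 0))"
    by (rule ticket_of_forms[of "(3, 5, - 5)" "(4, - 4, 6)" "(5, - 5, - 3)" "(6, - 4, 4)"]) auto
  have rel: "1 * quad (3, 5, - 5) x y ^ 3 + 1 * quad (4, - 4, 6) x y ^ 3 + 1 * quad (5, - 5, - 3) x y ^ 3
       + (- 1) * quad (6, - 4, 4) x y ^ 3 = 0" for x y
    unfolding quad.simps by algebra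
  have "3 \<in> T"
    unfolding mem by (rule relation_witness[OF _ _ rel]) simp_all
  then have "T = {1, 3}"
    using T(2) by auto
  then show ?thesis
    using T(1) by simp
qed

text \<open>If \<open>a + b = c\<close> and \<open>d\<^sup>2 = a\<^sup>2 + a b +
  b\<^sup>2\<close>, then \<open>a\<^sup>2 + b\<^sup>2 + c\<^sup>2 = 2 d\<^sup>2\<close> and
  \<open>a\<^sup>4 + b\<^sup>4 + c\<^sup>4 = 2 d\<^sup>4\<close>; the forms parametrise this
  conic.\<close>

lemma ticket_1_2_4: "{1, 2, 4} \<in> tickets 4 2"
proof -
  obtain T where T: "T \<in> tickets 4 2" "T \<in> {{1}, {1, 2}, {1, 3}, {1, 4}, {1, 2, 4}, {1, 2, 5}}"
    and mem: "\<And>m. m \<in> T \<longleftrightarrow> m > 0 \<and> (\<exists>c1 c2 c3 c4. (c1, c2, c3, c4) \<noteq> (0, 0, 0, 0) \<and>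
       (\<forall>x y. c1 * quad (1, 0, - 1) x y ^ m + c2 * quad (0, 2, 1) x y ^ m + c3 * quad (1, 2, 0) x y ^ m
         + c4 * quad (1, 1, 1) x y ^ m = 0))"
    by (rule ticket_of_forms[of "(1, 0, - 1)" "(0, 2, 1)" "(1, 2, 0)" "(1, 1, 1)"]) auto
  have rel: "1 * quad (1, 0, - 1) x y ^ 2 + 1 * quad (0, 2, 1) x y ^ 2 + 1 * quad (1, 2, 0) x y ^ 2
       + (- 2) * quad (1, 1, 1) x y ^ 2 = 0" 
    "1 * quad (1, 0, - 1) x y ^ 4 + 1 * quad (0, 2, 1) x y ^ 4 + 1 * quad (1, 2, 0) x y ^ 4
       + (- 2) * quad (1, 1, 1) x y ^ 4 = 0" for x y
    unfolding quad.simps by algebra+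
  have "2 \<in> T" "4 \<in> T"
    unfolding mem by (rule relation_witness[OF _ _ rel(1)], simp, simp, rule relation_witness[OF _ _ rel(2)], simp_all)
  then have "T = {1, 2, 4}"
    using T(2) by auto
  then show ?thesis
    using T(1) by simp
qed

text \<open>The family of \<open>quintic_square\<close> with \<open>\<beta>\<^sup>4 = 1\<close>,
  scaled by 2.\<close>

lemma ticket_1_2_5: "{1, 2, 5} \<in> tickets 4 2"
proof -
  obtain T where T: "T \<in> tickets 4 2" "T \<in> {{1}, {1, 2}, {1, 3}, {1, 4}, {1, 2, 4}, {1, 2, 5}}"
    and mem: "\<And>m. m \<in> T \<longleftrightarrow> m > 0 \<and> (\<exists>c1 c2 c3 c4. (c1, c2, c3, c4) \<noteq> (0, 0, 0, 0) \<and>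
       (\<forall>x y. c1 * quad (- 1, 2, 2) x y ^ m + c2 * quad (- 1, - 2, 2) x y ^ m + c3 * quad (1, 2 * \<i>, 2) x y ^ m
         + c4 * quad (1, - 2 * \<i>, 2) x y ^ m = 0))"
    by (rule ticket_of_forms[of "(- 1, 2, 2)" "(- 1, - 2, 2)" "(1, 2 * \<i>, 2)" "(1, - 2 * \<i>, 2)"])
      (auto simp: complex_eq_iff)
  have gen: "1 * quad (- 1, 2, 2) x y ^ 5 + (- 1) * quad (- 1, - 2, 2) x y ^ 5 + w * quad (1, 2 * w, 2) x y ^ 5
         + (- w) * quad (1, - 2 * w, 2) x y ^ 5 = 0" if "w\<^sup>2 = - 1" for w x y
    using that unfolding quad.simps by algebra
  note rel = gen[of \<i>, OF power2_i]
  have "5 \<in> T"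
    unfolding mem by (rule relation_witness[OF _ _ rel]) simp_all
  then have "T = {1, 2, 5}"
    using T(2) by auto
  then show ?thesis
    using T(1) by simp
qed

text \<open>For \<open>s\<^sup>2 = -3\<close> the difference \<open>(x\<^sup>2 + s x y +
  y\<^sup>2)\<^sup>4 - (x\<^sup>2 - s x y + y\<^sup>2)\<^sup>4\<close> is \<open>8 s x y
  (x\<^sup>6 + y\<^sup>6)\<close>. The substitution \<open>x \<mapsto> \<omega> x\<close> with a
  primitive cube root of unity \<open>\<omega>\<close> multiplies it by \<open>\<omega>\<close>
  and moves the two forms.\<close>

lemma ticket_1_4: "{1, 4} \<in> tickets 4 2"
proof -
  obtain z :: complex where z: "z\<^sup>2 = - 3"
    using power2_csqrt by blast
  define \<omega> where "\<omega> = (z - 1) / 2"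
  have w: "\<omega>\<^sup>2 + \<omega> + 1 = 0"
  proof -
    have "(2 * \<omega> + 1)\<^sup>2 = - 3"
      using z by (simp add: \<omega>_def diff_divide_distrib)
    then show ?thesis
      by algebra
  qed
  define s where "s = 1 + 2 * \<omega>"
  have s: "s\<^sup>2 = - 3"
    using w unfolding s_def by algebra
  have nz: "s \<noteq> 0" "\<omega> \<noteq> 0" "\<omega>\<^sup>2 \<noteq> 1" "\<omega> \<noteq> 1"
  proof -
    show "s \<noteq> 0" "\<omega> \<noteq> 0" "\<omega> \<noteq> 1"
      using s w by auto
    show "\<omega>\<^sup>2 \<noteq> 1"
    proof
      assume "\<omega>\<^sup>2 = 1"
      then have "\<omega> = - 2"
        using w by algebra
      then show False
        using w by simp
    qed
  qed
  obtain T where T: "T \<in> tickets 4 2" "T \<in> {{1}, {1, 2}, {1, 3}, {1, 4}, {1, 2, 4}, {1, 2, 5}}"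
    and mem: "\<And>m. m \<in> T \<longleftrightarrow> m > 0 \<and> (\<exists>c1 c2 c3 c4. (c1, c2, c3, c4) \<noteq> (0, 0, 0, 0) \<and>
       (\<forall>x y. c1 * quad (1, s, 1) x y ^ m + c2 * quad (1, - s, 1) x y ^ m + c3 * quad (\<omega>\<^sup>2, s * \<omega>, 1) x y ^ m
         + c4 * quad (\<omega>\<^sup>2, - (s * \<omega>), 1) x y ^ m = 0))"
    by (rule ticket_of_forms[of "(1, s, 1)" "(1, - s, 1)" "(\<omega>\<^sup>2, s * \<omega>, 1)" "(\<omega>\<^sup>2, - (s * \<omega>), 1)"])
      (use nz in auto)
  have rel: "1 * quad (1, s, 1) x y ^ 4 + (- 1) * quad (1, - s, 1) x y ^ 4 + (- (\<omega>\<^sup>2)) * quad (\<omega>\<^sup>2, s * \<omega>, 1) x y ^ 4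
         + \<omega>\<^sup>2 * quad (\<omega>\<^sup>2, - (s * \<omega>), 1) x y ^ 4 = 0" for x y
    using w s unfolding quad.simps by algebra
  have "4 \<in> T"
    unfolding mem by (rule relation_witness[OF _ _ rel]) simp_all
  moreover have "2 \<notin> T"
  proof
    assume "2 \<in> T"
    then obtain c1 c2 c3 c4 where c: "(c1, c2, c3, c4) \<noteq> (0, 0, 0, 0)"
      and e: "\<And>x y. c1 * quad (1, s, 1) x y ^ 2 + c2 * quad (1, - s, 1) x y ^ 2 + c3 * quad (\<omega>\<^sup>2, s * \<omega>, 1) x y ^ 2
         + c4 * quad (\<omega>\<^sup>2, - (s * \<omega>), 1) x y ^ 2 = 0"
      unfolding mem by blast
    have e0: "c1 + c2 + c3 + c4 = 0" "c1 + c2 + \<omega> * (c3 + c4) = 0"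
    proof -
      show "c1 + c2 + c3 + c4 = 0"
        using e[of 0 1] by simp
      have "c1 + c2 + (\<omega>\<^sup>2)\<^sup>2 * c3 + (\<omega>\<^sup>2)\<^sup>2 * c4 = 0"
        using e[of 1 0] by (simp add: mult.commute)
      moreover have "(\<omega>\<^sup>2)\<^sup>2 = \<omega>"
        using w by algebra
      ultimately show "c1 + c2 + \<omega> * (c3 + c4) = 0"
        by (simp add: algebra_simps)
    qed
    have odd: "x * s * ((c1 - c2) * (x\<^sup>2 + 1) + \<omega> * (c3 - c4) * (\<omega>\<^sup>2 * x\<^sup>2 + 1)) = 0" for x
    proof -
      let ?e = "\<lambda>x. c1 * (x\<^sup>2 + s * x + 1)\<^sup>2 + c2 * (x\<^sup>2 - s * x + 1)\<^sup>2 +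
        c3 * (\<omega>\<^sup>2 * x\<^sup>2 + s * \<omega> * x + 1)\<^sup>2 + c4 * (\<omega>\<^sup>2 * x\<^sup>2 - s * \<omega> * x + 1)\<^sup>2"
      have e0: "?e x = 0" for x
        using e[of x 1] by simp
      have "4 * (x * s * ((c1 - c2) * (x\<^sup>2 + 1) + \<omega> * (c3 - c4) * (\<omega>\<^sup>2 * x\<^sup>2 + 1))) = ?e x - ?e (- x)"
        by algebra
      also have "\<dots> = 0"
        unfolding e0 by simp
      finally show ?thesis
        by simp
    qed
    have d1: "(c1 - c2) * 2 + \<omega> * (c3 - c4) * (\<omega>\<^sup>2 + 1) = 0" and d2: "(c1 - c2) * 5 + \<omega> * (c3 - c4) * (\<omega>\<^sup>2 * 4 + 1) = 0"
      using odd[of 1] odd[of 2] nz by (simp_all add: add.commute)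
    have "(c3 - c4) * (\<omega> * (1 - \<omega>\<^sup>2)) = 0"
      using d1 d2 by algebra
    then have c34: "c3 = c4"
      using nz by simp
    then have c12: "c1 = c2"
      using d1 by simp
    have "(\<omega> - 1) * (c3 + c4) = 0"
      using e0 by algebra
    then have "c3 + c4 = 0"
      using nz by simp
    then have "c3 = 0" "c1 = 0"
      using c34 c12 e0 by simp_all
    then show False
      using c c34 c12 by simp
  qed
  ultimately have "T = {1, 4}"
    using T(2) by auto
  then show ?thesis
    using T(1) by simp
qed

theorem theorem4:
  "tickets 4 2 = {{1}, {1, 2}, {1, 3}, {1, 4}, {1, 2, 4}, {1, 2, 5}}"
proof
  show "tickets 4 2 \<subseteq> {{1}, {1, 2}, {1, 3}, {1, 4}, {1, 2, 4}, {1, 2, 5}}"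
  proof
    fix T assume "T \<in> tickets 4 2"
    then obtain F where "F \<in> families 4 2" "T = ticket F"
      unfolding tickets_def by blast
    then show "T \<in> {{1}, {1, 2}, {1, 3}, {1, 4}, {1, 2, 4}, {1, 2, 5}}"
      using ticket_cases by (simp only:)
  qed
  show "{{1}, {1, 2}, {1, 3}, {1, 4}, {1, 2, 4}, {1, 2, 5}} \<subseteq> tickets 4 2"
    using ticket_1 ticket_1_2 ticket_1_3 ticket_1_4 ticket_1_2_4 ticket_1_2_5
    by (simp only: insert_subset empty_subsetI simp_thms)
qed

end
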